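(* Let $G\subset\mathbb{Z}^d/(2\mathbb{Z}^d)$ be a separable group with $k$ generators, thus of order $2^k$. Let $N$ be a subset of $\mathbb{Z}^d$ such that $|N\cap\mathrm{orbit}(x)|=1$ for all $x\in\mathbb{Z}^d$, and for $\gamma\in N$ set $c_\gamma=2^{-k}|\mathrm{orbit}(\gamma)|^{1/2}$. Let $g\in L^2(\mathbb{R}^d)$ be separable with respect to $G$ with $\hat g(\omega)=\overline{\hat g(\omega)}$ for a.e. $\omega\in\mathbb{R}^d$, and consider the Wilson system $$\mathcal{W}(g,G)=\Big\{T_\lambda T_{\frac12h}\,c_\gamma\sum_{\sigma\in G}(-1)^{\langle I(h)+\gamma,\sigma\rangle}M_{R_\sigma\gamma}g\Big\}_{\lambda\in\mathbb{Z}^d,\ h\in G,\ \gamma\in N},$$ where members of the family that are the zero function are disregarded (removed). If $\mathcal{W}(g,G)$ is a frame for $L^2(\mathbb{R}^d)$ with bounds $a$ and $b$, then $\mathcal{W}(g,G)$ is a Riesz basis for $L^2(\mathbb{R}^d)$ with bounds $a$ and $b$.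
   Context: Operators: $T_\lambda f(x)=f(x-\lambda)$, $M_\gamma f(x)=e^{2\pi i\langle x,\gamma\rangle}f(x)$ for $\lambda,\gamma\in\mathbb{R}^d$; $\hat f$ is the unitary extension to $L^2(\mathbb{R}^d)$ of $\hat f(\omega)=\int f(x)e^{-2\pi i\langle\omega,x\rangle}dx$. Reflections: for $\sigma\in\mathbb{Z}^d$, $R_\sigma x=((-1)^{\sigma_1}x_1,\dots,(-1)^{\sigma_d}x_d)$ on $\mathbb{R}^d$; it depends only on $\sigma$ mod $2\mathbb{Z}^d$, so is defined for $\sigma\in\mathbb{Z}^d/(2\mathbb{Z}^d)$; elements of this group are identified with coset representatives in $\{0,1\}^d$. For a subgroup $G$, $\mathrm{orbit}(x)=\{R_\sigma x:\sigma\in G\}$. Separable groups: $[d]=\{1,\dots,d\}$, $\mathrm{supp}\,\sigma=\{i\in[d]:\sigma_i\equiv1\bmod2\}$. A subgroup $G$ is separable if it has generators $\sigma^1,\dots,\sigma^k$ with non-empty supports $S_i=\mathrm{supp}\,\sigma^i$ that are pairwise disjoint; $S_0=[d]\setminus\bigcup_{i=1}^kS_i$ (possibly empty). Separable functions: for $S=\{s_1<\dots<s_m\}\subset[d]$, $P_S(x)=(x_{s_1},\dots,x_{s_m})$. A function $g:\mathbb{R}^d\to\mathbb{C}$ is separable with respect to $G$ if there are functions $g_i:\mathbb{R}^{|S_i|}\to\mathbb{C}$, $i=0,\dots,k$, with $g(x)=\prod_{i=0}^kg_i(P_{S_i}x)$ (if $S_0=\emptyset$, $g_0$ is a constant). Dual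 group and $I$: let $\Lambda=\bigcup_{\sigma\in G}(\sigma+2\mathbb{Z}^d)$ and $\Lambda^\perp=\{\beta\in\mathbb{R}^d:\langle\beta,\lambda\rangle\in\mathbb{Z}\ \forall\lambda\in\Lambda\}$. The dual group $\widehat G$ is identified with $\mathbb{Z}^d/(2\Lambda^\perp)$ through the pairing $(-1)^{\langle\alpha,\sigma\rangle}$. $I:G\to\widehat G$ is the group isomorphism determined by $\langle I(\sigma^i),\sigma^j\rangle\equiv\delta_{i,j}\bmod2$; explicitly, choosing $n_i\in S_i$, $I(\sigma^i)$ is the class of the standard basis vector $\delta_{n_i}$. Elements of $\widehat G$ are identified with a fixed choice of representatives in $\mathbb{Z}^d$. Frame theory: a countable family $\{f_j\}$ in $L^2(\mathbb{R}^d)$ is a frame with bounds $a,b>0$ if $a\|f\|^2\le\sum_j|\langle f,f_j\rangle|^2\le b\|f\|^2$ for all $f$; a Riesz basis with bounds $a,b>0$ if its span is dense and $a\sum|c_j|^2\le\|\sum c_jf_j\|^2\le b\sum|c_j|^2$ for all finitely supported $(c_j)$. *)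

theory Defs
  imports "HOL-Analysis.Analysis" "HOL-Algebra.Coset" "HOL-Algebra.Generated_Groups"
begin

text \<open>
  Elements of the Hilbert space are represented by Lebesgue measurable functions, and identities
  between them are understood almost everywhere. Both l2_norm and l2_inner are meaningful only on
  members of L2, since the Bochner integral of a non-integrable function is 0.
\<close>

definition L2 :: "('a::euclidean_space \<Rightarrow> complex) set" where
  "L2 = {f. f \<in> borel_measurable lebesgue \<and> integrable lebesgue (\<lambda>x. (norm (f x))\<^sup>2)}"

definition l2_norm :: "('a::euclidean_space \<Rightarrow> complex) \<Rightarrow> real" where
  "l2_norm f = sqrt (LINT x|lebesgue. (norm (f x))\<^sup>2)"

definition l2_inner :: "('a::euclidean_space \<Rightarrow> complex) \<Rightarrow> ('a \<Rightarrow> complex) \<Rightarrow> complex" where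
  "l2_inner f g = (LINT x|lebesgue. f x * cnj (g x))"

definition is_frame ::
    "'j set \<Rightarrow> ('j \<Rightarrow> 'a::euclidean_space \<Rightarrow> complex) \<Rightarrow> real \<Rightarrow> real \<Rightarrow> bool" where
  "is_frame J e a b \<longleftrightarrow>
     countable J \<and> (\<forall>j\<in>J. e j \<in> L2) \<and> 0 < a \<and> 0 < b \<and>
     (\<forall>f\<in>L2. (\<lambda>j. (norm (l2_inner f (e j)))\<^sup>2) summable_on J \<and>
        a * (l2_norm f)\<^sup>2 \<le> (\<Sum>\<^sub>\<infinity>j\<in>J. (norm (l2_inner f (e j)))\<^sup>2) \<and>
        (\<Sum>\<^sub>\<infinity>j\<in>J. (norm (l2_inner f (e j)))\<^sup>2) \<le> b * (l2_norm f)\<^sup>2)"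

definition is_riesz_basis ::
    "'j set \<Rightarrow> ('j \<Rightarrow> 'a::euclidean_space \<Rightarrow> complex) \<Rightarrow> real \<Rightarrow> real \<Rightarrow> bool" where
  "is_riesz_basis J e a b \<longleftrightarrow>
     countable J \<and> (\<forall>j\<in>J. e j \<in> L2) \<and> 0 < a \<and> 0 < b \<and>
     (\<forall>f\<in>L2. \<forall>\<epsilon>>0. \<exists>F c. finite F \<and> F \<subseteq> J \<and>
        l2_norm (\<lambda>x. f x - (\<Sum>j\<in>F. c j * e j x)) < \<epsilon>) \<and>
     (\<forall>F c. finite F \<and> F \<subseteq> J \<longrightarrow>
        a * (\<Sum>j\<in>F. (norm (c j))\<^sup>2) \<le> (l2_norm (\<lambda>x. \<Sum>j\<in>F. c j * e j x))\<^sup>2 \<and>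
        (l2_norm (\<lambda>x. \<Sum>j\<in>F. c j * e j x))\<^sup>2 \<le> b * (\<Sum>j\<in>F. (norm (c j))\<^sup>2))"

definition translate :: "real^'n \<Rightarrow> (real^'n \<Rightarrow> complex) \<Rightarrow> real^'n \<Rightarrow> complex" where
  "translate l f = (\<lambda>x. f (x - l))"

definition modulate :: "real^'n \<Rightarrow> (real^'n \<Rightarrow> complex) \<Rightarrow> real^'n \<Rightarrow> complex" where
  "modulate \<gamma> f = (\<lambda>x. cis (2 * pi * (x \<bullet> \<gamma>)) * f x)"

definition fourier :: "(real^'n \<Rightarrow> complex) \<Rightarrow> real^'n \<Rightarrow> complex" where
  "fourier f \<omega> = (LINT x|lebesgue. f x * cis (- (2 * pi * (\<omega> \<bullet> x))))"

text \<open>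
  The graph of the unitary extension of the Fourier integral: F is the transform of f if some
  integrable and square-integrable functions converge to f in mean square while their Fourier
  integrals converge to F in mean square. By Plancherel, every f in L2 has such an F, F is unique
  almost everywhere, and the demand that the Fourier integrals be in L2 (needed because of the
  convention for l2_norm) is automatically met.
\<close>

definition has_fourier_L2 :: "(real^'n \<Rightarrow> complex) \<Rightarrow> (real^'n \<Rightarrow> complex) \<Rightarrow> bool" where
  "has_fourier_L2 f F \<longleftrightarrow> f \<in> L2 \<and> F \<in> L2 \<and>
     (\<exists>\<phi>. (\<forall>n::nat. integrable lebesgue (\<phi> n) \<and> \<phi> n \<in> L2 \<and> fourier (\<phi> n) \<in> L2) \<and>
        (\<lambda>n. l2_norm (\<lambda>x. \<phi> n x - f x)) \<longlonglongrightarrow> 0 \<and>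
        (\<lambda>n. l2_norm (\<lambda>\<omega>. fourier (\<phi> n) \<omega> - F \<omega>)) \<longlonglongrightarrow> 0)"

definition real_vec :: "int^'n \<Rightarrow> real^'n" where
  "real_vec \<alpha> = (\<chi> i. real_of_int (\<alpha> $ i))"

definition int_inner :: "int^'n \<Rightarrow> int^'n \<Rightarrow> int" where
  "int_inner \<alpha> \<beta> = (\<Sum>i\<in>UNIV. \<alpha> $ i * \<beta> $ i)"

text \<open>The group of integer vectors modulo 2, on coset representatives with entries 0 and 1.\<close>

definition parity_group :: "(int^'n) monoid" where
  "parity_group = \<lparr>carrier = {\<sigma>. \<forall>i. \<sigma> $ i \<in> {0, 1}},
     monoid.mult = (\<lambda>\<sigma> \<tau>. \<chi> i. (\<sigma> $ i + \<tau> $ i) mod 2), one = 0\<rparr>"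

definition reflect :: "int^'n \<Rightarrow> int^'n \<Rightarrow> int^'n" where
  "reflect \<sigma> x = (\<chi> i. if odd (\<sigma> $ i) then - x $ i else x $ i)"

definition refl_orbit :: "(int^'n) set \<Rightarrow> int^'n \<Rightarrow> (int^'n) set" where
  "refl_orbit G x = {reflect \<sigma> x | \<sigma>. \<sigma> \<in> G}"

definition supp :: "int^'n \<Rightarrow> 'n set" where
  "supp \<sigma> = {i. odd (\<sigma> $ i)}"

text \<open>
  The group G is separable, as witnessed by the generators s 1, ..., s k. These are unique up to
  order, their supports being the minimal non-empty supports of elements of G.
\<close>

definition separable_generators :: "(int^'n) set \<Rightarrow> nat \<Rightarrow> (nat \<Rightarrow> int^'n) \<Rightarrow> bool" where
  "separable_generators G k s \<longleftrightarrow>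
     subgroup G parity_group \<and>
     s ` {1..k} \<subseteq> carrier parity_group \<and> generate parity_group (s ` {1..k}) = G \<and>
     (\<forall>i\<in>{1..k}. supp (s i) \<noteq> {}) \<and> disjoint_family_on (\<lambda>i. supp (s i)) {1..k}"

definition coord_block :: "nat \<Rightarrow> (nat \<Rightarrow> int^'n) \<Rightarrow> nat \<Rightarrow> 'n set" where
  "coord_block k s i = (if i = 0 then UNIV - (\<Union>j\<in>{1..k}. supp (s j)) else supp (s i))"

text \<open>
  The coordinate projection of x to a set S of coordinates is the tuple indexed by S itself, that
  is, an element of the set of functions from S to the reals, rather than one indexed by an
  initial segment of the natural numbers. For empty S it is constant.
\<close>

definition coord_proj :: "'n set \<Rightarrow> real^'n \<Rightarrow> 'n \<Rightarrow> real" where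
  "coord_proj S x = restrict (\<lambda>i. x $ i) S"

definition separable_fun :: "nat \<Rightarrow> (nat \<Rightarrow> int^'n) \<Rightarrow> (real^'n \<Rightarrow> complex) \<Rightarrow> bool" where
  "separable_fun k s g \<longleftrightarrow>
     (\<exists>\<phi>. \<forall>x. g x = (\<Prod>i=0..k. \<phi> i (coord_proj (coord_block k s i) x)))"

definition int_vec_group :: "(int^'n) monoid" where
  "int_vec_group = \<lparr>carrier = UNIV, monoid.mult = (+), one = 0\<rparr>"

definition lattice_of :: "(int^'n) set \<Rightarrow> (int^'n) set" where
  "lattice_of G = (\<Union>\<sigma>\<in>G. {\<sigma> + 2 *s \<mu> | \<mu>. True})"

definition dual_lattice :: "(int^'n) set \<Rightarrow> (real^'n) set" where
  "dual_lattice L = {\<beta>. \<forall>l\<in>L. \<beta> \<bullet> real_vec l \<in> \<int>}"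

definition twice_dual :: "(int^'n) set \<Rightarrow> (int^'n) set" where
  "twice_dual G = {\<alpha>. \<exists>\<beta>\<in>dual_lattice (lattice_of G). real_vec \<alpha> = 2 *\<^sub>R \<beta>}"

definition dual_group :: "(int^'n) set \<Rightarrow> (int^'n) set monoid" where
  "dual_group G = int_vec_group Mod twice_dual G"

text \<open>
  I sends an element of G to an integer vector representing its image in the dual group; the
  choice of representatives is arbitrary.
\<close>

definition dual_iso_rep ::
    "(int^'n) set \<Rightarrow> nat \<Rightarrow> (nat \<Rightarrow> int^'n) \<Rightarrow> (int^'n \<Rightarrow> int^'n) \<Rightarrow> bool" where
  "dual_iso_rep G k s I \<longleftrightarrow>
     (\<lambda>h. twice_dual G #>\<^bsub>int_vec_group\<^esub> I h)
        \<in> iso (parity_group\<lparr>carrier := G\<rparr>) (dual_group G) \<and>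
     (\<forall>i\<in>{1..k}. \<forall>j\<in>{1..k}. int_inner (I (s i)) (s j) mod 2 = (if i = j then 1 else 0))"

definition wilson_const :: "nat \<Rightarrow> (int^'n) set \<Rightarrow> int^'n \<Rightarrow> real" where
  "wilson_const k G \<gamma> = (1 / 2 ^ k) * sqrt (real (card (refl_orbit G \<gamma>)))"

definition wilson ::
    "nat \<Rightarrow> (int^'n) set \<Rightarrow> (int^'n \<Rightarrow> int^'n) \<Rightarrow> (real^'n \<Rightarrow> complex) \<Rightarrow>
     (int^'n) \<times> (int^'n) \<times> (int^'n) \<Rightarrow> real^'n \<Rightarrow> complex" where
  "wilson k G I g = (\<lambda>(l, h, \<gamma>).
     translate (real_vec l) (translate ((1/2) *\<^sub>R real_vec h)
       (\<lambda>x. complex_of_real (wilson_const k G \<gamma>) *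
          (\<Sum>\<sigma>\<in>G. (-1) powi (int_inner (I h + \<gamma>) \<sigma>) *
             modulate (real_vec (reflect \<sigma> \<gamma>)) g x))))"

text \<open>Members that are zero as elements of L2 are removed, hence the almost-everywhere condition.\<close>

definition wilson_index ::
    "nat \<Rightarrow> (int^'n) set \<Rightarrow> (int^'n \<Rightarrow> int^'n) \<Rightarrow> (int^'n) set \<Rightarrow> (real^'n \<Rightarrow> complex) \<Rightarrow>
     ((int^'n) \<times> (int^'n) \<times> (int^'n)) set" where
  "wilson_index k G I N g =
     {j \<in> UNIV \<times> G \<times> N. \<not> (AE x in lebesgue. wilson k G I g j x = 0)}"

end

theory Submission
  imports Defs
begin

text \<open>
  The idea. A finite Wilson combination has the form \<open>F(x) = \<Sum>(l,h). E(l,h)(x) g(x - l - h/2)\<close> with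
  trigonometric polynomials \<open>E(l,h)\<close> that are multiplied by the sign \<open>(-1)^<I(h),\<sigma>>\<close> under the isometry
  \<open>x \<mapsto> R\<^sub>\<sigma>(x + \<sigma>/2)\<close>. Averaging \<open>|F|\<^sup>2\<close> over these isometries and over the integer lattice gives a
  quadratic form in the values \<open>E(l,h)(x)\<close> at a single point of the unit cube. Because \<open>g\<close> is separable
  and its transform is real, \<open>g(p) cnj(g(q))\<close> is invariant under reflecting the coordinates in \<open>supp \<sigma>\<close> and
  swapping \<open>p\<close> and \<open>q\<close> there. This makes the form diagonal in \<open>h\<close>, and its \<open>h\<close>-th block is
  the form that bounds the frame sum of \<open>f(x + l) = E(l,h)(x)\<close> from above (Cauchy--Schwarz and Bessel).
  Hence the lower frame bound yields some positive lower Riesz bound \<open>a\<^sub>0\<close>, usually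
  worse than \<open>a\<close>. A frame satisfying any positive lower Riesz bound satisfies the one with its
  lower frame bound \<open>a\<close>: if \<open>a\<^sub>1 < a\<close> is a lower Riesz bound, apply it to \<open>c - t y\<close>, where \<open>y\<close> is the frame
  analysis of \<open>\<Sum> c\<^sub>j e\<^sub>j\<close> and \<open>t\<close> is small, to obtain a larger lower Riesz bound.
\<close>

text \<open>The invariance rests on a splitting of \<open>g\<close> as
  \<open>\<alpha> x * \<beta> x\<close>, where \<open>\<alpha>\<close> sees only the coordinates in
  \<open>supp \<sigma>\<close> and \<open>\<beta>\<close> only the others. Reality of the transform
  means \<open>g (- x) = cnj (g x)\<close> almost everywhere; freezing the other coordinates yields
  \<open>\<alpha> (- p) = c * cnj (\<alpha> p)\<close> with one constant \<open>c\<close> of modulus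
  1, and \<open>c\<close> drops out of \<open>\<alpha> p * cnj (\<alpha> q)\<close>. The form is
  diagonal for the following reason. If \<open>h\<close> and \<open>h'\<close> differ on the block
  of a generator, their half shifts there add up to 1/2. Composing with the isometry of that
  generator then acts on a pair of points, up to a common integer vector, exactly as reflecting and
  swapping the block. So the entry of the form is unchanged while the product of the two signs is
  reversed. The points \<open>p\<close> and \<open>q\<close> that occur differ by a half-integer
  vector, and such pairs form a null set in the space of pairs. A statement about almost all pairs
  would therefore say nothing: the invariance has to hold for all pairs from one set of full
  measure.\<close>

subsection \<open>Frames and Riesz bases\<close>

lemma borel_measurable_cnj [measurable (raw)]:
  "f \<in> borel_measurable M \<Longrightarrow> (\<lambda>x. cnj (f x)) \<in> borel_measurable M"
  by (rule borel_measurable_continuous_on[of cnj]) (intro continuous_intros)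

lemma cmod_diff_squared: "(cmod (u - v))\<^sup>2 = (cmod u)\<^sup>2 - 2 * Re (u * cnj v) + (cmod v)\<^sup>2"
  unfolding cmod_power2 by (simp add: power2_eq_square algebra_simps)

lemma integrable_mult_cnj:
  fixes f g :: "'a \<Rightarrow> complex"
  assumes [measurable]: "f \<in> borel_measurable M" "g \<in> borel_measurable M"
    and f: "integrable M (\<lambda>x. (norm (f x))\<^sup>2)" and g: "integrable M (\<lambda>x. (norm (g x))\<^sup>2)"
  shows "integrable M (\<lambda>x. f x * cnj (g x))"
proof (rule Bochner_Integration.integrable_bound[OF Bochner_Integration.integrable_add[OF f g]])
  have "norm (f x) * norm (g x) \<le> (norm (f x))\<^sup>2 + (norm (g x))\<^sup>2" for x
    using sum_squares_bound[of "norm (f x)" "norm (g x)"]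
      mult_nonneg_nonneg[of "norm (f x)" "norm (g x)"] norm_ge_zero[of "f x"] norm_ge_zero[of "g x"]
    by linarith
  then show "AE x in M. norm (f x * cnj (g x)) \<le> norm ((norm (f x))\<^sup>2 + (norm (g x))\<^sup>2)"
    by (auto simp: norm_mult)
qed simp

lemma integrable_norm_sum_sq:
  fixes f :: "'i \<Rightarrow> 'a \<Rightarrow> complex"
  assumes "finite F" and "\<And>i. i \<in> F \<Longrightarrow> f i \<in> borel_measurable M"
    and "\<And>i. i \<in> F \<Longrightarrow> integrable M (\<lambda>x. (norm (f i x))\<^sup>2)"
  shows "integrable M (\<lambda>x. (norm (\<Sum>i\<in>F. f i x))\<^sup>2)"
proof (rule Bochner_Integration.integrable_bound)
  show "integrable M (\<lambda>x. real (card F) * (\<Sum>i\<in>F. (norm (f i x))\<^sup>2))"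
    using assms by auto
  show "(\<lambda>x. (norm (\<Sum>i\<in>F. f i x))\<^sup>2) \<in> borel_measurable M"
    using assms(2) by measurable
  have "(norm (\<Sum>i\<in>F. f i x))\<^sup>2 \<le> real (card F) * (\<Sum>i\<in>F. (norm (f i x))\<^sup>2)" for x
  proof -
    have "(norm (\<Sum>i\<in>F. f i x))\<^sup>2 \<le> (\<Sum>i\<in>F. norm (f i x))\<^sup>2"
      by (intro power_mono norm_sum) auto
    also have "\<dots> \<le> real (card F) * (\<Sum>i\<in>F. (norm (f i x))\<^sup>2)"
      using sum_squared_le_sum_of_squares[of "\<lambda>i. norm (f i x)" F] assms(1)
      by (simp add: mult.commute)
    finally show ?thesis .
  qed
  then show "AE x in M. norm ((norm (\<Sum>i\<in>F. f i x))\<^sup>2) \<le> norm (real (card F) * (\<Sum>i\<in>F. (norm (f i x))\<^sup>2))"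
    by (auto intro!: AE_I2 intro: order_trans[OF _ abs_ge_self])
qed

lemma L2_scale: "f \<in> L2 \<Longrightarrow> (\<lambda>x. c * f x) \<in> L2"
  by (auto simp: L2_def norm_mult power_mult_distrib)

lemma L2_sum: "finite F \<Longrightarrow> (\<And>j. j \<in> F \<Longrightarrow> f j \<in> L2) \<Longrightarrow> (\<lambda>x. \<Sum>j\<in>F. f j x) \<in> L2"
  unfolding L2_def using integrable_norm_sum_sq[of F f lebesgue] by (auto intro!: borel_measurable_sum)

lemma L2_add: "f \<in> L2 \<Longrightarrow> g \<in> L2 \<Longrightarrow> (\<lambda>x. f x + g x) \<in> L2"
  using L2_sum[of "{True, False}" "\<lambda>b. if b then f else g"] by simp

lemma L2_diff: "f \<in> L2 \<Longrightarrow> g \<in> L2 \<Longrightarrow> (\<lambda>x. f x - g x) \<in> L2"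
  using L2_add[of f "\<lambda>x. (-1) * g x"] L2_scale[of g "-1"] by simp

lemma L2_lincomb: "finite F \<Longrightarrow> (\<And>j. j \<in> F \<Longrightarrow> e j \<in> L2) \<Longrightarrow> (\<lambda>x. \<Sum>j\<in>F. c j * e j x) \<in> L2"
  by (intro L2_sum L2_scale)

lemma L2_inner_integrable: "f \<in> L2 \<Longrightarrow> g \<in> L2 \<Longrightarrow> integrable lebesgue (\<lambda>x. f x * cnj (g x))"
  unfolding L2_def by (auto intro: integrable_mult_cnj)

lemma l2_norm_nonneg: "0 \<le> l2_norm f"
  by (simp add: l2_norm_def)

lemma l2_norm_sq: "(l2_norm f)\<^sup>2 = (LINT x|lebesgue. (norm (f x))\<^sup>2)"
  by (simp add: l2_norm_def)

lemma l2_inner_self: "l2_inner f f = of_real ((l2_norm f)\<^sup>2)"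
  unfolding l2_inner_def l2_norm_sq
  by (subst integral_complex_of_real[symmetric]) (simp only: complex_norm_square)

lemma l2_inner_lincomb_right:
  assumes "f \<in> L2" "finite F" "\<And>j. j \<in> F \<Longrightarrow> e j \<in> L2"
  shows "l2_inner f (\<lambda>x. \<Sum>j\<in>F. c j * e j x) = (\<Sum>j\<in>F. cnj (c j) * l2_inner f (e j))"
proof -
  have "l2_inner f (\<lambda>x. \<Sum>j\<in>F. c j * e j x) = (LINT x|lebesgue. (\<Sum>j\<in>F. cnj (c j) * (f x * cnj (e j x))))"
    unfolding l2_inner_def by (simp add: sum_distrib_left algebra_simps)
  also have "\<dots> = (\<Sum>j\<in>F. cnj (c j) * l2_inner f (e j))"
    unfolding l2_inner_def using assms
    by (subst Bochner_Integration.integral_sum) (auto intro!: integrable_mult_right L2_inner_integrable)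
  finally show ?thesis .
qed

lemma l2_norm_diff_sq:
  assumes "f \<in> L2" "u \<in> L2"
  shows "(l2_norm (\<lambda>x. f x - u x))\<^sup>2 = (l2_norm f)\<^sup>2 - 2 * Re (l2_inner f u) + (l2_norm u)\<^sup>2"
proof -
  have i: "integrable lebesgue (\<lambda>x. (norm (f x))\<^sup>2)" "integrable lebesgue (\<lambda>x. (norm (u x))\<^sup>2)"
    "integrable lebesgue (\<lambda>x. f x * cnj (u x))"
    using assms by (auto simp: L2_def intro: L2_inner_integrable)
  have "(l2_norm (\<lambda>x. f x - u x))\<^sup>2 =
      (LINT x|lebesgue. (norm (f x))\<^sup>2 - 2 * Re (f x * cnj (u x)) + (norm (u x))\<^sup>2)"
    by (simp only: l2_norm_sq cmod_diff_squared)
  also have "\<dots> = (l2_norm f)\<^sup>2 - 2 * Re (l2_inner f u) + (l2_norm u)\<^sup>2"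
    using i integrable_Re[OF i(3)] integral_Re[OF i(3)]
    by (simp only: l2_norm_sq l2_inner_def Bochner_Integration.integral_add Bochner_Integration.integral_diff
        Bochner_Integration.integrable_diff integrable_mult_right integral_mult_right_zero)
  finally show ?thesis .
qed

lemma norm_l2_inner_le:
  assumes f: "f \<in> L2" and g: "g \<in> L2"
  shows "norm (l2_inner f g) \<le> l2_norm f * l2_norm g"
proof -
  have m [measurable]: "f \<in> borel_measurable lebesgue" "g \<in> borel_measurable lebesgue"
    and i: "integrable lebesgue (\<lambda>x. (norm (f x))\<^sup>2)" "integrable lebesgue (\<lambda>x. (norm (g x))\<^sup>2)"
    using assms by (auto simp: L2_def)
  have "ennreal (norm (l2_inner f g)) \<le> (\<integral>\<^sup>+x. norm (f x * cnj (g x)) \<partial>lebesgue)"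
    unfolding l2_inner_def by (rule integral_norm_bound_ennreal[OF L2_inner_integrable[OF f g]])
  also have "\<dots> = (\<integral>\<^sup>+x. ennreal (norm (f x)) * ennreal (norm (g x)) \<partial>lebesgue)"
    by (simp add: norm_mult ennreal_mult)
  finally have "(ennreal (norm (l2_inner f g)))\<^sup>2 \<le> (\<integral>\<^sup>+x. ennreal (norm (f x)) * ennreal (norm (g x)) \<partial>lebesgue)\<^sup>2"
    by (rule power_mono) simp
  also have "\<dots> \<le> (\<integral>\<^sup>+x. (ennreal (norm (f x)))\<^sup>2 \<partial>lebesgue) * (\<integral>\<^sup>+x. (ennreal (norm (g x)))\<^sup>2 \<partial>lebesgue)"
    by (rule Cauchy_Schwarz_nn_integral) auto
  also have "\<dots> = ennreal ((l2_norm f)\<^sup>2) * ennreal ((l2_norm g)\<^sup>2)"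
    using i by (simp add: l2_norm_sq ennreal_power nn_integral_eq_integral)
  finally have "(norm (l2_inner f g))\<^sup>2 \<le> (l2_norm f * l2_norm g)\<^sup>2"
    by (simp add: ennreal_power ennreal_mult[symmetric] power_mult_distrib)
  then show ?thesis
    by (rule power2_le_imp_le) (simp add: l2_norm_nonneg)
qed

text \<open>Synthesis is adjoint to analysis, so both have the same upper bound: pairing
  \<open>?u\<close> with itself and applying Cauchy-Schwarz to the coefficients bounds the square of
  \<open>(l2_norm ?u)\<^sup>2\<close> by \<open>b * ?C\<close> times
  \<open>(l2_norm ?u)\<^sup>2\<close>, and one factor cancels.\<close>

lemma l2_norm_lincomb_le:
  assumes fin: "finite F" and e: "\<And>j. j \<in> F \<Longrightarrow> e j \<in> L2" and b: "0 \<le> b"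
    and bes: "\<And>f. f \<in> L2 \<Longrightarrow> (\<Sum>j\<in>F. (norm (l2_inner f (e j)))\<^sup>2) \<le> b * (l2_norm f)\<^sup>2"
  shows "(l2_norm (\<lambda>x. \<Sum>j\<in>F. c j * e j x))\<^sup>2 \<le> b * (\<Sum>j\<in>F. (norm (c j))\<^sup>2)"
proof -
  let ?u = "\<lambda>x. \<Sum>j\<in>F. c j * e j x"
  have u: "?u \<in> L2" using fin e by (rule L2_lincomb)
  let ?C = "\<Sum>j\<in>F. (norm (c j))\<^sup>2"
  have "of_real ((l2_norm ?u)\<^sup>2) = (\<Sum>j\<in>F. cnj (c j) * l2_inner ?u (e j))"
    using l2_inner_lincomb_right[OF u fin, of e c] e by (simp add: l2_inner_self)
  from arg_cong[OF this, of norm] have "(l2_norm ?u)\<^sup>2 = norm (\<Sum>j\<in>F. cnj (c j) * l2_inner ?u (e j))"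
    by (simp only: norm_of_real abs_power2)
  also have "\<dots> \<le> (\<Sum>j\<in>F. norm (c j) * norm (l2_inner ?u (e j)))"
    by (rule order_trans[OF norm_sum]) (simp add: norm_mult)
  finally have "((l2_norm ?u)\<^sup>2)\<^sup>2 \<le> (\<Sum>j\<in>F. norm (c j) * norm (l2_inner ?u (e j)))\<^sup>2"
    by (rule power_mono) simp
  also have "\<dots> \<le> ?C * (\<Sum>j\<in>F. (norm (l2_inner ?u (e j)))\<^sup>2)"
    by (rule Cauchy_Schwarz_ineq_sum)
  also have "\<dots> \<le> ?C * (b * (l2_norm ?u)\<^sup>2)"
    using bes[OF u] by (intro mult_left_mono) (auto intro: sum_nonneg)
  finally have *: "(l2_norm ?u)\<^sup>2 * (l2_norm ?u)\<^sup>2 \<le> (b * ?C) * (l2_norm ?u)\<^sup>2"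
    by (simp only: power2_eq_square ac_simps)
  have "0 \<le> b * ?C" using b by (intro mult_nonneg_nonneg sum_nonneg) auto
  then show ?thesis
    using mult_right_le_imp_le[OF *] by (cases "l2_norm ?u = 0") auto
qed

lemma frame_finite_sum_le:
  assumes fr: "is_frame J e a b" and F: "finite F" "F \<subseteq> J" and f: "f \<in> L2"
  shows "(\<Sum>j\<in>F. (norm (l2_inner f (e j)))\<^sup>2) \<le> b * (l2_norm f)\<^sup>2"
proof -
  have "(\<Sum>j\<in>F. (norm (l2_inner f (e j)))\<^sup>2) \<le> (\<Sum>\<^sub>\<infinity>j\<in>J. (norm (l2_inner f (e j)))\<^sup>2)"
    using fr F f by (intro finite_sum_le_infsum) (auto simp: is_frame_def)
  also have "\<dots> \<le> b * (l2_norm f)\<^sup>2" using fr f by (auto simp: is_frame_def)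
  finally show ?thesis .
qed

text \<open>Replaces the infinite frame sum by a finite one that almost attains the lower bound and
  includes prescribed indices, so that the arguments below handle finite combinations only.\<close>

lemma frame_almost_lower_bound:
  assumes fr: "is_frame J e a b" and f: "f \<in> L2" and t: "t < a * (l2_norm f)\<^sup>2" and F0: "finite F0" "F0 \<subseteq> J"
  obtains F where "finite F" "F0 \<subseteq> F" "F \<subseteq> J" "t < (\<Sum>j\<in>F. (norm (l2_inner f (e j)))\<^sup>2)"
proof -
  let ?n = "\<lambda>j. (norm (l2_inner f (e j)))\<^sup>2"
  have s: "?n summable_on J" and l: "a * (l2_norm f)\<^sup>2 \<le> infsum ?n J"
    using fr f by (auto simp: is_frame_def)
  have "(sum ?n \<longlongrightarrow> infsum ?n J) (finite_subsets_at_top J)"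
    using s by (simp add: has_sum_def[symmetric])
  then have "\<forall>\<^sub>F F in finite_subsets_at_top J. t < sum ?n F"
    by (rule order_tendstoD) (use t l in linarith)
  then obtain X where X: "finite X" "X \<subseteq> J" "\<And>Y. finite Y \<Longrightarrow> X \<subseteq> Y \<Longrightarrow> Y \<subseteq> J \<Longrightarrow> t < sum ?n Y"
    unfolding eventually_finite_subsets_at_top by auto
  show thesis by (rule that[of "X \<union> F0"]) (use X F0 in auto)
qed

text \<open>Subtracting from the residual its own frame analysis, scaled by \<open>1 / b\<close> and
  cut off to finitely many indices, multiplies the squared distance by at most \<open>r < 1\<close>.
  Hence the infimum of the squared distances cannot be positive.\<close>

lemma frame_span_dense:
  assumes fr: "is_frame J e a b" and f: "f \<in> L2" and eps: "0 < \<epsilon>"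
  shows "\<exists>F c. finite F \<and> F \<subseteq> J \<and> l2_norm (\<lambda>x. f x - (\<Sum>j\<in>F. c j * e j x)) < \<epsilon>"
proof -
  have a: "0 < a" and b: "0 < b" and e: "\<And>j. j \<in> J \<Longrightarrow> e j \<in> L2" using fr by (auto simp: is_frame_def)
  define D where "D = {(l2_norm (\<lambda>x. f x - (\<Sum>j\<in>F. c j * e j x)))\<^sup>2 | F c. finite F \<and> F \<subseteq> J}"
  have ne: "D \<noteq> {}" unfolding D_def by blast
  have nn: "0 \<le> d" if "d \<in> D" for d using that by (auto simp: D_def)
  then have bb: "bdd_below D" by (meson bdd_belowI)
  define \<delta> where "\<delta> = Inf D"
  \<comment> \<open>The full frame sum would give the rate \<open>1 - a / b\<close>; half of the
    lower bound is given away to allow a finite truncation.\<close>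
  define r where "r = 1 - a / (2 * b)"
  have step: "\<exists>d'\<in>D. d' \<le> r * d" if d: "d \<in> D" "d > 0" for d
  proof -
    obtain F c where F: "finite F" "F \<subseteq> J" and dd: "d = (l2_norm (\<lambda>x. f x - (\<Sum>j\<in>F. c j * e j x)))\<^sup>2"
      using d by (auto simp: D_def)
    let ?h = "\<lambda>x. f x - (\<Sum>j\<in>F. c j * e j x)"
    have h: "?h \<in> L2" using f e F by (intro L2_diff L2_lincomb) auto
    have "a / 2 * d < a * (l2_norm ?h)\<^sup>2" using a d by (simp add: dd)
    then obtain F' where F': "finite F'" "F \<subseteq> F'" "F' \<subseteq> J"
      "a / 2 * d < (\<Sum>j\<in>F'. (norm (l2_inner ?h (e j)))\<^sup>2)"
      using frame_almost_lower_bound[OF fr h _ F] by blast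
    define y where "y = (\<lambda>j. (1 / b) * l2_inner ?h (e j))"
    let ?u = "\<lambda>x. \<Sum>j\<in>F'. y j * e j x"
    let ?s = "\<Sum>j\<in>F'. (norm (l2_inner ?h (e j)))\<^sup>2"
    have u: "?u \<in> L2" using e F' by (intro L2_lincomb) auto
    have "l2_inner ?h ?u = (\<Sum>j\<in>F'. cnj (y j) * l2_inner ?h (e j))"
      using h F' e by (intro l2_inner_lincomb_right) auto
    also have "\<dots> = of_real (?s / b)"
      unfolding sum_divide_distrib of_real_sum
      by (intro sum.cong refl) (simp add: y_def complex_norm_square mult.commute divide_simps del: of_real_power)
    finally have 1: "Re (l2_inner ?h ?u) = ?s / b" by simp
    have "(l2_norm ?u)\<^sup>2 \<le> b * (\<Sum>j\<in>F'. (norm (y j))\<^sup>2)"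
      by (rule l2_norm_lincomb_le) (use F' e b frame_finite_sum_le[OF fr] in auto)
    also have "\<dots> = ?s / b"
      using b by (simp add: y_def norm_mult norm_divide power_divide sum_divide_distrib[symmetric] power2_eq_square)
    finally have 2: "(l2_norm ?u)\<^sup>2 \<le> ?s / b" .
    define c' where "c' = (\<lambda>j. (if j \<in> F then c j else 0) + y j)"
    have "(\<Sum>j\<in>F'. c' j * e j x) = (\<Sum>j\<in>F. c j * e j x) + ?u x" for x
    proof -
      have "(\<Sum>j\<in>F'. (if j \<in> F then c j else 0) * e j x) = (\<Sum>j\<in>F. c j * e j x)"
        using F' by (intro sum.mono_neutral_cong_right) auto
      then show ?thesis by (simp add: c'_def distrib_right sum.distrib)
    qed
    then have "(l2_norm (\<lambda>x. f x - (\<Sum>j\<in>F'. c' j * e j x)))\<^sup>2 = (l2_norm (\<lambda>x. ?h x - ?u x))\<^sup>2"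
      by (simp add: algebra_simps)
    also have "\<dots> = d - 2 * (?s / b) + (l2_norm ?u)\<^sup>2"
      by (subst l2_norm_diff_sq[OF h u]) (simp add: 1 dd)
    also have "\<dots> \<le> d - ?s / b" using 2 by simp
    also have "\<dots> \<le> r * d" using F'(4) b by (simp add: r_def field_simps)
    finally have "(l2_norm (\<lambda>x. f x - (\<Sum>j\<in>F'. c' j * e j x)))\<^sup>2 \<le> r * d" .
    moreover have "(l2_norm (\<lambda>x. f x - (\<Sum>j\<in>F'. c' j * e j x)))\<^sup>2 \<in> D" using F' unfolding D_def by blast
    ultimately show ?thesis by blast
  qed
  have r1: "r < 1" using a b by (simp add: r_def)
  have "\<delta> \<le> 0"
  proof (rule ccontr)
    assume "\<not> \<delta> \<le> 0"
    then have p: "0 < \<delta>" by simp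
    have lb: "\<delta> \<le> d" if "d \<in> D" for d using that bb unfolding \<delta>_def by (simp add: cInf_lower)
    \<comment> \<open>If \<open>r\<close> were not positive, one step would already lead to a
      squared distance at most 0, below the infimum. Positivity allows the division by
      \<open>r\<close> that follows.\<close>
    have r0: "0 < r"
    proof (rule ccontr)
      assume "\<not> 0 < r"
      obtain d where "d \<in> D" using ne by blast
      then obtain d' where "d' \<in> D" "d' \<le> r * d" using step lb p by (meson less_le_trans)
      moreover have "r * d \<le> 0" using \<open>\<not> 0 < r\<close> nn[OF \<open>d \<in> D\<close>] by (simp add: mult_nonpos_nonneg)
      ultimately show False using lb p by force
    qed
    have "\<delta> < \<delta> / r" using p r0 r1 by (simp add: field_simps)
    then obtain d where d: "d \<in> D" "d < \<delta> / r"
      using ne unfolding \<delta>_def by (meson cInf_lessD)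
    then obtain d' where d': "d' \<in> D" "d' \<le> r * d" using step lb p by (meson less_le_trans)
    have "r * d < \<delta>" using d r0 by (simp add: field_simps)
    then show False using d' lb by force
  qed
  moreover have "0 < \<epsilon>\<^sup>2" using eps by simp
  ultimately have "Inf D < \<epsilon>\<^sup>2" unfolding \<delta>_def by linarith
  then obtain d where "d \<in> D" "d < \<epsilon>\<^sup>2" using ne by (meson cInf_lessD)
  then obtain F c where "finite F" "F \<subseteq> J" "(l2_norm (\<lambda>x. f x - (\<Sum>j\<in>F. c j * e j x)))\<^sup>2 < \<epsilon>\<^sup>2"
    by (auto simp: D_def)
  then have "l2_norm (\<lambda>x. f x - (\<Sum>j\<in>F. c j * e j x)) < \<epsilon>"
    using eps by (auto intro: power2_less_imp_less)
  with \<open>finite F\<close> \<open>F \<subseteq> J\<close> show ?thesis by blast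
qed

section \<open>From an arbitrary lower Riesz bound to the lower frame bound\<close>

lemma improvement_factor:
  fixes a a1 b :: real
  assumes a1: "0 < a1" and less: "a1 < a" and b: "0 < b"
  obtains t r where "0 < t" "0 < 2 * t - t\<^sup>2 * b + a1 * t\<^sup>2" "r < 1" "0 < r"
    "1 + 2 * t * a1 - a * (2 * t - t\<^sup>2 * b + a1 * t\<^sup>2) \<le> r"
proof -
  \<comment> \<open>Each cap has one purpose: \<open>t * b \<le> 1\<close> keeps the coefficient of
    the gain positive, \<open>t * (a * b) \<le> a - a1\<close> lets the second-order error consume
    at most half of the first-order gain \<open>2 * t * (a - a1)\<close>, and
    \<open>2 * (t * a) \<le> 1\<close> keeps the factor \<open>1 - t * (a - a1)\<close>
    positive.\<close>
  define t where "t = Min {1 / b, (a - a1) / (a * b), 1 / (2 * a)}"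
  have a: "0 < a" using assms by simp
  have t0: "0 < t" using assms a unfolding t_def by simp
  have t1: "t \<le> 1 / b" "t \<le> (a - a1) / (a * b)" "t \<le> 1 / (2 * a)" unfolding t_def by auto
  have tb: "t * b \<le> 1" using t1(1) b by (simp add: field_simps)
  have tab: "t * (a * b) \<le> a - a1" using t1(2) a b by (simp add: field_simps)
  have ta: "2 * (t * a) \<le> 1" using t1(3) a by (simp add: field_simps)
  have "t * (t * b) \<le> t * 1" using tb t0 by (intro mult_left_mono) auto
  then have p: "0 < 2 * t - t\<^sup>2 * b + a1 * t\<^sup>2"
    using t0 a1 by (smt (verit) mult.assoc mult_pos_pos power2_eq_square zero_less_power)
  have q: "t * (t * (a * b)) \<le> t * (a - a1)" using tab t0 by (intro mult_left_mono) auto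
  let ?r = "1 - t * (a - a1)"
  show thesis
  proof (rule that[of t ?r])
    show "?r < 1" using t0 less by simp
    have "0 < t * a1" "t * (a - a1) = t * a - t * a1" using t0 a1 by (simp_all add: right_diff_distrib)
    then have "t * (a - a1) < 1" using ta mult_pos_pos[OF t0 a] by linarith
    then show "0 < ?r" by simp
    have "1 + 2 * t * a1 - a * (2 * t - t\<^sup>2 * b + a1 * t\<^sup>2) = 1 - 2 * (t * (a - a1)) + t * (t * (a * b)) - a * a1 * t\<^sup>2"
      by (simp add: power2_eq_square algebra_simps)
    also have "\<dots> \<le> ?r"
    proof -
      have "0 \<le> a * a1 * t\<^sup>2" using a a1 by simp
      then show ?thesis using q by linarith
    qed
    finally show "1 + 2 * t * a1 - a * (2 * t - t\<^sup>2 * b + a1 * t\<^sup>2) \<le> ?r" .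
  qed (use t0 p in auto)
qed

text \<open>When the known bound is applied to \<open>c - t y\<close>, both cross terms are
  explicit: \<open>c\<close> paired with \<open>y\<close> is the squared norm \<open>n\<close> of
  the function, and the function paired with the combination of \<open>y\<close> is the frame sum
  \<open>Y\<close>. What remains is \<open>a1 * ?C + q * Y \<le> (1 + 2 * t * a1) * n\<close>, where
  \<open>Y\<close> is almost as large as \<open>a * n\<close>. For \<open>r < 1\<close> the quotient
  \<open>a1 / r\<close> is a better lower Riesz bound.\<close>

lemma frame_lower_riesz_improve:
  assumes fr: "is_frame J e a b" and a1: "0 < a1" "a1 < a"
    and low: "\<And>F c. finite F \<Longrightarrow> F \<subseteq> J \<Longrightarrow>
      a1 * (\<Sum>j\<in>F. (norm (c j))\<^sup>2) \<le> (l2_norm (\<lambda>x. \<Sum>j\<in>F. c j * e j x))\<^sup>2"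
    and r: "0 < t" "0 < 2 * t - t\<^sup>2 * b + a1 * t\<^sup>2"
    "1 + 2 * t * a1 - a * (2 * t - t\<^sup>2 * b + a1 * t\<^sup>2) \<le> r"
    and F: "finite F" "F \<subseteq> J"
  shows "a1 * (\<Sum>j\<in>F. (norm (c j))\<^sup>2) \<le> r * (l2_norm (\<lambda>x. \<Sum>j\<in>F. c j * e j x))\<^sup>2"
proof -
  have b: "0 < b" and e: "\<And>j. j \<in> J \<Longrightarrow> e j \<in> L2" using fr by (auto simp: is_frame_def)
  let ?f = "\<lambda>x. \<Sum>j\<in>F. c j * e j x"
  let ?C = "\<Sum>j\<in>F. (norm (c j))\<^sup>2"
  define q where "q = 2 * t - t\<^sup>2 * b + a1 * t\<^sup>2"
  define n where "n = (l2_norm ?f)\<^sup>2"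
  have f: "?f \<in> L2" using e F by (intro L2_lincomb) auto
  have key: "a1 * ?C + q * s \<le> (1 + 2 * t * a1) * n" if s: "s < a * n" for s
  proof -
    obtain F' where F': "finite F'" "F \<subseteq> F'" "F' \<subseteq> J"
      "s < (\<Sum>j\<in>F'. (norm (l2_inner ?f (e j)))\<^sup>2)"
      using frame_almost_lower_bound[OF fr f _ F] s unfolding n_def by blast
    define y where "y = (\<lambda>j. l2_inner ?f (e j))"
    define Y where "Y = (\<Sum>j\<in>F'. (norm (y j))\<^sup>2)"
    \<comment> \<open>The truncation \<open>F'\<close> may exceed \<open>F\<close>; extending
      \<open>c\<close> by zero puts \<open>c\<close> and \<open>y\<close> on the same index
      set.\<close>
    define c' where "c' = (\<lambda>j. if j \<in> F then c j else 0)"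
    let ?u = "\<lambda>x. \<Sum>j\<in>F'. (of_real t * y j) * e j x"
    have u: "?u \<in> L2" using e F' by (intro L2_lincomb) auto
    have cf: "(\<Sum>j\<in>F'. c' j * e j x) = ?f x" for x
      unfolding c'_def using F' by (intro sum.mono_neutral_cong_right) auto
    have cC: "(\<Sum>j\<in>F'. (norm (c' j))\<^sup>2) = ?C"
      unfolding c'_def using F' by (intro sum.mono_neutral_cong_right) auto
    have cy: "(\<Sum>j\<in>F'. cnj (c' j) * y j) = of_real n"
    proof -
      have "of_real n = l2_inner ?f ?f" by (simp add: l2_inner_self n_def)
      also have "\<dots> = l2_inner ?f (\<lambda>x. \<Sum>j\<in>F'. c' j * e j x)" by (simp add: cf)
      also have "\<dots> = (\<Sum>j\<in>F'. cnj (c' j) * y j)"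
        unfolding y_def using f F' e by (intro l2_inner_lincomb_right) auto
      finally show ?thesis by simp
    qed
    have fu: "l2_inner ?f ?u = of_real (t * Y)"
    proof -
      have "l2_inner ?f ?u = (\<Sum>j\<in>F'. cnj (of_real t * y j) * l2_inner ?f (e j))"
        using f F' e by (intro l2_inner_lincomb_right) auto
      also have "\<dots> = (\<Sum>j\<in>F'. of_real (t * (norm (y j))\<^sup>2))"
        by (intro sum.cong refl) (simp add: y_def complex_norm_square mult.commute del: of_real_power)
      finally show ?thesis by (simp add: Y_def sum_distrib_left)
    qed
    have uY: "(l2_norm ?u)\<^sup>2 \<le> b * (t\<^sup>2 * Y)"
    proof -
      have "(l2_norm ?u)\<^sup>2 \<le> b * (\<Sum>j\<in>F'. (norm (of_real t * y j))\<^sup>2)"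
        by (rule l2_norm_lincomb_le) (use F' e b frame_finite_sum_le[OF fr] in auto)
      then show ?thesis by (simp add: Y_def norm_mult power_mult_distrib sum_distrib_left)
    qed
    have "(norm (c' j - of_real t * y j))\<^sup>2 =
       (norm (c' j))\<^sup>2 - 2 * t * Re (cnj (c' j) * y j) + t\<^sup>2 * (norm (y j))\<^sup>2" for j
      unfolding cmod_diff_squared by (simp add: norm_mult power_mult_distrib algebra_simps)
    then have "(\<Sum>j\<in>F'. (norm (c' j - of_real t * y j))\<^sup>2) =
       ?C - 2 * t * Re (\<Sum>j\<in>F'. cnj (c' j) * y j) + t\<^sup>2 * Y"
      by (simp only: sum.distrib sum_subtractf cC Y_def sum_distrib_left Re_sum)
    also have "\<dots> = ?C - 2 * t * n + t\<^sup>2 * Y" by (simp add: cy)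
    finally have "a1 * (?C - 2 * t * n + t\<^sup>2 * Y) = a1 * (\<Sum>j\<in>F'. (norm (c' j - of_real t * y j))\<^sup>2)"
      by simp
    also have "\<dots> \<le> (l2_norm (\<lambda>x. \<Sum>j\<in>F'. (c' j - of_real t * y j) * e j x))\<^sup>2"
      using F' by (intro low) auto
    also have "\<dots> = (l2_norm (\<lambda>x. ?f x - ?u x))\<^sup>2"
      by (simp add: left_diff_distrib sum_subtractf cf)
    also have "\<dots> = n - 2 * (t * Y) + (l2_norm ?u)\<^sup>2"
      by (subst l2_norm_diff_sq[OF f u]) (simp add: fu n_def)
    also have "\<dots> \<le> n - 2 * (t * Y) + b * (t\<^sup>2 * Y)" using uY by simp
    finally have "a1 * ?C + q * Y \<le> (1 + 2 * t * a1) * n"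
      by (simp add: q_def algebra_simps)
    moreover have "q * s \<le> q * Y" using F'(4) r(2) by (intro mult_left_mono) (auto simp: q_def Y_def y_def)
    ultimately show ?thesis by simp
  qed
  \<comment> \<open>Finite frame sums reach only the numbers below \<open>a * n\<close>, so the
    value \<open>a * n\<close> itself is attained in the limit.\<close>
  have "a1 * ?C + q * (a * n) \<le> (1 + 2 * t * a1) * n"
  proof (rule field_le_epsilon)
    fix \<epsilon> :: real assume "0 < \<epsilon>"
    then have "a * n - \<epsilon> / q < a * n" using r(2) by (simp add: q_def)
    from key[OF this] have "a1 * ?C + q * (a * n) - q * (\<epsilon> / q) \<le> (1 + 2 * t * a1) * n"
      by (simp add: algebra_simps)
    moreover have "q * (\<epsilon> / q) = \<epsilon>" using r(2) by (simp add: q_def)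
    ultimately show "a1 * ?C + q * (a * n) \<le> (1 + 2 * t * a1) * n + \<epsilon>" by linarith
  qed
  then have "a1 * ?C \<le> (1 + 2 * t * a1 - a * q) * n" by (simp add: algebra_simps)
  also have "\<dots> \<le> r * n" using r(3) by (intro mult_right_mono) (auto simp: q_def n_def)
  finally show ?thesis by (simp add: n_def)
qed

text \<open>The lower Riesz bounds up to \<open>a\<close> have a supremum that is itself such a
  bound, the defining inequalities being closed conditions. If it were below \<open>a\<close>, the
  improvement would produce a larger one.\<close>

lemma frame_lower_riesz_optimal:
  assumes fr: "is_frame J e a b" and a0: "0 < a0"
    and low: "\<And>F c. finite F \<Longrightarrow> F \<subseteq> J \<Longrightarrow>
      a0 * (\<Sum>j\<in>F. (norm (c j))\<^sup>2) \<le> (l2_norm (\<lambda>x. \<Sum>j\<in>F. c j * e j x))\<^sup>2"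
    and F: "finite F" "F \<subseteq> J"
  shows "a * (\<Sum>j\<in>F. (norm (c j))\<^sup>2) \<le> (l2_norm (\<lambda>x. \<Sum>j\<in>F. c j * e j x))\<^sup>2"
proof -
  have a: "0 < a" and b: "0 < b" using fr by (auto simp: is_frame_def)
  define V where "V = {a1. a1 \<le> a \<and> (\<forall>F c. finite F \<longrightarrow> F \<subseteq> J \<longrightarrow>
      a1 * (\<Sum>j\<in>F. (norm (c j))\<^sup>2) \<le> (l2_norm (\<lambda>x. \<Sum>j\<in>F. c j * e j x))\<^sup>2)}"
  have V0: "min a0 a \<in> V" unfolding V_def
    by (auto intro!: order_trans[OF mult_right_mono low] sum_nonneg)
  have bd: "bdd_above V" unfolding V_def by (auto intro!: bdd_aboveI[of _ a])
  define A where "A = Sup V"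
  have pos: "0 < A" using V0 bd a a0 cSup_upper[OF V0 bd] by (simp add: A_def)
  have ne: "V \<noteq> {}" using V0 by blast
  have Ala: "A \<le> a" unfolding A_def using ne by (rule cSup_least) (simp add: V_def)
  have Alow: "A * (\<Sum>j\<in>F. (norm (c j))\<^sup>2) \<le> (l2_norm (\<lambda>x. \<Sum>j\<in>F. c j * e j x))\<^sup>2"
    if "finite F" "F \<subseteq> J" for F c
  proof -
    let ?C = "\<Sum>j\<in>F. (norm (c j))\<^sup>2" and ?N = "(l2_norm (\<lambda>x. \<Sum>j\<in>F. c j * e j x))\<^sup>2"
    have *: "v * ?C \<le> ?N" if "v \<in> V" for v using that \<open>finite F\<close> \<open>F \<subseteq> J\<close> by (auto simp: V_def)
    have C0: "0 \<le> ?C" by (intro sum_nonneg) auto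
    show ?thesis
    proof (cases "?C = 0")
      case False
      then have C: "0 < ?C" using C0 by linarith
      have "A \<le> ?N / ?C" unfolding A_def
        using ne by (rule cSup_least) (simp only: pos_le_divide_eq[OF C] *)
      then show ?thesis using C by (simp add: pos_le_divide_eq)
    qed (simp add: l2_norm_sq)
  qed
  have "A = a"
  proof (rule ccontr)
    assume "A \<noteq> a"
    then have less: "A < a" using Ala by simp
    obtain t r where t: "0 < t" "0 < 2 * t - t\<^sup>2 * b + A * t\<^sup>2" "r < 1" "0 < r"
      "1 + 2 * t * A - a * (2 * t - t\<^sup>2 * b + A * t\<^sup>2) \<le> r"
      using improvement_factor[OF pos less b] by blast
    have "min a (A / r) \<in> V" unfolding V_def
    proof (intro CollectI conjI allI impI)
      fix F c assume F: "finite F" "F \<subseteq> J"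
      let ?C = "\<Sum>j\<in>F. (norm (c j :: complex))\<^sup>2"
      have "A * ?C \<le> r * (l2_norm (\<lambda>x. \<Sum>j\<in>F. c j * e j x))\<^sup>2"
        by (rule frame_lower_riesz_improve[OF fr pos less Alow t(1,2,5) F])
      then have "(A / r) * ?C \<le> (l2_norm (\<lambda>x. \<Sum>j\<in>F. c j * e j x))\<^sup>2"
        using t(4) by (simp add: field_simps)
      moreover have "min a (A / r) * ?C \<le> (A / r) * ?C" by (intro mult_right_mono sum_nonneg) auto
      ultimately show "min a (A / r) * ?C \<le> (l2_norm (\<lambda>x. \<Sum>j\<in>F. c j * e j x))\<^sup>2" by linarith
    qed simp
    then have "min a (A / r) \<le> A" unfolding A_def using bd by (rule cSup_upper)
    moreover have "A < A / r" using t pos by (simp add: field_simps)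
    ultimately show False using less by simp
  qed
  then show ?thesis using Alow[OF F] by simp
qed

theorem frame_riesz_basis:
  fixes e :: "'b \<Rightarrow> 'a::euclidean_space \<Rightarrow> complex"
  assumes fr: "is_frame J e a b" and a0: "0 < a0"
    and low: "\<And>F c. finite F \<Longrightarrow> F \<subseteq> J \<Longrightarrow>
      a0 * (\<Sum>j\<in>F. (norm (c j))\<^sup>2) \<le> (l2_norm (\<lambda>x. \<Sum>j\<in>F. c j * e j x))\<^sup>2"
  shows "is_riesz_basis J e a b"
proof -
  have J: "countable J" "0 < a" "0 < b" "\<And>j. j \<in> J \<Longrightarrow> e j \<in> L2" using fr by (auto simp: is_frame_def)
  have up: "(l2_norm (\<lambda>x. \<Sum>j\<in>F. c j * e j x))\<^sup>2 \<le> b * (\<Sum>j\<in>F. (norm (c j))\<^sup>2)"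
    if "finite F" "F \<subseteq> J" for F c
    by (rule l2_norm_lincomb_le) (use that J frame_finite_sum_le[OF fr] in auto)
  show ?thesis
    unfolding is_riesz_basis_def
  proof (intro conjI ballI allI impI)
    fix f :: "'a \<Rightarrow> complex" and \<epsilon> :: real assume "f \<in> L2" "0 < \<epsilon>"
    then show "\<exists>F c. finite F \<and> F \<subseteq> J \<and> l2_norm (\<lambda>x. f x - (\<Sum>j\<in>F. c j * e j x)) < \<epsilon>"
      by (rule frame_span_dense[OF fr])
  next
    fix F :: "'b set" and c :: "'b \<Rightarrow> complex" assume "finite F \<and> F \<subseteq> J"
    then show "a * (\<Sum>j\<in>F. (norm (c j))\<^sup>2) \<le> (l2_norm (\<lambda>x. \<Sum>j\<in>F. c j * e j x))\<^sup>2"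
      "(l2_norm (\<lambda>x. \<Sum>j\<in>F. c j * e j x))\<^sup>2 \<le> b * (\<Sum>j\<in>F. (norm (c j))\<^sup>2)"
      using frame_lower_riesz_optimal[OF fr a0 low] up by blast+
  qed (use J in auto)
qed

subsection \<open>Sums over a countable type as integrals\<close>

text \<open>Lattice sums are kept as integrals over the counting measure because these can be
  reindexed along bijections of the lattice; this bridge to series supplies their measurability and
  the exchange with another integral.\<close>

lemma nn_integral_count_space_suminf:
  fixes f :: "'c::countable \<Rightarrow> ennreal"
  shows "(\<integral>\<^sup>+m. f m \<partial>count_space UNIV) = (\<Sum>n. if n \<in> range (to_nat :: 'c \<Rightarrow> nat) then f (from_nat n) else 0)"
proof -
  have "(\<integral>\<^sup>+m. f m \<partial>count_space UNIV) = (\<integral>\<^sup>+m. f (from_nat (to_nat (m :: 'c))) \<partial>count_space UNIV)" by simp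
  also have "\<dots> = (\<integral>\<^sup>+n. f (from_nat n) \<partial>count_space (range (to_nat :: 'c \<Rightarrow> nat)))"
    by (rule nn_integral_bij_count_space) (simp add: bij_betw_def)
  also have "\<dots> = (\<integral>\<^sup>+n. f (from_nat n) * indicator (range (to_nat :: 'c \<Rightarrow> nat)) n \<partial>count_space UNIV)"
    by (rule nn_integral_count_space_indicator) simp
  also have "\<dots> = (\<integral>\<^sup>+n. (if n \<in> range (to_nat :: 'c \<Rightarrow> nat) then f (from_nat n) else 0) \<partial>count_space UNIV)"
    by (intro nn_integral_cong) (auto simp: indicator_def)
  also have "\<dots> = (\<Sum>n. if n \<in> range (to_nat :: 'c \<Rightarrow> nat) then f (from_nat n) else 0)"
    by (rule nn_integral_count_space_nat)
  finally show ?thesis .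
qed

lemma borel_measurable_count_sum:
  fixes f :: "'c::countable \<Rightarrow> 'a \<Rightarrow> ennreal"
  assumes "\<And>m. f m \<in> borel_measurable M"
  shows "(\<lambda>x. \<integral>\<^sup>+m. f m x \<partial>count_space UNIV) \<in> borel_measurable M"
  unfolding nn_integral_count_space_suminf
  by (intro borel_measurable_suminf_order) (use assms in auto)

lemma nn_integral_count_sum_swap:
  fixes f :: "'c::countable \<Rightarrow> 'a \<Rightarrow> ennreal"
  assumes "\<And>m. f m \<in> borel_measurable M"
  shows "(\<integral>\<^sup>+x. (\<integral>\<^sup>+m. f m x \<partial>count_space UNIV) \<partial>M) = (\<integral>\<^sup>+m. (\<integral>\<^sup>+x. f m x \<partial>M) \<partial>count_space UNIV)"
  unfolding nn_integral_count_space_suminf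
  by (subst nn_integral_suminf) (use assms in \<open>auto intro!: suminf_cong\<close>)

subsection \<open>Coordinate reflections and translations\<close>

definition rrefl :: "int^'n \<Rightarrow> real^'n \<Rightarrow> real^'n" where
  "rrefl \<sigma> x = (\<chi> i. if odd (\<sigma> $ i) then - x $ i else x $ i)"

text \<open>The vector \<open>rrefl \<sigma> 1\<close> lists the signs. In this form the map is a
  coordinatewise scaling plus a translation, to which the change of variables for Lebesgue measure
  applies.\<close>

lemma rrefl_affine:
  fixes t :: "real^'n"
  shows "t + rrefl \<sigma> x = t + (\<Sum>j\<in>Basis. (rrefl \<sigma> 1 \<bullet> j * (x \<bullet> j)) *\<^sub>R j)"
proof -
  have "rrefl \<sigma> x \<bullet> b = (\<Sum>j\<in>Basis. (rrefl \<sigma> 1 \<bullet> j * (x \<bullet> j)) *\<^sub>R j) \<bullet> b" if "b \<in> Basis" for b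
    unfolding inner_sum_left_Basis[OF that] using that by (auto simp: Basis_vec_def inner_axis rrefl_def)
  then have "rrefl \<sigma> x = (\<Sum>j\<in>Basis. (rrefl \<sigma> 1 \<bullet> j * (x \<bullet> j)) *\<^sub>R j)"
    by (rule euclidean_eqI)
  then show ?thesis by (rule arg_cong)
qed

lemma
  fixes t :: "real^'n"
  shows measurable_rrefl_lebesgue: "(\<lambda>x. t + rrefl \<sigma> x) \<in> lebesgue \<rightarrow>\<^sub>M lebesgue" (is ?m)
    and distr_rrefl_lebesgue: "distr lebesgue lebesgue (\<lambda>x. t + rrefl \<sigma> x) = lebesgue" (is ?d)
proof -
  have 1: "\<bar>rrefl \<sigma> 1 \<bullet> j\<bar> = 1" if "j \<in> Basis" for j :: "real^'n"
    using that by (auto simp: Basis_vec_def inner_axis rrefl_def)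
  then have nz: "rrefl \<sigma> 1 \<bullet> j \<noteq> 0" if "j \<in> Basis" for j :: "real^'n"
    using that by fastforce
  show ?m unfolding rrefl_affine using nz by (rule lebesgue_affine_measurable)
  have "(lebesgue :: (real^'n) measure) = density (distr lebesgue lebesgue (\<lambda>x. t + rrefl \<sigma> x)) (\<lambda>_. 1)"
    using lebesgue_affine_euclidean[of "\<lambda>j. rrefl \<sigma> 1 \<bullet> j" t, OF nz]
    unfolding rrefl_affine[symmetric] by (simp add: 1)
  then show ?d by (simp add: density_1)
qed

lemma rrefl_0 [simp]: "rrefl 0 x = x"
  by (simp add: rrefl_def)

lemma
  fixes t :: "real^'n"
  shows measurable_translate_lebesgue: "(\<lambda>x. x + t) \<in> lebesgue \<rightarrow>\<^sub>M lebesgue"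
    and distr_translate_lebesgue: "distr lebesgue lebesgue (\<lambda>x. x + t) = lebesgue"
  using measurable_rrefl_lebesgue[of t 0] distr_rrefl_lebesgue[of t 0] by (simp_all add: add.commute)

lemma AE_rrefl:
  fixes t :: "real^'n"
  assumes "AE x in lebesgue. P x"
  shows "AE x in lebesgue. P (t + rrefl \<sigma> x)"
  by (rule AE_distrD[OF measurable_rrefl_lebesgue]) (simp only: distr_rrefl_lebesgue assms)

lemma AE_translate:
  fixes t :: "real^'n"
  assumes "AE x in lebesgue. P x"
  shows "AE x in lebesgue. P (x + t)"
  using AE_rrefl[OF assms, of t 0] by (simp add: add.commute)

lemma nn_integral_rrefl:
  fixes t :: "real^'n"
  assumes "f \<in> borel_measurable lebesgue"
  shows "(\<integral>\<^sup>+x. f (t + rrefl \<sigma> x) \<partial>lebesgue) = (\<integral>\<^sup>+x. f x \<partial>lebesgue)"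
  by (subst (2) distr_rrefl_lebesgue[of t \<sigma>, symmetric])
    (rule nn_integral_distr[OF measurable_rrefl_lebesgue, symmetric], simp add: assms)

lemma nn_integral_translate:
  fixes t :: "real^'n"
  assumes "f \<in> borel_measurable lebesgue"
  shows "(\<integral>\<^sup>+x. f (x + t) \<partial>lebesgue) = (\<integral>\<^sup>+x. f x \<partial>lebesgue)"
  using nn_integral_rrefl[OF assms, of t 0] by (simp add: add.commute)

lemma integral_rrefl:
  fixes t :: "real^'n" and f :: "real^'n \<Rightarrow> complex"
  assumes "f \<in> borel_measurable lebesgue"
  shows "(LINT x|lebesgue. f (t + rrefl \<sigma> x)) = (LINT x|lebesgue. f x)"
  by (subst (2) distr_rrefl_lebesgue[of t \<sigma>, symmetric])
    (rule integral_distr[OF measurable_rrefl_lebesgue, symmetric], simp add: assms)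

lemma integral_translate:
  fixes t :: "real^'n" and f :: "real^'n \<Rightarrow> complex"
  assumes "f \<in> borel_measurable lebesgue"
  shows "(LINT x|lebesgue. f (x + t)) = (LINT x|lebesgue. f x)"
  using integral_rrefl[OF assms, of t 0] by (simp add: add.commute)

lemma borel_measurable_translate:
  fixes t :: "real^'n"
  assumes "f \<in> borel_measurable lebesgue"
  shows "(\<lambda>x. f (x + t)) \<in> borel_measurable lebesgue"
  by (rule measurable_compose[OF measurable_translate_lebesgue assms])

lemma borel_measurable_rrefl:
  fixes t :: "real^'n"
  assumes "f \<in> borel_measurable lebesgue"
  shows "(\<lambda>x. f (t + rrefl \<sigma> x)) \<in> borel_measurable lebesgue"
  by (rule measurable_compose[OF measurable_rrefl_lebesgue assms])

lemma L2_rrefl: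
  fixes t :: "real^'n"
  assumes "f \<in> L2"
  shows "(\<lambda>x. f (t + rrefl \<sigma> x)) \<in> L2"
proof -
  have "integrable (distr lebesgue lebesgue (\<lambda>x. t + rrefl \<sigma> x)) (\<lambda>x. (norm (f x))\<^sup>2)"
    using assms by (simp add: distr_rrefl_lebesgue L2_def)
  then have "integrable lebesgue (\<lambda>x. (norm (f (t + rrefl \<sigma> x)))\<^sup>2)"
    by (rule integrable_distr[OF measurable_rrefl_lebesgue])
  then show ?thesis using assms by (auto simp: L2_def intro: borel_measurable_rrefl)
qed

lemma L2_translate:
  fixes t :: "real^'n"
  assumes "f \<in> L2"
  shows "(\<lambda>x. f (x + t)) \<in> L2"
  using L2_rrefl[OF assms, of t 0] by (simp add: add.commute)

subsection \<open>Tiling by integer translates of the unit cube\<close>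

text \<open>Half-open, so that each point has exactly one integer translate inside and the tiling
  holds everywhere.\<close>

definition unit_cube :: "(real^'n) set" where
  "unit_cube = {x. \<forall>i. 0 \<le> x $ i \<and> x $ i < 1}"

lemma unit_cube_borel [measurable]: "(unit_cube :: (real^'n) set) \<in> sets borel"
proof -
  have "unit_cube = (\<Inter>i. {x :: real^'n. 0 \<le> x $ i} \<inter> {x. x $ i < 1})"
    by (auto simp: unit_cube_def)
  also have "\<dots> \<in> sets borel"
    by (intro sets.countable_INT'' sets.Int borel_closed borel_open closed_Collect_le open_Collect_less continuous_intros)
      auto
  finally show ?thesis .
qed

lemma unit_cube_lebesgue [measurable]: "(unit_cube :: (real^'n) set) \<in> sets lebesgue"
  using unit_cube_borel by simp

lemma emeasure_unit_cube: "emeasure lebesgue (unit_cube :: (real^'n) set) = 1"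
proof (rule antisym)
  have b: "b \<bullet> (1 :: real^'n) = 1" if "b \<in> Basis" for b
    using that by (auto simp: Basis_vec_def inner_axis')
  have "emeasure lebesgue (unit_cube :: (real^'n) set) \<le> emeasure lebesgue (cbox 0 (1 :: real^'n))"
    by (rule emeasure_mono) (auto simp: unit_cube_def mem_box_cart less_imp_le)
  also have "\<dots> = 1" using b by (simp add: emeasure_lborel_cbox_eq inner_commute)
  finally show "emeasure lebesgue (unit_cube :: (real^'n) set) \<le> 1" .
  have "1 = emeasure lebesgue (box 0 (1 :: real^'n))" using b by (simp add: emeasure_lborel_box_eq inner_commute)
  also have "\<dots> \<le> emeasure lebesgue (unit_cube :: (real^'n) set)"
    by (rule emeasure_mono) (auto simp: unit_cube_def mem_box_cart less_imp_le)
  finally show "1 \<le> emeasure lebesgue (unit_cube :: (real^'n) set)" .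
qed

definition floor_vec :: "real^'n \<Rightarrow> int^'n" where
  "floor_vec x = (\<chi> i. \<lfloor>x $ i\<rfloor>)"

lemma real_vec_nth [simp]: "real_vec a $ i = real_of_int (a $ i)"
  by (simp add: real_vec_def)

lemma real_vec_simps [simp]:
  "real_vec (a + b) = real_vec a + real_vec b" "real_vec (a - b) = real_vec a - real_vec b"
  "real_vec (- a) = - real_vec a" "real_vec 0 = 0"
  by (simp_all add: vec_eq_iff)

lemma add_real_vec_mem_unit_cube: "x + real_vec m \<in> unit_cube \<longleftrightarrow> m = - floor_vec x"
proof
  assume "x + real_vec m \<in> unit_cube"
  then have "\<lfloor>x $ i\<rfloor> = - (m $ i)" for i
    by (auto simp: unit_cube_def floor_eq_iff algebra_simps dest!: spec[of _ i])
  then show "m = - floor_vec x" by (simp add: vec_eq_iff floor_vec_def)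
next
  assume m: "m = - floor_vec x"
  have "0 \<le> x $ i - real_of_int \<lfloor>x $ i\<rfloor>" "x $ i - real_of_int \<lfloor>x $ i\<rfloor> < 1" for i
    by linarith+
  then show "x + real_vec m \<in> unit_cube" unfolding m by (simp add: unit_cube_def floor_vec_def)
qed

lemma nn_integral_count_single:
  assumes "\<And>m. m \<noteq> m0 \<Longrightarrow> f m = 0"
  shows "(\<integral>\<^sup>+m. f m \<partial>count_space UNIV) = f m0"
proof -
  have "(\<integral>\<^sup>+m. f m \<partial>count_space UNIV) = (\<integral>\<^sup>+m. f m0 * indicator {m0} m \<partial>count_space UNIV)"
    by (rule nn_integral_cong) (auto simp: indicator_def assms)
  then show ?thesis by (simp add: nn_integral_cmult_indicator)
qed

lemma sum_indicator_unit_cube: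
  "(\<integral>\<^sup>+m. indicator unit_cube (x + real_vec m) \<partial>count_space UNIV) = 1"
  by (subst nn_integral_count_single[of "- floor_vec x"])
    (simp_all only: indicator_def add_real_vec_mem_unit_cube simp_thms of_bool_eq)

text \<open>The indicators of all integer translates of the cube add up to 1 at each point. Insert
  this sum, exchange it with the integral, and move every piece back to the cube.\<close>

lemma nn_integral_tile:
  fixes f :: "real^'n \<Rightarrow> ennreal"
  assumes f [measurable]: "f \<in> borel_measurable lebesgue"
  shows "(\<integral>\<^sup>+x. f x \<partial>lebesgue) =
    (\<integral>\<^sup>+x. indicator unit_cube x * (\<integral>\<^sup>+m. f (x + real_vec m) \<partial>count_space UNIV) \<partial>lebesgue)"
proof -
  have m1: "(\<lambda>x. indicator unit_cube (x + real_vec m) * f x) \<in> borel_measurable lebesgue" for m :: "int^'n"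
    by (intro borel_measurable_times_ennreal borel_measurable_translate[of "indicator unit_cube"] borel_measurable_indicator) auto
  have m2: "(\<lambda>x. indicator unit_cube x * f (x + real_vec m)) \<in> borel_measurable lebesgue" for m :: "int^'n"
    using borel_measurable_translate[OF f, of "real_vec m"] by (intro borel_measurable_times_ennreal) auto
  have "(\<integral>\<^sup>+x. f x \<partial>lebesgue) =
     (\<integral>\<^sup>+x. (\<integral>\<^sup>+m. indicator unit_cube (x + real_vec m) * f x \<partial>count_space UNIV) \<partial>lebesgue)"
    by (intro nn_integral_cong) (simp add: nn_integral_multc sum_indicator_unit_cube)
  also have "\<dots> = (\<integral>\<^sup>+m. (\<integral>\<^sup>+x. indicator unit_cube (x + real_vec m) * f x \<partial>lebesgue) \<partial>count_space UNIV)"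
    by (rule nn_integral_count_sum_swap) (rule m1)
  also have "\<dots> = (\<integral>\<^sup>+m. (\<integral>\<^sup>+x. indicator unit_cube x * f (x + real_vec (- m)) \<partial>lebesgue) \<partial>count_space UNIV)"
  proof (rule nn_integral_cong)
    fix m :: "int^'n"
    show "(\<integral>\<^sup>+x. indicator unit_cube (x + real_vec m) * f x \<partial>lebesgue) =
        (\<integral>\<^sup>+x. indicator unit_cube x * f (x + real_vec (- m)) \<partial>lebesgue)"
      using nn_integral_translate[OF m1[of m], of "- real_vec m"] by simp
  qed
  also have "\<dots> = (\<integral>\<^sup>+m. (\<integral>\<^sup>+x. indicator unit_cube x * f (x + real_vec m) \<partial>lebesgue) \<partial>count_space UNIV)"
    by (rule nn_integral_bij_count_space[OF bij_uminus])
  also have "\<dots> = (\<integral>\<^sup>+x. (\<integral>\<^sup>+m. indicator unit_cube x * f (x + real_vec m) \<partial>count_space UNIV) \<partial>lebesgue)"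
    by (rule nn_integral_count_sum_swap[symmetric]) (rule m2)
  also have "\<dots> = (\<integral>\<^sup>+x. indicator unit_cube x * (\<integral>\<^sup>+m. f (x + real_vec m) \<partial>count_space UNIV) \<partial>lebesgue)"
    by (simp add: nn_integral_cmult)
  finally show ?thesis .
qed

text \<open>The translated cube is again a fundamental domain: its integer translates add up to 1,
  and the periodic factor does not notice them.\<close>

lemma nn_integral_periodic_shift:
  fixes p :: "real^'n \<Rightarrow> ennreal"
  assumes p [measurable]: "p \<in> borel_measurable lebesgue" and per: "\<And>x m. p (x + real_vec m) = p x"
  shows "(\<integral>\<^sup>+x. indicator unit_cube x * p (x + v) \<partial>lebesgue) = (\<integral>\<^sup>+x. indicator unit_cube x * p x \<partial>lebesgue)"
proof -
  have m: "(\<lambda>x. indicator unit_cube (x - v) * p x) \<in> borel_measurable lebesgue"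
    using borel_measurable_translate[OF borel_measurable_indicator[OF unit_cube_lebesgue], of "- v"]
    by (intro borel_measurable_times_ennreal) auto
  have "(\<integral>\<^sup>+x. indicator unit_cube x * p (x + v) \<partial>lebesgue) = (\<integral>\<^sup>+x. indicator unit_cube (x - v) * p x \<partial>lebesgue)"
    using nn_integral_translate[OF m, of v] by simp
  also have "\<dots> = (\<integral>\<^sup>+x. indicator unit_cube x *
      (\<integral>\<^sup>+m. indicator unit_cube ((x - v) + real_vec m) * p x \<partial>count_space UNIV) \<partial>lebesgue)"
    by (subst nn_integral_tile[OF m]) (simp add: per diff_add_eq)
  also have "\<dots> = (\<integral>\<^sup>+x. indicator unit_cube x * p x \<partial>lebesgue)"
    by (simp add: nn_integral_multc sum_indicator_unit_cube)
  finally show ?thesis .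
qed

lemma bij_reflect: "bij (reflect \<sigma>)"
  by (rule involuntory_imp_bij) (simp add: reflect_def vec_eq_iff)

lemma rrefl_add: "rrefl \<sigma> (x + y) = rrefl \<sigma> x + rrefl \<sigma> y"
  by (simp add: rrefl_def vec_eq_iff)

lemma rrefl_real_vec: "rrefl \<sigma> (real_vec m) = real_vec (reflect \<sigma> m)"
  by (simp add: rrefl_def reflect_def vec_eq_iff)

text \<open>With \<open>t\<close> equal to half of \<open>\<sigma>\<close> the sample points become
  \<open>refl_point \<sigma> x + real_vec m\<close>. The reflection permutes the lattice, hence
  \<open>m\<close> can be added after reflecting.\<close>

lemma nn_integral_tile_rrefl:
  fixes f :: "real^'n \<Rightarrow> ennreal"
  assumes f [measurable]: "f \<in> borel_measurable lebesgue"
  shows "(\<integral>\<^sup>+x. f x \<partial>lebesgue) =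
    (\<integral>\<^sup>+x. indicator unit_cube x * (\<integral>\<^sup>+m. f (rrefl \<sigma> (x + t) + real_vec m) \<partial>count_space UNIV) \<partial>lebesgue)"
proof -
  let ?f = "\<lambda>x. f (rrefl \<sigma> (x + t))"
  have eq: "rrefl \<sigma> (x + t) = rrefl \<sigma> t + rrefl \<sigma> x" for x by (simp add: rrefl_add add.commute)
  have "(\<integral>\<^sup>+x. f x \<partial>lebesgue) = (\<integral>\<^sup>+x. ?f x \<partial>lebesgue)"
    unfolding eq by (rule nn_integral_rrefl[OF f, symmetric])
  also have "\<dots> = (\<integral>\<^sup>+x. indicator unit_cube x * (\<integral>\<^sup>+m. ?f (x + real_vec m) \<partial>count_space UNIV) \<partial>lebesgue)"
    by (rule nn_integral_tile) (unfold eq, rule borel_measurable_rrefl[OF f])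
  also have "(\<lambda>x. \<integral>\<^sup>+m. ?f (x + real_vec m) \<partial>count_space UNIV) =
     (\<lambda>x. \<integral>\<^sup>+m. f (rrefl \<sigma> (x + t) + real_vec m) \<partial>count_space UNIV)"
  proof -
    have "?f (x + real_vec m) = f (rrefl \<sigma> (x + t) + real_vec (reflect \<sigma> m))" for x m
      by (simp add: rrefl_add rrefl_real_vec algebra_simps)
    then show ?thesis
      using nn_integral_bij_count_space[OF bij_reflect, of "\<lambda>m. f (rrefl \<sigma> (_ + t) + real_vec m)" \<sigma>] by simp
  qed
  finally show ?thesis .
qed

text \<open>By tiling, the integral of the lattice sum over the cube is the squared norm of
  \<open>g\<close>, so the sum is finite almost everywhere on the cube. It is periodic, and the
  integer translates carry this to all of space.\<close>

lemma AE_square_summable: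
  fixes g :: "real^'n \<Rightarrow> complex"
  assumes "g \<in> L2"
  shows "AE x in lebesgue. integrable (count_space UNIV) (\<lambda>m. (norm (g (x + real_vec m)))\<^sup>2)"
proof -
  let ?s = "\<lambda>x. \<integral>\<^sup>+m. ennreal ((norm (g (x + real_vec m)))\<^sup>2) \<partial>count_space UNIV"
  have m: "(\<lambda>x. ennreal ((norm (g x))\<^sup>2)) \<in> borel_measurable lebesgue"
    and i: "integrable lebesgue (\<lambda>x. (norm (g x))\<^sup>2)" using assms by (auto simp: L2_def)
  have "(\<integral>\<^sup>+x. indicator unit_cube x * ?s x \<partial>lebesgue) = (\<integral>\<^sup>+x. ennreal ((norm (g x))\<^sup>2) \<partial>lebesgue)"
    by (rule nn_integral_tile[OF m, symmetric])
  also have "\<dots> < \<infinity>" using i by (simp add: nn_integral_eq_integral)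
  finally have "(\<integral>\<^sup>+x. indicator unit_cube x * ?s x \<partial>lebesgue) \<noteq> \<infinity>" by simp
  moreover have "(\<lambda>x. indicator unit_cube x * ?s x) \<in> borel_measurable lebesgue"
    by (intro borel_measurable_times_ennreal borel_measurable_count_sum borel_measurable_translate[OF m]
        borel_measurable_indicator unit_cube_lebesgue)
  ultimately have "AE x in lebesgue. indicator unit_cube x * ?s x \<noteq> \<infinity>"
    by (intro nn_integral_PInf_AE) auto
  then have "AE x in lebesgue. indicator unit_cube (x + real_vec l) * ?s (x + real_vec l) \<noteq> \<infinity>" for l
    by (rule AE_translate)
  then have "AE x in lebesgue. \<forall>l. indicator unit_cube (x + real_vec l) * ?s (x + real_vec l) \<noteq> \<infinity>"
    by (subst AE_all_countable) blast
  then show ?thesis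
  proof eventually_elim
    case (elim x)
    let ?l = "- floor_vec x"
    have "?s (x + real_vec ?l) \<noteq> \<infinity>"
      using elim[rule_format, of ?l] add_real_vec_mem_unit_cube[of x ?l] by simp
    moreover have "?s (x + real_vec ?l) = ?s x"
      using nn_integral_bij_count_space[OF bij_plus, of "\<lambda>m. ennreal ((norm (g (x + real_vec m)))\<^sup>2)" ?l]
      by (simp only: real_vec_simps add.assoc)
    ultimately show ?case
      by (intro integrableI_bounded) (auto simp: top.not_eq_extremum)
  qed
qed

subsection \<open>Exponentials on the unit cube\<close>

definition cube_exp :: "int^'n \<Rightarrow> real^'n \<Rightarrow> complex" where
  "cube_exp \<gamma> x = indicator unit_cube x * cis (2 * pi * (x \<bullet> real_vec \<gamma>))"

lemma inner_real_vec_Ints: "real_vec a \<bullet> real_vec b = of_int (int_inner a b)"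
  by (simp add: inner_vec_def int_inner_def)

lemma borel_measurable_cis [measurable (raw)]:
  "f \<in> borel_measurable M \<Longrightarrow> (\<lambda>x. cis (f x)) \<in> borel_measurable M"
  by (rule borel_measurable_continuous_on[of cis]) (auto intro!: continuous_intros simp: cis_conv_exp)

lemma borel_measurable_lebesgue_inner [measurable]:
  fixes v :: "'a::euclidean_space"
  shows "(\<lambda>x. x \<bullet> v) \<in> borel_measurable lebesgue" "(\<lambda>x. v \<bullet> x) \<in> borel_measurable lebesgue"
  by (intro measurable_completion; simp)+

lemma borel_measurable_cube_indicator_times:
  "f \<in> borel_measurable lebesgue \<Longrightarrow> (\<lambda>x. indicator unit_cube x * f x :: complex) \<in> borel_measurable lebesgue"
  by (intro borel_measurable_times borel_measurable_indicator) auto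

lemma integrable_indicator_unit_cube: "integrable lebesgue (indicator (unit_cube :: (real^'n) set) :: _ \<Rightarrow> real)"
  by (rule integrable_real_indicator) (simp_all only: unit_cube_lebesgue emeasure_unit_cube, simp)

lemma integrable_bounded_unit_cube:
  fixes f :: "real^'n \<Rightarrow> 'b::{banach, second_countable_topology}"
  assumes "f \<in> borel_measurable lebesgue" and "\<And>x. x \<in> unit_cube \<Longrightarrow> norm (f x) \<le> B"
  shows "integrable lebesgue (\<lambda>x. indicator unit_cube x *\<^sub>R f x)"
proof (rule Bochner_Integration.integrable_bound)
  show "integrable lebesgue (\<lambda>x. B * indicator (unit_cube :: (real^'n) set) x)"
    by (intro integrable_mult_right integrable_indicator_unit_cube)
  show "(\<lambda>x. indicator unit_cube x *\<^sub>R f x) \<in> borel_measurable lebesgue"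
    using assms(1) by (intro borel_measurable_scaleR borel_measurable_indicator) auto
  show "AE x in lebesgue. norm (indicator unit_cube x *\<^sub>R f x) \<le> norm (B * indicator unit_cube x)"
    using assms(2) by (auto simp: indicator_def intro!: AE_I2 intro: order_trans[OF _ abs_ge_self])
qed

lemma one_plus_minus_cos_nonneg: "0 \<le> 1 + cos (y :: real)" "0 \<le> 1 - cos y"
  using cos_ge_minus_one[of y] cos_le_one[of y] by linarith+

text \<open>A shift by half a period along a coordinate with nonzero frequency reverses the sign of
  the cosine. Shift invariance is available for nonnegative integrands, hence the comparison of
  \<open>1 + cos\<close> with \<open>1 - cos\<close>. The phase \<open>\<theta>\<close> makes the
  statement cover the sine.\<close>

lemma integral_cos_unit_cube:
  fixes \<delta> :: "int^'n"
  assumes "\<delta> \<noteq> 0"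
  shows "(LINT x|lebesgue. indicator unit_cube x * cos (2 * pi * (x \<bullet> real_vec \<delta>) + \<theta>)) = 0"
proof -
  obtain i where i: "\<delta> $ i \<noteq> 0" using assms by (auto simp: vec_eq_iff)
  define v :: "real^'n" where "v = axis i (1 / (2 * of_int (\<delta> $ i)))"
  have v: "v \<bullet> real_vec \<delta> = 1 / 2" using i by (simp add: v_def inner_axis')
  let ?c = "\<lambda>x. cos (2 * pi * (x \<bullet> real_vec \<delta>) + \<theta>)"
  let ?p = "\<lambda>x. ennreal (1 + ?c x)"
  have cm: "?c \<in> borel_measurable lebesgue" by measurable
  have per: "?c (x + real_vec m) = ?c x" for x m
  proof -
    have "?c (x + real_vec m) = cos ((2 * pi * (x \<bullet> real_vec \<delta>) + \<theta>) + 2 * pi * of_int (int_inner m \<delta>))"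
      by (simp add: inner_add_left inner_real_vec_Ints algebra_simps)
    then show ?thesis by (simp add: cos_add cos_int_2pin sin_int_2pin)
  qed
  have neg: "?c (x + v) = - ?c x" for x
  proof -
    have "?c (x + v) = cos ((2 * pi * (x \<bullet> real_vec \<delta>) + \<theta>) + pi)"
      by (simp add: inner_add_left v algebra_simps)
    then show ?thesis by simp
  qed
  have ic: "integrable lebesgue (\<lambda>x. indicator (unit_cube :: (real^'n) set) x * ?c x)"
    using integrable_bounded_unit_cube[OF cm, of 1] by simp
  have eq: "(\<integral>\<^sup>+x. indicator unit_cube x * ennreal (1 + s * ?c x) \<partial>lebesgue) =
     ennreal (LINT x|lebesgue. indicator (unit_cube :: (real^'n) set) x + s * (indicator unit_cube x * ?c x))"
    if "s \<in> {1, -1}" for s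
  proof -
    have nn: "0 \<le> 1 + s * ?c x" for x
      using that one_plus_minus_cos_nonneg[of "2 * pi * (x \<bullet> real_vec \<delta>) + \<theta>"] by auto
    have "(\<integral>\<^sup>+x. indicator unit_cube x * ennreal (1 + s * ?c x) \<partial>lebesgue) =
      (\<integral>\<^sup>+x. ennreal (indicator (unit_cube :: (real^'n) set) x + s * (indicator unit_cube x * ?c x)) \<partial>lebesgue)"
      by (intro nn_integral_cong) (simp add: indicator_def)
    also have "\<dots> = ennreal (LINT x|lebesgue. indicator (unit_cube :: (real^'n) set) x + s * (indicator unit_cube x * ?c x))"
      using nn by (intro nn_integral_eq_integral Bochner_Integration.integrable_add integrable_mult_right ic integrable_indicator_unit_cube)
        (auto simp: indicator_def)
    finally show ?thesis .
  qed
  have "(\<integral>\<^sup>+x. indicator unit_cube x * ?p (x + v) \<partial>lebesgue) = (\<integral>\<^sup>+x. indicator unit_cube x * ?p x \<partial>lebesgue)"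
    using cm by (intro nn_integral_periodic_shift) (auto simp: per)
  then have "(\<integral>\<^sup>+x. indicator unit_cube x * ennreal (1 + (-1) * ?c x) \<partial>lebesgue) =
    (\<integral>\<^sup>+x. indicator unit_cube x * ennreal (1 + 1 * ?c x) \<partial>lebesgue)"
    by (simp add: neg)
  then have "ennreal (LINT x|lebesgue. indicator (unit_cube :: (real^'n) set) x + (-1) * (indicator unit_cube x * ?c x)) =
      ennreal (LINT x|lebesgue. indicator (unit_cube :: (real^'n) set) x + 1 * (indicator unit_cube x * ?c x))"
    by (subst (asm) (1 2) eq) auto
  moreover have "0 \<le> (LINT x|lebesgue. indicator (unit_cube :: (real^'n) set) x + s * (indicator unit_cube x * ?c x))"
    if "s \<in> {1, -1}" for s
    by (rule integral_nonneg_AE, rule AE_I2)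
      (use that one_plus_minus_cos_nonneg[of "2 * pi * (_ \<bullet> real_vec \<delta>) + \<theta>"] in \<open>auto simp: indicator_def\<close>)
  ultimately have "(LINT x|lebesgue. indicator (unit_cube :: (real^'n) set) x + (-1) * (indicator unit_cube x * ?c x)) =
      (LINT x|lebesgue. indicator (unit_cube :: (real^'n) set) x + 1 * (indicator unit_cube x * ?c x))"
    by (subst (asm) ennreal_inj) blast+
  then show ?thesis
    using Bochner_Integration.integral_add[OF integrable_indicator_unit_cube ic]
      Bochner_Integration.integral_diff[OF integrable_indicator_unit_cube ic] by simp
qed

lemma L2_bounded_unit_cube:
  fixes f :: "real^'n \<Rightarrow> complex"
  assumes "f \<in> borel_measurable lebesgue" and "\<And>x. x \<in> unit_cube \<Longrightarrow> norm (f x) \<le> B"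
  shows "(\<lambda>x. indicator unit_cube x * f x) \<in> L2"
proof -
  have "(norm (f x))\<^sup>2 \<le> B\<^sup>2" if "x \<in> unit_cube" for x
    using assms(2)[OF that] by (intro power_mono) auto
  then have "integrable lebesgue (\<lambda>x. indicator unit_cube x *\<^sub>R (norm (f x))\<^sup>2)"
    using assms(1) by (intro integrable_bounded_unit_cube[of _ "B\<^sup>2"]) auto
  moreover have "(norm (indicator unit_cube x * f x))\<^sup>2 = indicator unit_cube x *\<^sub>R (norm (f x))\<^sup>2" for x
    by (simp add: indicator_def)
  ultimately show ?thesis
    using assms(1) by (simp add: L2_def borel_measurable_cube_indicator_times)
qed

lemma cube_exp_L2: "cube_exp \<gamma> \<in> L2"
proof -
  have "(\<lambda>x. indicator unit_cube x * cis (2 * pi * (x \<bullet> real_vec \<gamma>))) \<in> L2"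
    by (rule L2_bounded_unit_cube[of _ 1]) (simp_all, measurable)
  then show ?thesis by (simp add: cube_exp_def[abs_def])
qed

lemma cube_exp_orthonormal: "l2_inner (cube_exp \<gamma>) (cube_exp \<gamma>') = (if \<gamma> = \<gamma>' then 1 else 0)"
proof -
  let ?\<delta> = "\<gamma> - \<gamma>'"
  have "cube_exp \<gamma> x * cnj (cube_exp \<gamma>' x) = indicator unit_cube x * cis (2 * pi * (x \<bullet> real_vec ?\<delta>))" for x
    by (auto simp: cube_exp_def indicator_def cis_mult cis_cnj inner_diff_right algebra_simps)
  then have *: "l2_inner (cube_exp \<gamma>) (cube_exp \<gamma>') = (LINT x|lebesgue. indicator unit_cube x * cis (2 * pi * (x \<bullet> real_vec ?\<delta>)))"
    by (simp add: l2_inner_def)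
  show ?thesis
  proof (cases "\<gamma> = \<gamma>'")
    case True
    have "(LINT x|lebesgue. indicator (unit_cube :: (real^'n) set) x) = measure lebesgue (unit_cube :: (real^'n) set)"
      by (simp add: Bochner_Integration.integral_indicator del: measure_completion)
    then have one: "(LINT x|lebesgue. indicator (unit_cube :: (real^'n) set) x) = (1 :: real)"
      using emeasure_unit_cube[where 'n = 'n] by (simp add: measure_def del: emeasure_completion)
    have "(LINT x|lebesgue. indicator (unit_cube :: (real^'n) set) x :: complex) =
        (LINT x|lebesgue. complex_of_real (indicator (unit_cube :: (real^'n) set) x))"
      by (rule Bochner_Integration.integral_cong) (simp_all add: indicator_def)
    then have "(LINT x|lebesgue. indicator (unit_cube :: (real^'n) set) x :: complex) = 1"
      by (simp only: integral_complex_of_real one of_real_1)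
    then show ?thesis using True * by simp
  next
    case False
    then have d: "?\<delta> \<noteq> 0" by simp
    \<comment> \<open>The phases 0 and \<open>- (pi / 2)\<close> yield the real and the imaginary
      part.\<close>
    let ?c = "\<lambda>\<theta> x. indicator unit_cube x * cos (2 * pi * (x \<bullet> real_vec ?\<delta>) + \<theta>)"
    have i: "integrable lebesgue (?c \<theta>)" for \<theta>
      using integrable_bounded_unit_cube[of "\<lambda>x. cos (2 * pi * (x \<bullet> real_vec ?\<delta>) + \<theta>)" 1] by simp
    have "indicator unit_cube x * cis (2 * pi * (x \<bullet> real_vec ?\<delta>)) = of_real (?c 0 x) + \<i> * of_real (?c (- (pi / 2)) x)" for x
      by (auto simp: indicator_def complex_eq_iff cos_diff)
    then have "(LINT x|lebesgue. indicator unit_cube x * cis (2 * pi * (x \<bullet> real_vec ?\<delta>))) =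
       of_real (LINT x|lebesgue. ?c 0 x) + \<i> * of_real (LINT x|lebesgue. ?c (- (pi / 2)) x)"
      using i[of 0] i[of "- (pi/2)"] by (simp del: of_real_mult)
    then show ?thesis
      using False * integral_cos_unit_cube[OF d, of 0] integral_cos_unit_cube[OF d, of "- (pi / 2)"]
      by (simp only: of_real_0 mult_zero_right add_0 if_False)
  qed
qed

lemma l2_norm_orthonormal_lincomb:
  assumes F: "finite F" and e: "\<And>j. j \<in> F \<Longrightarrow> e j \<in> L2"
    and on: "\<And>i j. i \<in> F \<Longrightarrow> j \<in> F \<Longrightarrow> l2_inner (e i) (e j) = (if i = j then 1 else 0)"
  shows "(l2_norm (\<lambda>x. \<Sum>j\<in>F. c j * e j x))\<^sup>2 = (\<Sum>j\<in>F. (norm (c j))\<^sup>2)"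
proof -
  let ?u = "\<lambda>x. \<Sum>j\<in>F. c j * e j x"
  have u: "?u \<in> L2" using F e by (rule L2_lincomb)
  have "l2_inner ?u (e i) = c i" if i: "i \<in> F" for i
  proof -
    have "l2_inner ?u (e i) = (LINT x|lebesgue. (\<Sum>j\<in>F. c j * (e j x * cnj (e i x))))"
      unfolding l2_inner_def by (simp add: sum_distrib_right mult.assoc)
    also have "\<dots> = (\<Sum>j\<in>F. c j * l2_inner (e j) (e i))"
      unfolding l2_inner_def using e i
      by (subst Bochner_Integration.integral_sum) (auto intro!: integrable_mult_right L2_inner_integrable)
    also have "\<dots> = (\<Sum>j\<in>F. if i = j then c j else 0)" using on i by (intro sum.cong) auto
    finally show ?thesis using F i by simp
  qed
  then have "of_real ((l2_norm ?u)\<^sup>2) = (\<Sum>j\<in>F. cnj (c j) * c j)"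
    unfolding l2_inner_self[symmetric] using l2_inner_lincomb_right[OF u F e] by simp
  also have "\<dots> = of_real (\<Sum>j\<in>F. (norm (c j))\<^sup>2)"
    unfolding of_real_sum complex_norm_square by (simp add: mult.commute)
  finally show ?thesis by (simp only: of_real_eq_iff)
qed

lemma bessel_inequality:
  assumes F: "finite F" and e: "\<And>j. j \<in> F \<Longrightarrow> e j \<in> L2"
    and on: "\<And>i j. i \<in> F \<Longrightarrow> j \<in> F \<Longrightarrow> l2_inner (e i) (e j) = (if i = j then 1 else 0)" and f: "f \<in> L2"
  shows "(\<Sum>j\<in>F. (norm (l2_inner f (e j)))\<^sup>2) \<le> (l2_norm f)\<^sup>2"
proof -
  let ?u = "\<lambda>x. \<Sum>j\<in>F. l2_inner f (e j) * e j x"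
  have u: "?u \<in> L2" using F e by (rule L2_lincomb)
  have "l2_inner f ?u = (\<Sum>j\<in>F. cnj (l2_inner f (e j)) * l2_inner f (e j))"
    using f F e by (rule l2_inner_lincomb_right)
  also have "\<dots> = of_real (\<Sum>j\<in>F. (norm (l2_inner f (e j)))\<^sup>2)"
    unfolding of_real_sum complex_norm_square by (simp add: mult.commute)
  finally have "Re (l2_inner f ?u) = (\<Sum>j\<in>F. (norm (l2_inner f (e j)))\<^sup>2)" by simp
  then have "(l2_norm (\<lambda>x. f x - ?u x))\<^sup>2 = (l2_norm f)\<^sup>2 - (\<Sum>j\<in>F. (norm (l2_inner f (e j)))\<^sup>2)"
    using l2_norm_diff_sq[OF f u] l2_norm_orthonormal_lincomb[OF F e on, where c = "\<lambda>j. l2_inner f (e j)"] by simp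
  moreover have "0 \<le> (l2_norm (\<lambda>x. f x - ?u x))\<^sup>2" by simp
  ultimately show ?thesis by linarith
qed

subsection \<open>Injectivity of the Fourier integral\<close>

definition fourier_null :: "(real^'n \<Rightarrow> complex) \<Rightarrow> bool" where
  "fourier_null H \<longleftrightarrow> integrable lebesgue H \<and> (\<forall>t. fourier H t = 0)"

text \<open>Such functions form an algebra that contains the characters and is closed under bounded
  pointwise limits; it therefore reaches the indicators of all Borel sets. Multiplying
  \<open>H\<close> by the indicator of the set where its real part is positive will force
  \<open>H\<close> to vanish.\<close>

definition null_multiplier :: "(real^'n \<Rightarrow> complex) \<Rightarrow> bool" where
  "null_multiplier p \<longleftrightarrow> p \<in> borel_measurable lebesgue \<and> (\<exists>B. \<forall>x. norm (p x) \<le> B) \<and>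
     (\<forall>H. fourier_null H \<longrightarrow> fourier_null (\<lambda>x. p x * H x))"

lemma integrable_bounded_mult:
  fixes p H :: "'a \<Rightarrow> complex"
  assumes "p \<in> borel_measurable M" "\<And>x. norm (p x) \<le> B" "integrable M H"
  shows "integrable M (\<lambda>x. p x * H x)"
proof (rule Bochner_Integration.integrable_bound)
  show "integrable M (\<lambda>x. B * norm (H x))" using assms by auto
  show "(\<lambda>x. p x * H x) \<in> borel_measurable M" using assms by auto
  have "norm (p x) * norm (H x) \<le> \<bar>B * norm (H x)\<bar>" for x
    by (rule order_trans[OF mult_right_mono[OF assms(2)] abs_ge_self]) simp
  then show "AE x in M. norm (p x * H x) \<le> norm (B * norm (H x))" by (simp add: norm_mult)
qed

lemma integrable_mult_cis:
  assumes "integrable lebesgue (H :: real^'n \<Rightarrow> complex)"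
  shows "integrable lebesgue (\<lambda>x. H x * cis (c * (t \<bullet> x) + d))"
  using integrable_bounded_mult[of "\<lambda>x. cis (c * (t \<bullet> x) + d)" lebesgue 1 H] assms
  by (simp add: mult.commute)

lemma integrable_fourier:
  assumes "integrable lebesgue (H :: real^'n \<Rightarrow> complex)"
  shows "integrable lebesgue (\<lambda>x. H x * cis (- (2 * pi * (t \<bullet> x))))"
  using integrable_mult_cis[OF assms, of "- 2 * pi" t 0] by simp

lemma fourier_scale: "fourier (\<lambda>x. c * f x) t = c * fourier f t"
  by (simp add: fourier_def mult.assoc)

lemma fourier_add:
  "integrable lebesgue f \<Longrightarrow> integrable lebesgue g \<Longrightarrow> fourier (\<lambda>x. f x + g x) t = fourier f t + fourier g t"
  using integrable_fourier[of f t] integrable_fourier[of g t] by (simp add: fourier_def distrib_right)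

lemma fourier_null_scale: "fourier_null H \<Longrightarrow> fourier_null (\<lambda>x. c * H x)"
  by (auto simp: fourier_null_def fourier_scale)

lemma fourier_null_add: "fourier_null H \<Longrightarrow> fourier_null K \<Longrightarrow> fourier_null (\<lambda>x. H x + K x)"
  by (auto simp: fourier_null_def fourier_add)

lemma null_multiplier_const: "null_multiplier (\<lambda>_. c)"
  by (auto simp: null_multiplier_def intro: fourier_null_scale)

lemma null_multiplier_mult:
  assumes "null_multiplier p" "null_multiplier q"
  shows "null_multiplier (\<lambda>x. p x * q x)"
proof -
  obtain B C where "\<And>x. norm (p x) \<le> B" "\<And>x. norm (q x) \<le> C" using assms by (auto simp: null_multiplier_def)
  then have "norm (p x * q x) \<le> B * C" for x by (auto simp: norm_mult intro!: mult_mono order_trans[OF norm_ge_zero])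
  then show ?thesis using assms unfolding null_multiplier_def
    by (auto simp: mult.assoc intro!: borel_measurable_times)
qed

lemma null_multiplier_add:
  assumes "null_multiplier p" "null_multiplier q"
  shows "null_multiplier (\<lambda>x. p x + q x)"
proof -
  obtain B C where "\<And>x. norm (p x) \<le> B" "\<And>x. norm (q x) \<le> C" using assms by (auto simp: null_multiplier_def)
  then have "norm (p x + q x) \<le> B + C" for x by (auto intro!: order_trans[OF norm_triangle_ineq] add_mono)
  then show ?thesis using assms unfolding null_multiplier_def
    by (auto simp: distrib_right intro!: borel_measurable_add fourier_null_add)
qed

lemma null_multiplier_diff:
  assumes "null_multiplier p" "null_multiplier q"
  shows "null_multiplier (\<lambda>x. p x - q x)"
  using null_multiplier_add[OF assms(1) null_multiplier_mult[OF null_multiplier_const[of "-1"] assms(2)]] by simp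

lemma null_multiplier_power:
  assumes "null_multiplier p"
  shows "null_multiplier (\<lambda>x. p x ^ n)"
  by (induction n) (simp_all add: null_multiplier_const null_multiplier_mult[OF assms])

lemma null_multiplier_limit:
  assumes p: "\<And>n. null_multiplier (p n)" and B: "\<And>n x. norm (p n x) \<le> B"
    and lim: "\<And>x. (\<lambda>n. p n x) \<longlonglongrightarrow> q x"
  shows "null_multiplier q"
proof -
  have pm: "p n \<in> borel_measurable lebesgue" for n using p by (simp add: null_multiplier_def)
  have qm: "q \<in> borel_measurable lebesgue" by (rule borel_measurable_LIMSEQ_metric[OF pm lim])
  have qB: "norm (q x) \<le> B" for x
    by (rule Lim_norm_ubound[OF _ lim]) (use B in auto)
  have "fourier_null (\<lambda>x. q x * H x)" if H: "fourier_null H" for H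
  proof -
    have Hi: "integrable lebesgue H" using H by (simp add: fourier_null_def)
    have "fourier (\<lambda>x. q x * H x) t = 0" for t
    proof -
      let ?s = "\<lambda>n x. p n x * H x * cis (- (2 * pi * (t \<bullet> x)))"
      let ?f = "\<lambda>x. q x * H x * cis (- (2 * pi * (t \<bullet> x)))"
      have "(\<lambda>n. integral\<^sup>L lebesgue (?s n)) \<longlonglongrightarrow> integral\<^sup>L lebesgue ?f"
      proof (rule integral_dominated_convergence[where w = "\<lambda>x. B * norm (H x)"])
        show "?f \<in> borel_measurable lebesgue" "\<And>n. ?s n \<in> borel_measurable lebesgue"
          using pm qm Hi by (auto intro!: borel_measurable_times)
        show "integrable lebesgue (\<lambda>x. B * norm (H x))" using Hi by auto
        show "AE x in lebesgue. (\<lambda>n. ?s n x) \<longlonglongrightarrow> ?f x"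
          by (intro AE_I2 tendsto_intros lim)
        show "AE x in lebesgue. norm (?s n x) \<le> B * norm (H x)" for n
          using B by (auto simp: norm_mult intro!: mult_right_mono)
      qed
      moreover have "integral\<^sup>L lebesgue (?s n) = 0" for n
        using p[of n] H by (auto simp: null_multiplier_def fourier_null_def fourier_def)
      ultimately show ?thesis by (simp add: fourier_def LIMSEQ_unique tendsto_const)
    qed
    then show ?thesis using integrable_bounded_mult[OF qm qB Hi] by (simp add: fourier_null_def)
  qed
  then show ?thesis using qm qB by (auto simp: null_multiplier_def)
qed

lemma null_multiplier_cis: "null_multiplier (\<lambda>x. cis (2 * pi * (s \<bullet> x)))"
proof -
  have "fourier_null (\<lambda>x. cis (2 * pi * (s \<bullet> x)) * H x)" if H: "fourier_null H" for H
  proof -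
    have "integrable lebesgue (\<lambda>x. cis (2 * pi * (s \<bullet> x)) * H x)"
      using H integrable_mult_cis[of H "2 * pi" s 0] by (simp add: fourier_null_def mult.commute)
    moreover have "fourier (\<lambda>x. cis (2 * pi * (s \<bullet> x)) * H x) t = fourier H (t - s)" for t
    proof -
      have "cis (2 * pi * (s \<bullet> x)) * H x * cis (- (2 * pi * (t \<bullet> x))) = H x * cis (- (2 * pi * ((t - s) \<bullet> x)))" for x
      proof -
        have "cis (2 * pi * (s \<bullet> x)) * H x * cis (- (2 * pi * (t \<bullet> x))) =
            H x * (cis (2 * pi * (s \<bullet> x)) * cis (- (2 * pi * (t \<bullet> x))))"
          by (simp only: ac_simps)
        then show ?thesis unfolding cis_mult by (simp add: inner_diff_left right_diff_distrib)
      qed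
      then show ?thesis by (simp only: fourier_def)
    qed
    ultimately show ?thesis using H by (simp add: fourier_null_def)
  qed
  then show ?thesis by (auto simp: null_multiplier_def intro!: exI[of _ 1])
qed

lemma null_multiplier_sin: "null_multiplier (\<lambda>x. of_real (sin (s \<bullet> x + \<theta>)))"
proof -
  let ?s = "(1 / (2 * pi)) *\<^sub>R s"
  have "null_multiplier (\<lambda>x. (cis \<theta> / (2 * \<i>)) * cis (2 * pi * (?s \<bullet> x)) + (- cis (- \<theta>) / (2 * \<i>)) * cis (2 * pi * ((- ?s) \<bullet> x)))"
    by (intro null_multiplier_add null_multiplier_mult null_multiplier_const null_multiplier_cis)
  moreover have "(cis \<theta> / (2 * \<i>)) * cis (2 * pi * (?s \<bullet> x)) + (- cis (- \<theta>) / (2 * \<i>)) * cis (2 * pi * ((- ?s) \<bullet> x))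
     = of_real (sin (s \<bullet> x + \<theta>))" for x
    by (simp add: complex_eq_iff sin_add cos_add Re_divide Im_divide power2_eq_square field_simps)
  ultimately show ?thesis by simp
qed

lemma null_multiplier_indicator_power_limit:
  fixes u :: "real^'n \<Rightarrow> real"
  assumes p: "null_multiplier (\<lambda>x. of_real (u x))" and u: "\<And>x. 0 \<le> u x" "\<And>x. u x \<le> 1"
  shows "null_multiplier (indicator {x. u x = 1})"
proof (rule null_multiplier_limit)
  show "null_multiplier (\<lambda>x. of_real (u x) ^ n)" for n by (rule null_multiplier_power[OF p])
  show "norm (complex_of_real (u x) ^ n) \<le> 1" for n x
    using u by (simp add: norm_power power_le_one)
  show "(\<lambda>n. complex_of_real (u x) ^ n) \<longlonglongrightarrow> indicator {x. u x = 1} x" for x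
  proof (cases "u x = 1")
    case False
    then have "\<bar>u x\<bar> < 1" using u[of x] by auto
    then show ?thesis using False by (auto intro!: LIMSEQ_power_zero simp: norm_of_real)
  qed simp
qed

text \<open>Polynomials in \<open>u\<close> that approach a step function with its jump at 1/2.
  Bernoulli's inequality bounds them from below by \<open>1 - (2 * u) ^ n\<close>; the estimate
  \<open>1 - v \<le> exp (- v)\<close> bounds them from above by
  \<open>exp (- ((2 * u) ^ n))\<close>. At the jump they are the powers
  \<open>(1 - 1 / m) ^ m\<close> with \<open>m = 2 ^ n\<close>.\<close>

lemma power_threshold_limit:
  fixes u :: real
  assumes "0 \<le> u" "u \<le> 1"
  shows "(\<lambda>n. (1 - u ^ n) ^ (2 ^ n)) \<longlonglongrightarrow> (if u < 1 / 2 then 1 else if u = 1 / 2 then exp (- 1) else 0)"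
proof -
  have un: "0 \<le> u ^ n" "u ^ n \<le> 1" for n using assms by (auto simp: power_le_one)
  consider "u < 1/2" | "u = 1/2" | "u > 1/2" by linarith
  then show ?thesis
  proof cases
    case 1
    have l: "1 - (2 * u) ^ n \<le> (1 - u ^ n) ^ (2 ^ n)" for n
      using Bernoulli_inequality[of "- (u ^ n)" "2 ^ n"] un[of n] by (simp add: power_mult_distrib)
    have r: "(1 - u ^ n) ^ (2 ^ n) \<le> 1" for n using un[of n] by (intro power_le_one) auto
    have "(\<lambda>n. (2 * u) ^ n) \<longlonglongrightarrow> 0" using 1 assms by (intro LIMSEQ_power_zero) simp
    from tendsto_diff[OF tendsto_const this] have "(\<lambda>n. 1 - (2 * u) ^ n) \<longlonglongrightarrow> 1" by simp
    from tendsto_sandwich[where f = "\<lambda>n. 1 - (2 * u) ^ n" and g = "\<lambda>n. (1 - u ^ n) ^ (2 ^ n)"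
        and h = "\<lambda>_. 1", OF always_eventually always_eventually this tendsto_const]
    have "(\<lambda>n. (1 - u ^ n) ^ (2 ^ n)) \<longlonglongrightarrow> 1" using l r by simp
    then show ?thesis using 1 by simp
  next
    case 2
    have "filterlim (\<lambda>n. 2 ^ n :: nat) sequentially sequentially"
      by (rule filterlim_subseq) (simp add: strict_mono_def)
    from filterlim_compose[OF tendsto_exp_limit_sequentially[of "-1"] this] show ?thesis
      unfolding 2 by (simp add: power_one_over)
  next
    case 3
    have up: "(1 - u ^ n) ^ (2 ^ n) \<le> exp (- ((2 * u) ^ n))" for n
    proof -
      have "(1 - u ^ n) ^ (2 ^ n) \<le> exp (- (u ^ n)) ^ (2 ^ n)"
        using exp_ge_add_one_self[of "- (u ^ n)"] un[of n] by (intro power_mono) auto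
      also have "\<dots> = exp (- ((2 * u) ^ n))" by (simp add: exp_of_nat_mult[symmetric] power_mult_distrib)
      finally show ?thesis .
    qed
    have "filterlim (\<lambda>n. (2 * u) ^ n) at_top sequentially"
      using 3 filterlim_realpow_sequentially_gt1[of "2 * u"] by (simp add: filterlim_at_infinity_imp_filterlim_at_top)
    then have "(\<lambda>n. exp (- ((2 * u) ^ n))) \<longlonglongrightarrow> 0"
      by (intro filterlim_compose[OF exp_at_bot] filterlim_compose[OF filterlim_uminus_at_bot_at_top])
    moreover have "0 \<le> (1 - u ^ n) ^ (2 ^ n)" for n using un[of n] by simp
    ultimately have "(\<lambda>n. (1 - u ^ n) ^ (2 ^ n)) \<longlonglongrightarrow> 0"
      using up tendsto_sandwich[where f = "\<lambda>_. 0" and g = "\<lambda>n. (1 - u ^ n) ^ (2 ^ n)"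
        and h = "\<lambda>n. exp (- ((2 * u) ^ n))", OF always_eventually always_eventually tendsto_const] by simp
    then show ?thesis using 3 by simp
  qed
qed

lemma null_multiplier_indicator_sin: "null_multiplier (indicator {x. 0 < sin (s \<bullet> x + \<theta>)})"
proof -
  define u where "u = (\<lambda>x. (1 - sin (s \<bullet> x + \<theta>)) / 2)"
  have u: "0 \<le> u x" "u x \<le> 1" for x
    unfolding u_def using sin_le_one[of "s \<bullet> x + \<theta>"] sin_ge_minus_one[of "s \<bullet> x + \<theta>"] by auto
  \<comment> \<open>Positivity of the sine is \<open>u x < 1 / 2\<close>. Where the sine vanishes
    the limit takes the spurious value \<open>exp (- 1)\<close>; a second limit, of the powers of
    \<open>L\<close>, removes it because it is less than 1.\<close>
  define L where "L = (\<lambda>x. if u x < 1 / 2 then 1 else if u x = 1 / 2 then exp (- 1) else 0 :: real)"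
  have "null_multiplier (\<lambda>x. (1/2) * (1 - of_real (sin (s \<bullet> x + \<theta>))))"
    by (intro null_multiplier_mult null_multiplier_diff null_multiplier_const null_multiplier_sin)
  then have un: "null_multiplier (\<lambda>x. of_real (u x))" by (simp add: u_def)
  have "null_multiplier (\<lambda>x. of_real (L x))"
  proof (rule null_multiplier_limit)
    show "null_multiplier (\<lambda>x. (1 - of_real (u x) ^ n) ^ (2 ^ n))" for n
      by (intro null_multiplier_power null_multiplier_diff null_multiplier_const un)
    have eq: "(1 - complex_of_real (u x) ^ n) ^ (2 ^ n) = of_real ((1 - u x ^ n) ^ (2 ^ n))" for n x by simp
    show "norm ((1 - complex_of_real (u x) ^ n) ^ (2 ^ n)) \<le> 1" for n x
      unfolding eq norm_of_real using u[of x] by (simp add: power_abs power_le_one abs_le_iff)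
    show "(\<lambda>n. (1 - complex_of_real (u x) ^ n) ^ (2 ^ n)) \<longlonglongrightarrow> of_real (L x)" for x
      unfolding eq L_def by (rule tendsto_of_real[OF power_threshold_limit[OF u]])
  qed
  then have "null_multiplier (indicator {x. L x = 1})"
    by (rule null_multiplier_indicator_power_limit) (auto simp: L_def)
  moreover have "{x. L x = 1} = {x. 0 < sin (s \<bullet> x + \<theta>)}" by (auto simp: L_def u_def)
  ultimately show ?thesis by simp
qed

text \<open>Stretch the sine: once \<open>\<bar>x \<bullet> i - a\<bar>\<close> divided by
  \<open>Suc n\<close> is below \<open>pi\<close>, the sine of
  \<open>(x \<bullet> i - a) / Suc n\<close> has the sign of \<open>x \<bullet> i - a\<close>. The
  indicators are thus eventually constant at each point.\<close>

lemma null_multiplier_indicator_halfspace: "null_multiplier (indicator {x. a < x \<bullet> i})"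
proof (rule null_multiplier_limit)
  let ?A = "\<lambda>n. {x. 0 < sin (((1 / real (Suc n)) *\<^sub>R i) \<bullet> x + (- a / real (Suc n)))}"
  show "null_multiplier (indicator (?A n))" for n by (rule null_multiplier_indicator_sin)
  show "norm (indicator (?A n) x :: complex) \<le> 1" for n x by (simp add: indicator_def)
  show "(\<lambda>n. indicator (?A n) x :: complex) \<longlonglongrightarrow> indicator {x. a < x \<bullet> i} x" for x
  proof (rule tendsto_eventually)
    let ?y = "x \<bullet> i - a"
    have "(\<lambda>n. \<bar>?y\<bar> / real (Suc n)) \<longlonglongrightarrow> 0"
      by (rule LIMSEQ_Suc[OF lim_const_over_n])
    then have "\<forall>\<^sub>F n in sequentially. \<bar>?y\<bar> / real (Suc n) < pi"
      by (rule order_tendstoD) simp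
    then show "\<forall>\<^sub>F n in sequentially. indicator (?A n) x = (indicator {x. a < x \<bullet> i} x :: complex)"
    proof eventually_elim
      case (elim n)
      let ?z = "?y / real (Suc n)"
      have z: "((1 / real (Suc n)) *\<^sub>R i) \<bullet> x + (- a / real (Suc n)) = ?z"
        by (simp add: inner_commute diff_divide_distrib)
      have "\<bar>?z\<bar> < pi" using elim by simp
      then have "0 < sin ?z \<longleftrightarrow> 0 < ?z"
      proof -
        have "0 < sin w" if "0 < w" "w < pi" for w using that by (rule sin_gt_zero)
        from this[of ?z] this[of "- ?z"] \<open>\<bar>?z\<bar> < pi\<close> show ?thesis
          unfolding sin_minus abs_less_iff by (cases "?z = 0") (linarith | simp)+
      qed
      also have "\<dots> \<longleftrightarrow> a < x \<bullet> i" by (simp add: zero_less_divide_iff)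
      finally show ?case by (simp only: indicator_def z mem_Collect_eq)
    qed
  qed
qed

text \<open>Half-spaces generate the Borel sets. Complements come from subtracting from 1, finite
  unions from products of complements, and a countable union is the bounded pointwise limit of the
  finite ones.\<close>

lemma null_multiplier_indicator_borel:
  assumes "A \<in> sets (borel :: (real^'n) measure)"
  shows "null_multiplier (indicator A)"
proof -
  have "A \<in> sigma_sets UNIV ((\<lambda>(a, i). {x :: real^'n. a < x \<bullet> i}) ` (UNIV \<times> Basis))"
    using assms by (subst (asm) borel_eq_halfspace_greater) auto
  then show ?thesis
  proof (induction rule: sigma_sets.induct)
    case (Basic a)
    then show ?case by (auto intro: null_multiplier_indicator_halfspace)
  next
    case Empty
    then show ?case using null_multiplier_const[of 0] by simp
  next
    case (Compl a)
    then have "null_multiplier (\<lambda>x. 1 - indicator a x)"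
      by (intro null_multiplier_diff null_multiplier_const)
    then show ?case by (simp add: indicator_diff[of _ UNIV, symmetric] indicator_compl Compl_eq_Diff_UNIV[symmetric])
  next
    case (Union a)
    show ?case
    proof (rule null_multiplier_limit)
      have fin: "null_multiplier (\<lambda>x. \<Prod>i<n. 1 - indicator (a i) x)" for n
        by (induction n) (auto intro!: null_multiplier_const null_multiplier_mult null_multiplier_diff Union)
      show "null_multiplier (\<lambda>x. 1 - (\<Prod>i<n. 1 - indicator (a i) x))" for n
        by (intro null_multiplier_diff null_multiplier_const fin)
      have eq: "1 - (\<Prod>i<n. 1 - indicator (a i) x) = (indicator (\<Union>i<n. a i) x :: complex)" for n x
        by (induction n) (auto simp: indicator_def lessThan_Suc)
      show "norm (1 - (\<Prod>i<n. 1 - indicator (a i) x) :: complex) \<le> 1" for n x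
        unfolding eq by (simp add: indicator_def)
      show "(\<lambda>n. 1 - (\<Prod>i<n. 1 - indicator (a i) x)) \<longlonglongrightarrow> (indicator (\<Union>i. a i) x :: complex)" for x
        unfolding eq by (rule LIMSEQ_indicator_UN)
    qed
  qed
qed

text \<open>The set \<open>A\<close> where the real part is positive agrees with a Borel set
  \<open>S\<close> up to a null set. The Fourier integral of \<open>H\<close> restricted to
  \<open>S\<close>, taken at frequency 0, is the integral of \<open>H\<close> over \<open>A\<close>;
  it vanishes although its real part integrates a nonnegative function.\<close>

lemma fourier_null_Re_nonpos:
  assumes H: "fourier_null (H :: real^'n \<Rightarrow> complex)"
  shows "AE x in lebesgue. Re (H x) \<le> 0"
proof -
  have Hi: "integrable lebesgue H" using H by (simp add: fourier_null_def)
  have Hm: "H \<in> borel_measurable lebesgue" using Hi by auto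
  define A where "A = {x. 0 < Re (H x)}"
  have A: "A \<in> sets lebesgue"
  proof -
    have "{x \<in> space lebesgue. 0 < Re (H x)} \<in> sets lebesgue" using Hm by measurable
    then show ?thesis by (simp add: A_def)
  qed
  then obtain S N N' where S: "S \<in> sets lborel" "N' \<in> null_sets lborel" "N \<subseteq> N'" "A = S \<union> N"
    by (auto elim!: sets_completionE)
  have AE: "AE x in lebesgue. x \<notin> N'"
    by (rule AE_not_in) (use S in \<open>simp add: null_sets_completionI\<close>)
  have "fourier_null (\<lambda>x. indicator S x * H x)"
    using null_multiplier_indicator_borel[of S] S H by (auto simp: null_multiplier_def)
  then have "(LINT x|lebesgue. indicator S x * H x) = 0"
    by (auto simp: fourier_null_def fourier_def dest!: spec[of _ 0])
  moreover have iA: "integrable lebesgue (\<lambda>x. indicator A x * H x)"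
    by (rule integrable_bounded_mult[where B = 1]) (use A Hi in \<open>auto simp: indicator_def\<close>)
  have "(LINT x|lebesgue. indicator S x * H x) = (LINT x|lebesgue. indicator A x * H x)"
    using A S Hm AE by (intro integral_cong_AE borel_measurable_times borel_measurable_indicator)
      (auto simp: indicator_def)
  ultimately have "Re (LINT x|lebesgue. indicator A x * H x) = 0" by simp
  then have 0: "(LINT x|lebesgue. Re (indicator A x * H x)) = 0"
    using integral_Re[OF iA] by simp
  have nn: "0 \<le> Re (indicator A x * H x)" for x by (auto simp: A_def indicator_def)
  have "AE x in lebesgue. Re (indicator A x * H x) = 0"
    using integral_nonneg_eq_0_iff_AE[OF integrable_Re[OF iA]] nn 0 by simp
  then show ?thesis
  proof eventually_elim
    case (elim x)
    then show ?case by (cases "0 < Re (H x)") (simp_all add: A_def)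
  qed
qed

theorem fourier_null_AE_zero:
  assumes H: "fourier_null (H :: real^'n \<Rightarrow> complex)"
  shows "AE x in lebesgue. H x = 0"
proof -
  have "AE x in lebesgue. Re (c * H x) \<le> 0" for c
    by (rule fourier_null_Re_nonpos[OF fourier_null_scale[OF H]])
  from this[of 1] this[of "-1"] this[of \<i>] this[of "- \<i>"]
  show ?thesis by eventually_elim (auto simp: complex_eq_iff)
qed

subsection \<open>The Fourier transform of a square-integrable function\<close>

text \<open>Fubini's theorem is applied on the product of \<open>lborel\<close> with itself, which
  Lebesgue measurable functions enter through Borel representatives.\<close>

lemma lebesgue_integrable_borel_representative:
  fixes f :: "'a::euclidean_space \<Rightarrow> complex"
  assumes f: "integrable lebesgue f"
  obtains f' where "f' \<in> borel_measurable borel" "integrable lborel f'" "AE x in lebesgue. f x = f' x"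
proof -
  have m: "(\<lambda>x. Re (f x)) \<in> borel_measurable (completion lborel)" "(\<lambda>x. Im (f x)) \<in> borel_measurable (completion lborel)"
    using f by auto
  obtain r where r: "r \<in> borel_measurable lborel" "AE x in lborel. Re (f x) = r x"
    using completion_ex_borel_measurable_real[OF m(1)] by blast
  obtain i where i: "i \<in> borel_measurable lborel" "AE x in lborel. Im (f x) = i x"
    using completion_ex_borel_measurable_real[OF m(2)] by blast
  define f' where "f' = (\<lambda>x. Complex (r x) (i x))"
  have f'm: "f' \<in> borel_measurable lborel"
    unfolding f'_def Complex_eq using r(1) i(1) by measurable
  have ae: "AE x in lebesgue. f x = f' x"
    using AE_completion[OF r(2)] AE_completion[OF i(2)]
    by eventually_elim (simp add: f'_def complex_eq_iff)
  have "integrable lebesgue f'"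
    using f ae f'm by (subst integrable_cong_AE[of _ _ f]) (auto intro: measurable_completion)
  then have "integrable lborel f'" using f'm by (simp add: integrable_completion)
  then show thesis using that f'm ae by simp
qed

lemma fourier_lborel:
  assumes "f' \<in> borel_measurable borel" "f \<in> borel_measurable lebesgue" "AE x in lebesgue. f x = f' x"
  shows "fourier f \<omega> = (LINT x|lborel. f' x * cis (- (2 * pi * (\<omega> \<bullet> x))))"
proof -
  have "fourier f \<omega> = (LINT x|lebesgue. f' x * cis (- (2 * pi * (\<omega> \<bullet> x))))"
    unfolding fourier_def
    by (rule integral_cong_AE) (use assms in \<open>auto intro!: borel_measurable_times measurable_completion\<close>)
  also have "\<dots> = (LINT x|lborel. f' x * cis (- (2 * pi * (\<omega> \<bullet> x))))"
    by (rule integral_completion) (use assms in measurable)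
  finally show ?thesis .
qed

lemma borel_measurable_fourier:
  assumes "integrable lebesgue f"
  shows "fourier f \<in> borel_measurable borel"
proof -
  obtain f' where [measurable]: "f' \<in> borel_measurable borel" and f': "AE x in lebesgue. f x = f' x"
    using lebesgue_integrable_borel_representative[OF assms] by metis
  have "(\<lambda>\<omega>. LINT x|lborel. f' x * cis (- (2 * pi * (\<omega> \<bullet> x)))) \<in> borel_measurable borel"
    by measurable
  then show ?thesis using fourier_lborel[of f' f] assms f' by (simp add: fun_eq_iff[symmetric] cong: measurable_cong)
qed

lemma fourier_multiplication_formula:
  assumes "integrable lebesgue \<phi>" "integrable lebesgue \<psi>"
  shows "(LINT \<omega>|lebesgue. fourier \<phi> \<omega> * \<psi> \<omega>) = (LINT x|lebesgue. \<phi> x * fourier \<psi> x)"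
proof -
  obtain f where [measurable]: "f \<in> borel_measurable borel" and f: "integrable lborel f" "AE x in lebesgue. \<phi> x = f x"
    using lebesgue_integrable_borel_representative[OF assms(1)] by metis
  obtain g where [measurable]: "g \<in> borel_measurable borel" and g: "integrable lborel g" "AE x in lebesgue. \<psi> x = g x"
    using lebesgue_integrable_borel_representative[OF assms(2)] by metis
  have F: "fourier \<phi> \<omega> = (LINT x|lborel. f x * cis (- (2 * pi * (\<omega> \<bullet> x))))" for \<omega>
    by (rule fourier_lborel) (use f assms in auto)
  have G: "fourier \<psi> x = (LINT \<omega>|lborel. g \<omega> * cis (- (2 * pi * (x \<bullet> \<omega>))))" for x
    by (rule fourier_lborel) (use g assms in auto)
  have Fm [measurable]: "fourier \<phi> \<in> borel_measurable borel" "fourier \<psi> \<in> borel_measurable borel"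
    using assms borel_measurable_fourier by blast+
  define k where "k = (\<lambda>\<omega> x. f x * cis (- (2 * pi * (\<omega> \<bullet> x))) * g \<omega>)"
  have km: "case_prod k \<in> borel_measurable (lborel \<Otimes>\<^sub>M lborel)" unfolding k_def by measurable
  have nk: "norm (k \<omega> x) = norm (f x) * norm (g \<omega>)" for \<omega> x by (simp add: k_def norm_mult)
  have kint: "integrable (lborel \<Otimes>\<^sub>M lborel) (case_prod k)"
  proof (rule lborel_pair.Fubini_integrable[OF km])
    show "integrable lborel (\<lambda>\<omega>. LINT x|lborel. norm (case_prod k (\<omega>, x)))"
      using f g by (simp add: nk)
    have "integrable lborel (\<lambda>x. k \<omega> x)" for \<omega>
    proof (rule Bochner_Integration.integrable_bound)
      show "integrable lborel (\<lambda>x. norm (f x) * norm (g \<omega>))" using f by auto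
      show "(\<lambda>x. k \<omega> x) \<in> borel_measurable lborel" unfolding k_def by measurable
      show "AE x in lborel. norm (k \<omega> x) \<le> norm (norm (f x) * norm (g \<omega>))" by (simp add: nk)
    qed
    then show "AE \<omega> in lborel. integrable lborel (\<lambda>x. case_prod k (\<omega>, x))" by simp
  qed
  have "(LINT \<omega>|lebesgue. fourier \<phi> \<omega> * \<psi> \<omega>) = (LINT \<omega>|lebesgue. fourier \<phi> \<omega> * g \<omega>)"
    by (rule integral_cong_AE) (use assms g in \<open>auto intro!: borel_measurable_times intro: measurable_completion\<close>)
  also have "\<dots> = (LINT \<omega>|lborel. fourier \<phi> \<omega> * g \<omega>)" by (rule integral_completion) measurable
  also have "\<dots> = (LINT \<omega>|lborel. (LINT x|lborel. k \<omega> x))" by (simp add: k_def F)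
  also have "\<dots> = (LINT x|lborel. (LINT \<omega>|lborel. k \<omega> x))"
    by (rule lborel_pair.Fubini_integral[OF kint, symmetric])
  also have "\<dots> = (LINT x|lborel. f x * fourier \<psi> x)"
    unfolding k_def G
    by (subst integral_mult_right_zero[symmetric]) (simp add: ac_simps inner_commute)
  also have "\<dots> = (LINT x|lebesgue. f x * fourier \<psi> x)" by (rule integral_completion[symmetric]) measurable
  also have "\<dots> = (LINT x|lebesgue. \<phi> x * fourier \<psi> x)"
    by (rule integral_cong_AE) (use assms f in \<open>auto intro!: borel_measurable_times intro: measurable_completion\<close>)
  finally show ?thesis .
qed

lemma L2_cnj: "f \<in> L2 \<Longrightarrow> (\<lambda>x. cnj (f x)) \<in> L2"
  by (auto simp: L2_def)

lemma l2_norm_cnj: "l2_norm (\<lambda>x. cnj (f x)) = l2_norm f"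
  by (simp add: l2_norm_def)

lemma integral_mult_L2_le:
  assumes "f \<in> L2" "g \<in> L2"
  shows "norm (LINT x|lebesgue. f x * g x) \<le> l2_norm f * l2_norm g"
  using norm_l2_inner_le[OF assms(1) L2_cnj[OF assms(2)]] by (simp add: l2_inner_def l2_norm_cnj)

lemma integrable_mult_L2: "f \<in> L2 \<Longrightarrow> g \<in> L2 \<Longrightarrow> integrable lebesgue (\<lambda>x. f x * g x)"
  using L2_inner_integrable[OF _ L2_cnj, of f g] by simp

lemma tendsto_integral_mult_L2:
  assumes "\<And>n. f n \<in> L2" "F \<in> L2" "g \<in> L2" and lim: "(\<lambda>n. l2_norm (\<lambda>x. f n x - F x)) \<longlonglongrightarrow> 0"
  shows "(\<lambda>n. LINT x|lebesgue. f n x * g x) \<longlonglongrightarrow> (LINT x|lebesgue. F x * g x)"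
proof -
  have conv: "(\<lambda>n. l2_norm (\<lambda>x. f n x - F x) * l2_norm g) \<longlonglongrightarrow> 0"
    using tendsto_mult_right[OF lim] by simp
  have le: "norm ((LINT x|lebesgue. f n x * g x) - (LINT x|lebesgue. F x * g x)) \<le> l2_norm (\<lambda>x. f n x - F x) * l2_norm g" for n
  proof -
    have "(LINT x|lebesgue. f n x * g x) - (LINT x|lebesgue. F x * g x) = (LINT x|lebesgue. (f n x - F x) * g x)"
      using assms by (simp add: left_diff_distrib integrable_mult_L2)
    then show ?thesis using integral_mult_L2_le[OF L2_diff assms(3)] assms by simp
  qed
  have "(\<lambda>n. (LINT x|lebesgue. f n x * g x) - (LINT x|lebesgue. F x * g x)) \<longlonglongrightarrow> 0"
    by (rule Lim_null_comparison[OF always_eventually conv]) (rule allI, rule le)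
  then show ?thesis by (rule LIM_zero_cancel)
qed

text \<open>For the approximating integrable functions this is Fubini. Both sides pass to the
  mean-square limit because \<open>\<psi>\<close> and its Fourier integral are
  square-integrable.\<close>

lemma has_fourier_L2_multiplication_formula:
  assumes g: "has_fourier_L2 g G" and \<psi>: "integrable lebesgue \<psi>" "\<psi> \<in> L2" "fourier \<psi> \<in> L2"
  shows "(LINT \<omega>|lebesgue. G \<omega> * \<psi> \<omega>) = (LINT x|lebesgue. g x * fourier \<psi> x)"
proof -
  obtain \<phi> where \<phi>: "\<And>n::nat. integrable lebesgue (\<phi> n)" "\<And>n. \<phi> n \<in> L2" "\<And>n. fourier (\<phi> n) \<in> L2"
    "(\<lambda>n. l2_norm (\<lambda>x. \<phi> n x - g x)) \<longlonglongrightarrow> 0" "(\<lambda>n. l2_norm (\<lambda>\<omega>. fourier (\<phi> n) \<omega> - G \<omega>)) \<longlonglongrightarrow> 0"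
    and L: "g \<in> L2" "G \<in> L2"
    using g unfolding has_fourier_L2_def by blast
  have 1: "(\<lambda>n. LINT \<omega>|lebesgue. fourier (\<phi> n) \<omega> * \<psi> \<omega>) \<longlonglongrightarrow> (LINT \<omega>|lebesgue. G \<omega> * \<psi> \<omega>)"
    using \<phi> L \<psi> by (intro tendsto_integral_mult_L2)
  have 2: "(\<lambda>n. LINT x|lebesgue. \<phi> n x * fourier \<psi> x) \<longlonglongrightarrow> (LINT x|lebesgue. g x * fourier \<psi> x)"
    using \<phi> L \<psi> by (intro tendsto_integral_mult_L2)
  from LIMSEQ_unique[OF 1 2[folded fourier_multiplication_formula[OF \<phi>(1) \<psi>(1)]]]
  show ?thesis .
qed

lemma nn_integral_count_space_le:
  fixes f :: "'c::countable \<Rightarrow> ennreal"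
  assumes "\<And>F. finite F \<Longrightarrow> (\<Sum>m\<in>F. f m) \<le> C"
  shows "(\<integral>\<^sup>+m. f m \<partial>count_space UNIV) \<le> C"
  unfolding nn_integral_count_space_suminf
proof (rule suminf_le_const[OF summableI])
  fix n
  let ?S = "range (to_nat :: 'c \<Rightarrow> nat) \<inter> {..<n}"
  have inj: "inj_on (from_nat :: nat \<Rightarrow> 'c) ?S" by (auto simp: inj_on_def)
  have "(\<Sum>i<n. if i \<in> range (to_nat :: 'c \<Rightarrow> nat) then f (from_nat i) else 0) = (\<Sum>i\<in>?S. f (from_nat i))"
    by (rule sum.mono_neutral_cong_right) auto
  also have "\<dots> = (\<Sum>m\<in>from_nat ` ?S. f m)" by (rule sum.reindex_cong[OF inj, symmetric]) auto
  also have "\<dots> \<le> C" by (rule assms) simp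
  finally show "(\<Sum>i<n. if i \<in> range (to_nat :: 'c \<Rightarrow> nat) then f (from_nat i) else 0) \<le> C" .
qed

section \<open>The Fourier transform of the unit cube\<close>

definition cube_fourier :: "real^'n \<Rightarrow> complex" where
  "cube_fourier = fourier (indicator unit_cube)"

lemma integrable_indicator_unit_cube_complex:
  "integrable lebesgue (indicator (unit_cube :: (real^'n) set) :: _ \<Rightarrow> complex)"
proof -
  have "(indicator (unit_cube :: (real^'n) set) :: _ \<Rightarrow> complex) = (\<lambda>x. indicator unit_cube x *\<^sub>R 1)"
    by (simp add: fun_eq_iff indicator_def)
  then show ?thesis using integrable_bounded_unit_cube[of "\<lambda>_ :: real^'n. 1 :: complex" 1] by simp
qed

lemma cube_fourier_shift:
  "cube_fourier (x + real_vec m) = l2_inner (\<lambda>y. indicator unit_cube y * cis (- (2 * pi * (x \<bullet> y)))) (cube_exp m)"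
proof -
  have "indicator unit_cube y * cis (- (2 * pi * ((x + real_vec m) \<bullet> y))) =
      indicator unit_cube y * cis (- (2 * pi * (x \<bullet> y))) * cnj (cube_exp m y)" for y
    by (auto simp: cube_exp_def indicator_def cis_mult cis_cnj inner_add_left inner_commute algebra_simps)
  then show ?thesis by (simp only: cube_fourier_def fourier_def l2_inner_def)
qed

lemma borel_measurable_cube_fourier: "cube_fourier \<in> borel_measurable lebesgue"
  unfolding cube_fourier_def
  by (intro measurable_completion) (simp add: borel_measurable_fourier integrable_indicator_unit_cube_complex)

text \<open>The values at the points \<open>x + real_vec m\<close> are the inner products of a
  single function, of modulus 1 on the cube, with the orthonormal exponentials. Bessel bounds the
  sum of their squares by 1, and tiling integrates this bound over the cube.\<close>

lemma cube_fourier_L2: "cube_fourier \<in> L2"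
proof -
  have le: "(\<integral>\<^sup>+m. ennreal ((norm (cube_fourier (x + real_vec m)))\<^sup>2) \<partial>count_space UNIV) \<le> 1" for x :: "real^'n"
  proof (rule nn_integral_count_space_le)
    fix F :: "(int^'n) set" assume F: "finite F"
    let ?f = "\<lambda>y. indicator unit_cube y * cis (- (2 * pi * (x \<bullet> y)))"
    have fL: "?f \<in> L2"
      by (rule L2_bounded_unit_cube[of _ 1]) (simp_all, measurable)
    have "(\<Sum>m\<in>F. (norm (cube_fourier (x + real_vec m)))\<^sup>2) \<le> (l2_norm ?f)\<^sup>2"
      unfolding cube_fourier_shift by (rule bessel_inequality) (auto simp: F fL cube_exp_L2 cube_exp_orthonormal)
    also have "(l2_norm ?f)\<^sup>2 = (l2_norm (cube_exp (0 :: int^'n)))\<^sup>2"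
      by (simp add: l2_norm_sq cube_exp_def norm_mult)
    also have "\<dots> = 1" using l2_inner_self[of "cube_exp (0 :: int^'n)"]
      unfolding cube_exp_orthonormal by (metis of_real_eq_1_iff)
    finally show "(\<Sum>m\<in>F. ennreal ((norm (cube_fourier (x + real_vec m)))\<^sup>2)) \<le> 1" by simp
  qed
  have m: "(\<lambda>x. ennreal ((norm (cube_fourier (x :: real^'n)))\<^sup>2)) \<in> borel_measurable lebesgue"
    using borel_measurable_cube_fourier by measurable
  have "(\<integral>\<^sup>+x. ennreal ((norm (cube_fourier (x :: real^'n)))\<^sup>2) \<partial>lebesgue) \<le>
      (\<integral>\<^sup>+x. indicator (unit_cube :: (real^'n) set) x * 1 \<partial>lebesgue)"
    unfolding nn_integral_tile[OF m] by (intro nn_integral_mono mult_left_mono le) simp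
  also have "(\<integral>\<^sup>+x. indicator (unit_cube :: (real^'n) set) x * 1 \<partial>lebesgue) = 1"
    using emeasure_unit_cube[where 'n = 'n] by (simp del: emeasure_completion)
  finally have "(\<integral>\<^sup>+x. ennreal ((norm (cube_fourier (x :: real^'n)))\<^sup>2) \<partial>lebesgue) < \<infinity>"
    by (rule order_le_less_trans) simp
  then show ?thesis
    using borel_measurable_cube_fourier by (auto simp: L2_def intro!: integrableI_bounded)
qed

lemma cnj_indicator [simp]: "cnj (indicator A x) = indicator A x"
  by (simp add: indicator_def)

lemma cube_fourier_uminus: "cube_fourier (- x) = cnj (cube_fourier x)"
  unfolding cube_fourier_def fourier_def
  by (subst Bochner_Integration.integral_cnj[symmetric]) (simp add: cis_cnj cnj_indicator)

lemma integral_unit_cube_complex: "(LINT x|lebesgue. indicator (unit_cube :: (real^'n) set) x) = (1 :: complex)"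
proof -
  have "cube_exp 0 x * cnj (cube_exp 0 x) = (indicator unit_cube x :: complex)" for x :: "real^'n"
    by (simp add: cube_exp_def indicator_def)
  then show ?thesis using cube_exp_orthonormal[of "0 :: int^'n" 0] by (simp add: l2_inner_def)
qed

text \<open>At 0 the value is the volume 1. Since \<open>cis\<close> is 1-Lipschitz, the value at
  \<open>x\<close> differs from 1 by at most \<open>2 * pi * (norm x * d)\<close>, where the number
  \<open>d\<close> of coordinates bounds the norm on the cube.\<close>

lemma cube_fourier_nonzero: "\<exists>\<epsilon>>0. \<forall>x :: real^'n. norm x < \<epsilon> \<longrightarrow> cube_fourier x \<noteq> 0"
proof -
  define d where "d = real CARD('n)"
  have d: "0 < d" by (simp add: d_def)
  have cb: "norm y \<le> d" if "y \<in> unit_cube" for y :: "real^'n"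
  proof -
    have "norm y \<le> (\<Sum>i\<in>UNIV. \<bar>y $ i\<bar>)" by (rule norm_le_l1_cart)
    also have "\<dots> \<le> (\<Sum>i\<in>(UNIV :: 'n set). 1)"
      using that by (intro sum_mono) (auto simp: unit_cube_def less_imp_le)
    finally show ?thesis by (simp add: d_def)
  qed
  have "cube_fourier x \<noteq> 0" if x: "norm x < 1 / (2 * pi * d)" for x :: "real^'n"
  proof
    assume 0: "cube_fourier x = 0"
    let ?f = "\<lambda>y. indicator unit_cube y * cis (- (2 * pi * (x \<bullet> y))) :: complex"
    have fi: "integrable lebesgue ?f" using integrable_fourier[OF integrable_indicator_unit_cube_complex, of x] .
    let ?c = "2 * pi * (norm x * d)"
    have "1 = norm (integral\<^sup>L lebesgue (indicator (unit_cube :: (real^'n) set) :: _ \<Rightarrow> complex) - integral\<^sup>L lebesgue ?f)"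
      using 0 integral_unit_cube_complex[where 'n = 'n] by (simp add: cube_fourier_def fourier_def)
    also have "\<dots> = norm (LINT y|lebesgue. indicator unit_cube y - ?f y)"
      by (subst Bochner_Integration.integral_diff[OF integrable_indicator_unit_cube_complex fi]) (rule refl)
    also have "\<dots> \<le> (LINT y|lebesgue. ?c * indicator (unit_cube :: (real^'n) set) y)"
    proof (rule Bochner_Integration.integral_norm_bound_integral)
      show "integrable lebesgue (\<lambda>y. indicator unit_cube y - ?f y)"
        by (rule Bochner_Integration.integrable_diff[OF integrable_indicator_unit_cube_complex fi])
      show "integrable lebesgue (\<lambda>y. ?c * indicator (unit_cube :: (real^'n) set) y)"
        using integrable_indicator_unit_cube by (rule integrable_mult_right)
      show "norm (indicator unit_cube y - ?f y) \<le> ?c * indicator unit_cube y" for y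
      proof (cases "y \<in> unit_cube")
        case True
        have "norm (1 - cis (- (2 * pi * (x \<bullet> y)))) = norm (cis (- (2 * pi * (x \<bullet> y))) - cis 0)"
          by (simp add: norm_minus_commute)
        also have "\<dots> \<le> \<bar>2 * pi * (x \<bullet> y)\<bar>"
          using dist_exp_i_1[of "- (2 * pi * (x \<bullet> y))"] abs_sin_x_le_abs_x[of "- (2 * pi * (x \<bullet> y)) / 2"]
          by (simp add: cis_conv_exp)
        also have "\<dots> \<le> ?c"
        proof -
          have "\<bar>x \<bullet> y\<bar> \<le> norm x * norm y" by (rule Cauchy_Schwarz_ineq2)
          also have "\<dots> \<le> norm x * d" using cb[OF True] by (intro mult_left_mono) auto
          finally show ?thesis by (simp add: abs_mult)
        qed
        finally show ?thesis using True by simp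
      qed simp
    qed
    also have "\<dots> = ?c"
    proof -
      have "complex_of_real (LINT y|lebesgue. indicator (unit_cube :: (real^'n) set) y) = 1"
        unfolding integral_unit_cube_complex[where 'n = 'n, symmetric] integral_complex_of_real[symmetric]
        by (rule Bochner_Integration.integral_cong) (simp_all add: indicator_def)
      then show ?thesis by simp
    qed
    finally have "1 \<le> ?c" .
    moreover have "?c < 1" using x d by (simp add: field_simps)
    ultimately show False by simp
  qed
  then show ?thesis using d by (intro exI[of _ "1 / (2 * pi * d)"]) auto
qed

text \<open>The difference \<open>k x = g x - cnj (g (- x))\<close> is only square-integrable, so
  uniqueness is applied to the integrable product of \<open>k\<close> with a translate of
  \<open>cube_fourier\<close>. Up to a factor of modulus 1, the Fourier integral of this product at
  \<open>t\<close> is the integral of \<open>k\<close> against the transform of the test function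
  \<open>\<psi> t y\<close>, and that is 0 by the multiplication formula and the reality of
  \<open>G\<close>.\<close>

theorem has_fourier_L2_real_imp_symmetric:
  fixes g :: "real^'n \<Rightarrow> complex"
  assumes g: "has_fourier_L2 g G" and re: "AE \<omega> in lebesgue. G \<omega> = cnj (G \<omega>)"
  shows "AE x in lebesgue. g (- x) = cnj (g x)"
proof -
  have L: "g \<in> L2" "G \<in> L2" using g by (auto simp: has_fourier_L2_def)
  then have gm: "g \<in> borel_measurable lebesgue" and Gm: "G \<in> borel_measurable lebesgue" by (auto simp: L2_def)
  have m1: "rrefl (1 :: int^'n) x = - x" for x by (simp add: rrefl_def vec_eq_iff)
  \<comment> \<open>The cube moved to \<open>t\<close> and modulated by \<open>y\<close>. Its
    transform is the translate of \<open>cube_fourier\<close> by \<open>y\<close> times a character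
    of frequency \<open>t\<close>; varying \<open>t\<close> for fixed \<open>y\<close> thus gives
    all Fourier integrals of one product.\<close>
  define \<psi> where "\<psi> = (\<lambda>t y \<omega> :: real^'n. indicator unit_cube (\<omega> + - t) * cis (2 * pi * (y \<bullet> \<omega>)))"
  have \<psi>f: "fourier (\<psi> t y) x = cis (- (2 * pi * (t \<bullet> (x - y)))) * cube_fourier (x - y)" for t y x
  proof -
    let ?h = "\<lambda>\<omega>. \<psi> t y \<omega> * cis (- (2 * pi * (x \<bullet> \<omega>)))"
    have hm: "?h \<in> borel_measurable lebesgue"
      unfolding \<psi>_def using borel_measurable_translate[OF borel_measurable_indicator[OF unit_cube_lebesgue], of "- t"]
      by (intro borel_measurable_times) auto
    have "fourier (\<psi> t y) x = (LINT \<omega>|lebesgue. ?h (\<omega> + t))"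
      unfolding fourier_def by (rule integral_translate[OF hm, symmetric])
    also have "(\<lambda>\<omega>. ?h (\<omega> + t)) = (\<lambda>\<omega>. cis (- (2 * pi * (t \<bullet> (x - y)))) *
        (indicator unit_cube \<omega> * cis (- (2 * pi * ((x - y) \<bullet> \<omega>)))))"
    proof
      fix \<omega>
      have "?h (\<omega> + t) = indicator unit_cube \<omega> * (cis (2 * pi * (y \<bullet> (\<omega> + t))) * cis (- (2 * pi * (x \<bullet> (\<omega> + t)))))"
        by (simp add: \<psi>_def)
      also have "cis (2 * pi * (y \<bullet> (\<omega> + t))) * cis (- (2 * pi * (x \<bullet> (\<omega> + t)))) =
          cis (- (2 * pi * (t \<bullet> (x - y)))) * cis (- (2 * pi * ((x - y) \<bullet> \<omega>)))"
        unfolding cis_mult by (simp add: inner_diff_left inner_diff_right inner_add_right inner_commute algebra_simps)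
      finally show "?h (\<omega> + t) = cis (- (2 * pi * (t \<bullet> (x - y)))) *
          (indicator unit_cube \<omega> * cis (- (2 * pi * ((x - y) \<bullet> \<omega>))))"
        by (simp only: ac_simps)
    qed
    finally show ?thesis by (simp add: cube_fourier_def fourier_def)
  qed
  have \<psi>L: "\<psi> t y \<in> L2" "integrable lebesgue (\<psi> t y)" for t y
  proof -
    let ?h = "\<lambda>\<omega>. indicator unit_cube \<omega> * cis (2 * pi * (y \<bullet> (\<omega> + t))) :: complex"
    have hm: "(\<lambda>\<omega>. cis (2 * pi * (y \<bullet> (\<omega> + t)))) \<in> borel_measurable lebesgue"
      unfolding inner_add_right by measurable
    have "?h \<in> L2" by (rule L2_bounded_unit_cube[OF hm, of 1]) simp
    from L2_translate[OF this, of "- t"] show "\<psi> t y \<in> L2" by (simp add: \<psi>_def)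
    have "integrable lebesgue ?h"
    proof -
      have "?h = (\<lambda>\<omega>. indicator unit_cube \<omega> *\<^sub>R cis (2 * pi * (y \<bullet> (\<omega> + t))))"
        by (simp add: fun_eq_iff indicator_def)
      then show ?thesis using integrable_bounded_unit_cube[OF hm, of 1] by simp
    qed
    then have "integrable (distr lebesgue lebesgue (\<lambda>x. x + - t)) ?h" by (simp only: distr_translate_lebesgue)
    from integrable_distr[OF measurable_translate_lebesgue this] show "integrable lebesgue (\<psi> t y)"
      by (simp add: \<psi>_def)
  qed
  have \<psi>FL: "fourier (\<psi> t y) \<in> L2" for t y
  proof -
    have c: "(\<lambda>x. cube_fourier (x + - y)) \<in> L2" by (rule L2_translate[OF cube_fourier_L2])
    have "(\<lambda>x. cis (- (2 * pi * (t \<bullet> (x - y)))) * cube_fourier (x + - y)) \<in> borel_measurable lebesgue"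
      using c unfolding inner_diff_right by (intro borel_measurable_times) (measurable, simp add: L2_def)
    then show ?thesis using c unfolding \<psi>f[abs_def] by (simp add: L2_def norm_mult)
  qed
  note mf = has_fourier_L2_multiplication_formula[OF g \<psi>L(2) \<psi>L(1) \<psi>FL]
  have eq: "(LINT x|lebesgue. g x * fourier (\<psi> t y) x) = (LINT x|lebesgue. cnj (g (- x)) * fourier (\<psi> t y) x)" for t y
  proof -
    \<comment> \<open>Replacing \<open>y\<close> by \<open>- y\<close> makes conjugation map the
      family of test functions to itself; on their transforms the same operation reflects the
      argument.\<close>
    have cp: "cnj (\<psi> t (- y) \<omega>) = \<psi> t y \<omega>" for \<omega> by (simp add: \<psi>_def cis_cnj indicator_def)
    have cf: "cnj (fourier (\<psi> t (- y)) x) = fourier (\<psi> t y) (- x)" for x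
    proof -
      have "cube_fourier (- x - y) = cnj (cube_fourier (x + y))" using cube_fourier_uminus[of "x + y"] by simp
      then show ?thesis unfolding \<psi>f by (simp add: cis_cnj inner_diff_right inner_add_right inner_minus_right algebra_simps)
    qed
    have pm: "\<psi> t y \<in> borel_measurable lebesgue" "fourier (\<psi> t (- y)) \<in> borel_measurable lebesgue"
      using \<psi>L \<psi>FL by (auto simp: L2_def)
    have "(LINT x|lebesgue. g x * fourier (\<psi> t y) x) = (LINT \<omega>|lebesgue. G \<omega> * \<psi> t y \<omega>)" by (rule mf[symmetric])
    also have "\<dots> = (LINT \<omega>|lebesgue. cnj (G \<omega>) * \<psi> t y \<omega>)"
      by (rule integral_cong_AE) (use re Gm pm in \<open>auto intro!: borel_measurable_times borel_measurable_cnj\<close>)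
    also have "\<dots> = cnj (LINT \<omega>|lebesgue. G \<omega> * \<psi> t (- y) \<omega>)"
      by (subst Bochner_Integration.integral_cnj[symmetric]) (simp add: cp)
    also have "\<dots> = cnj (LINT x|lebesgue. g x * fourier (\<psi> t (- y)) x)" by (simp only: mf)
    also have "\<dots> = (LINT x|lebesgue. cnj (g x) * fourier (\<psi> t y) (- x))"
      by (subst Bochner_Integration.integral_cnj[symmetric]) (simp add: cf)
    also have "\<dots> = (LINT x|lebesgue. (\<lambda>x. cnj (g x) * fourier (\<psi> t y) (- x)) (0 + rrefl (1 :: int^'n) x))"
      by (rule integral_rrefl[symmetric])
        (unfold cf[symmetric], use gm pm in \<open>auto intro!: borel_measurable_times borel_measurable_cnj\<close>)
    finally show ?thesis by (simp add: m1)
  qed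
  have gr: "(\<lambda>x. cnj (g (- x))) \<in> L2" using L2_rrefl[OF L(1), of 0 1] by (simp add: m1 L2_cnj)
  define k where "k = (\<lambda>x. g x - cnj (g (- x)))"
  have kL: "k \<in> L2" unfolding k_def by (rule L2_diff[OF L(1) gr])
  have near: "AE x in lebesgue. k x * cube_fourier (x - y) = 0" for y
  proof (rule fourier_null_AE_zero)
    have cL: "(\<lambda>x. cube_fourier (x - y)) \<in> L2" using L2_translate[OF cube_fourier_L2, of "- y"] by simp
    have "fourier (\<lambda>x. k x * cube_fourier (x - y)) t = 0" for t
    proof -
      have "k x * cube_fourier (x - y) * cis (- (2 * pi * (t \<bullet> x))) = cis (- (2 * pi * (t \<bullet> y))) * (k x * fourier (\<psi> t y) x)" for x
      proof -
        have "cis (- (2 * pi * (t \<bullet> x))) = cis (- (2 * pi * (t \<bullet> y))) * cis (- (2 * pi * (t \<bullet> (x - y))))"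
          unfolding cis_mult by (simp add: inner_diff_right algebra_simps)
        then show ?thesis by (simp add: \<psi>f)
      qed
      then have "fourier (\<lambda>x. k x * cube_fourier (x - y)) t =
          (LINT x|lebesgue. cis (- (2 * pi * (t \<bullet> y))) * (k x * fourier (\<psi> t y) x))"
        by (simp only: fourier_def[of "\<lambda>x. k x * cube_fourier (x - y)"])
      also have "\<dots> = cis (- (2 * pi * (t \<bullet> y))) * (LINT x|lebesgue. k x * fourier (\<psi> t y) x)"
        by (rule integral_mult_right_zero)
      also have "(LINT x|lebesgue. k x * fourier (\<psi> t y) x) = 0"
        unfolding k_def left_diff_distrib
        using eq[of t y] integrable_mult_L2[OF L(1) \<psi>FL] integrable_mult_L2[OF gr \<psi>FL] by simp
      finally show ?thesis by simp
    qed
    then show "fourier_null (\<lambda>x. k x * cube_fourier (x - y))"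
      using integrable_mult_L2[OF kL cL] by (simp add: fourier_null_def)
  qed
  obtain \<epsilon> where \<epsilon>: "0 < \<epsilon>" "\<And>x :: real^'n. norm x < \<epsilon> \<Longrightarrow> cube_fourier x \<noteq> 0"
    using cube_fourier_nonzero by blast
  \<comment> \<open>\<open>cube_fourier\<close> is known to be nonzero only near 0. Dense centres
    \<open>y\<close> bring some \<open>x - y\<close> into that ball for every \<open>x\<close>, and
    countability keeps the union of the exceptional sets null.\<close>
  obtain D :: "(real^'n) set" where D: "countable D" "\<And>X. open X \<Longrightarrow> X \<noteq> {} \<Longrightarrow> \<exists>d\<in>D. d \<in> X"
    using countable_dense_setE by blast
  have "AE x in lebesgue. \<forall>y\<in>D. k x * cube_fourier (x - y) = 0"
    using near by (subst AE_ball_countable[OF D(1)]) blast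
  then show ?thesis
  proof eventually_elim
    case (elim x)
    obtain y where y: "y \<in> D" "y \<in> ball x \<epsilon>" using D(2)[of "ball x \<epsilon>"] \<epsilon>(1) by auto
    then have "cube_fourier (x - y) \<noteq> 0" by (intro \<epsilon>(2)) (simp add: dist_norm)
    then have "k x = 0" using elim y(1) by auto
    then have "g x = cnj (g (- x))" by (simp add: k_def)
    then show ?case by simp
  qed
qed

subsection \<open>Separable groups\<close>

definition parity_add :: "int^'n \<Rightarrow> int^'n \<Rightarrow> int^'n" where
  "parity_add \<sigma> \<tau> = (\<chi> i. (\<sigma> $ i + \<tau> $ i) mod 2)"

lemma parity_add_nth [simp]: "parity_add \<sigma> \<tau> $ i = (\<sigma> $ i + \<tau> $ i) mod 2"
  by (simp add: parity_add_def)

lemma carrier_parity_group: "\<sigma> \<in> carrier parity_group \<longleftrightarrow> (\<forall>i. \<sigma> $ i = 0 \<or> \<sigma> $ i = 1)"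
  by (simp add: parity_group_def)

lemma mult_parity_group: "\<sigma> \<otimes>\<^bsub>parity_group\<^esub> \<tau> = parity_add \<sigma> \<tau>"
  by (simp add: parity_group_def parity_add_def)

lemma one_parity_group: "\<one>\<^bsub>parity_group\<^esub> = 0"
  by (simp add: parity_group_def)

lemma inv_parity_group:
  assumes "\<sigma> \<in> carrier parity_group"
  shows "inv\<^bsub>parity_group\<^esub> \<sigma> = \<sigma>"
proof -
  have self: "parity_add \<sigma> \<sigma> = 0" by (simp add: vec_eq_iff)
  have "y = \<sigma>" if "y \<in> carrier parity_group" "parity_add \<sigma> y = 0" for y
    unfolding vec_eq_iff
  proof
    fix i
    have "(\<sigma> $ i + y $ i) mod 2 = 0" using that(2) by (metis parity_add_nth zero_index)
    then show "y $ i = \<sigma> $ i" using assms that(1)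
      unfolding carrier_parity_group by (auto dest!: spec[of _ i])
  qed
  then show ?thesis
    unfolding m_inv_def mult_parity_group one_parity_group using assms self by (intro the_equality) auto
qed

lemma finite_carrier_parity_group: "finite (carrier (parity_group :: (int^'n) monoid))"
proof -
  have "carrier (parity_group :: (int^'n) monoid) \<subseteq> (\<lambda>S. \<chi> i. if i \<in> S then 1 else 0) ` UNIV"
  proof
    fix \<sigma> :: "int^'n" assume "\<sigma> \<in> carrier parity_group"
    then have "\<sigma> = (\<chi> i. if i \<in> {i. \<sigma> $ i = 1} then 1 else 0)"
      by (auto simp: carrier_parity_group vec_eq_iff)
    then show "\<sigma> \<in> (\<lambda>S. \<chi> i. if i \<in> S then 1 else 0) ` UNIV" by blast
  qed
  then show ?thesis by (rule finite_subset) simp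
qed

lemma minus_one_powi: "(-1 :: complex) powi n = (if even n then 1 else -1)"
  by (cases "even n") (auto simp: power_int_minus_left)

lemma int_inner_add_left: "int_inner (a + b) c = int_inner a c + int_inner b c"
  by (simp add: int_inner_def distrib_right sum.distrib)

lemma int_inner_commute: "int_inner a b = int_inner b a"
  by (simp add: int_inner_def mult.commute)

lemma even_int_inner_parity_add:
  "even (int_inner a (parity_add \<sigma> \<tau>)) \<longleftrightarrow> even (int_inner a \<sigma> + int_inner a \<tau>)"
proof -
  have "int_inner a (parity_add \<sigma> \<tau>) mod 2 = (int_inner a \<sigma> + int_inner a \<tau>) mod 2"
    unfolding int_inner_def sum.distrib[symmetric] distrib_left[symmetric]
    by (subst (1 2) mod_sum_eq[symmetric]) (simp add: mod_mult_right_eq)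
  then show ?thesis by presburger
qed

locale separable_group =
  fixes G :: "(int^'n) set" and k :: nat and s :: "nat \<Rightarrow> int^'n"
  assumes gens: "separable_generators G k s"
begin

lemma G_carrier: "\<sigma> \<in> G \<Longrightarrow> \<sigma> $ i = 0 \<or> \<sigma> $ i = 1"
proof -
  assume "\<sigma> \<in> G"
  then have "\<sigma> \<in> carrier parity_group"
    using gens subgroup.subset unfolding separable_generators_def by blast
  then show "\<sigma> $ i = 0 \<or> \<sigma> $ i = 1" by (simp add: carrier_parity_group)
qed

lemma finite_G: "finite G"
  using gens finite_subset[OF subgroup.subset finite_carrier_parity_group] by (auto simp: separable_generators_def)

lemma zero_mem_G: "0 \<in> G"
  using gens subgroup.one_closed[of G parity_group] by (simp add: separable_generators_def one_parity_group)

lemma parity_add_mem_G: "\<sigma> \<in> G \<Longrightarrow> \<tau> \<in> G \<Longrightarrow> parity_add \<sigma> \<tau> \<in> G"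
  using gens subgroup.m_closed[of G parity_group] by (simp add: separable_generators_def mult_parity_group)

lemma gen_mem_G: "i \<in> {1..k} \<Longrightarrow> s i \<in> G"
  using gens generate.incl[of "s i" "s ` {1..k}" parity_group] by (auto simp: separable_generators_def)

text \<open>Every element is its own inverse, so the inverse rule of \<open>generate\<close> yields
  nothing beyond the generators.\<close>

lemma G_induct [consumes 1, case_names zero gen add]:
  assumes "\<sigma> \<in> G" and "P 0" and "\<And>i. i \<in> {1..k} \<Longrightarrow> P (s i)"
    and "\<And>\<sigma> \<tau>. \<sigma> \<in> G \<Longrightarrow> \<tau> \<in> G \<Longrightarrow> P \<sigma> \<Longrightarrow> P \<tau> \<Longrightarrow> P (parity_add \<sigma> \<tau>)"
  shows "P \<sigma>"
proof -
  have gG: "generate parity_group (s ` {1..k}) = G" using gens by (simp add: separable_generators_def)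
  have "\<sigma> \<in> generate parity_group (s ` {1..k})" using assms(1) gG by simp
  then show ?thesis
  proof (induction rule: generate.induct)
    case one
    then show ?case using assms(2) by (simp add: one_parity_group)
  next
    case (incl h)
    then show ?case using assms(3) by auto
  next
    case (inv h)
    then have "h \<in> carrier parity_group" using gens by (auto simp: separable_generators_def)
    then show ?case using inv assms(3) by (auto simp: inv_parity_group)
  next
    case (eng h1 h2)
    then show ?case using assms(4)[of h1 h2] gG by (simp add: mult_parity_group)
  qed
qed

lemma supp_parity_add: "\<sigma> \<in> G \<Longrightarrow> \<tau> \<in> G \<Longrightarrow> i \<in> supp (parity_add \<sigma> \<tau>) \<longleftrightarrow> (i \<in> supp \<sigma>) \<noteq> (i \<in> supp \<tau>)"
  by (auto simp: supp_def)

text \<open>Addition modulo 2 is symmetric difference of supports, and the generators have disjoint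
  supports. An element of \<open>G\<close> thus contains each block \<open>supp (s j)\<close>
  entirely or avoids it; all later reasoning about \<open>G\<close> goes by blocks.\<close>

lemma supp_gen_cases:
  assumes "\<sigma> \<in> G" "j \<in> {1..k}"
  shows "supp (s j) \<subseteq> supp \<sigma> \<or> supp (s j) \<inter> supp \<sigma> = {}"
  using assms(1)
proof (induction rule: G_induct)
  case zero
  then show ?case by (simp add: supp_def)
next
  case (gen i)
  show ?case
  proof (cases "i = j")
    case False
    then show ?thesis using gens gen assms(2)
      unfolding separable_generators_def disjoint_family_on_def by auto
  qed simp
next
  case (add \<sigma> \<tau>)
  then show ?case using supp_parity_add by blast
qed

lemma supp_subset_Union: "\<sigma> \<in> G \<Longrightarrow> supp \<sigma> \<subseteq> (\<Union>j\<in>{1..k}. supp (s j))"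
proof (induction rule: G_induct)
  case zero
  then show ?case by (simp add: supp_def)
next
  case (add \<sigma> \<tau>)
  then show ?case using supp_parity_add by blast
qed auto

lemma gen_supp_nonempty: "j \<in> {1..k} \<Longrightarrow> supp (s j) \<noteq> {}"
  using gens by (auto simp: separable_generators_def)

lemma G_eqI:
  assumes "\<sigma> \<in> G" "\<tau> \<in> G" and "supp \<sigma> = supp \<tau>"
  shows "\<sigma> = \<tau>"
  unfolding vec_eq_iff
proof
  fix i
  have "odd (\<sigma> $ i) \<longleftrightarrow> odd (\<tau> $ i)" using assms(3) by (auto simp: supp_def)
  then show "\<sigma> $ i = \<tau> $ i" using G_carrier[OF assms(1), of i] G_carrier[OF assms(2), of i] by auto
qed

lemma distinguishing_generator:
  assumes "\<sigma> \<in> G" "\<tau> \<in> G" "\<sigma> \<noteq> \<tau>"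
  obtains j where "j \<in> {1..k}" "supp (s j) \<subseteq> supp \<sigma> \<longleftrightarrow> \<not> supp (s j) \<subseteq> supp \<tau>"
proof -
  obtain i where i: "(i \<in> supp \<sigma>) \<noteq> (i \<in> supp \<tau>)" using G_eqI[OF assms(1,2)] assms(3) by blast
  then obtain j where j: "j \<in> {1..k}" "i \<in> supp (s j)"
    using supp_subset_Union[OF assms(1)] supp_subset_Union[OF assms(2)] by blast
  show thesis
    by (rule that[OF j(1)]) (use i j supp_gen_cases[OF assms(1) j(1)] supp_gen_cases[OF assms(2) j(1)] in blast)
qed

lemma even_twice_dual:
  assumes "t \<in> twice_dual G" "\<sigma> \<in> G"
  shows "even (int_inner t \<sigma>)"
proof -
  obtain \<beta> where \<beta>: "\<beta> \<in> dual_lattice (lattice_of G)" "real_vec t = 2 *\<^sub>R \<beta>"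
    using assms(1) by (auto simp: twice_dual_def)
  have "\<sigma> + 2 *s 0 \<in> lattice_of G" using assms(2) unfolding lattice_of_def by blast
  then have "\<beta> \<bullet> real_vec \<sigma> \<in> \<int>" using \<beta>(1) by (auto simp: dual_lattice_def)
  then obtain z where "\<beta> \<bullet> real_vec \<sigma> = of_int z" by (auto elim: Ints_cases)
  then have "real_of_int (int_inner t \<sigma>) = of_int (2 * z)"
    unfolding inner_real_vec_Ints[symmetric] \<beta>(2) by simp
  then show ?thesis by (simp only: of_int_eq_iff) simp
qed

lemma zero_mem_twice_dual: "0 \<in> twice_dual G"
  unfolding twice_dual_def dual_lattice_def by (auto intro!: exI[of _ 0])

text \<open>\<open>I\<close> respects addition only modulo \<open>twice_dual G\<close>, whose
  elements pair evenly with \<open>G\<close>. So the parity of the pairing with \<open>s j\<close>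
  is additive in \<open>h\<close>, just as the property of \<open>h\<close> to contain block
  \<open>j\<close> is additive modulo 2, and the two agree on the generators.\<close>

lemma even_int_inner_dual_iso_rep:
  assumes I: "dual_iso_rep G k s I" and h: "h \<in> G" and j: "j \<in> {1..k}"
  shows "even (int_inner (I h) (s j)) \<longleftrightarrow> \<not> supp (s j) \<subseteq> supp h"
proof -
  let ?T = "twice_dual G"
  have coset: "?T #>\<^bsub>int_vec_group\<^esub> a = {t + a | t. t \<in> ?T}" for a
    by (auto simp: r_coset_def int_vec_group_def)
  have hom: "(\<lambda>h. ?T #>\<^bsub>int_vec_group\<^esub> I h) \<in> hom (parity_group\<lparr>carrier := G\<rparr>) (dual_group G)"
    and gen: "\<And>i j. i \<in> {1..k} \<Longrightarrow> j \<in> {1..k} \<Longrightarrow> int_inner (I (s i)) (s j) mod 2 = (if i = j then 1 else 0)"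
    using I by (auto simp: dual_iso_rep_def iso_def)
  have add: "even (int_inner (I (parity_add h h')) (s j)) \<longleftrightarrow> even (int_inner (I h) (s j) + int_inner (I h') (s j))"
    if "h \<in> G" "h' \<in> G" for h h'
  proof -
    have "?T #>\<^bsub>int_vec_group\<^esub> I (parity_add h h') =
        (?T #>\<^bsub>int_vec_group\<^esub> I h) <#>\<^bsub>int_vec_group\<^esub> (?T #>\<^bsub>int_vec_group\<^esub> I h')"
      using hom_mult[OF hom, of h h'] that by (simp add: dual_group_def FactGroup_def mult_parity_group)
    moreover have "I (parity_add h h') \<in> ?T #>\<^bsub>int_vec_group\<^esub> I (parity_add h h')"
      unfolding coset using zero_mem_twice_dual by force
    ultimately obtain t t' where t: "t \<in> ?T" "t' \<in> ?T" "I (parity_add h h') = (t + I h) + (t' + I h')"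
      unfolding coset by (auto simp: set_mult_def int_vec_group_def)
    then show ?thesis
      using even_twice_dual[OF t(1) gen_mem_G[OF j]] even_twice_dual[OF t(2) gen_mem_G[OF j]]
      by (simp add: int_inner_add_left)
  qed
  show ?thesis using h
  proof (induction rule: G_induct)
    case zero
    \<comment> \<open>The representative \<open>I 0\<close> may be any element of its class; its
      pairing is even because additivity at 0 makes it congruent to twice itself.\<close>
    have "parity_add 0 0 = (0 :: int^'n)" by (simp add: vec_eq_iff)
    then have "even (int_inner (I 0) (s j))" using add[OF zero_mem_G zero_mem_G] by simp
    then show ?case using gen_supp_nonempty[OF j] by (auto simp: supp_def)
  next
    case (gen i)
    have "supp (s j) \<subseteq> supp (s i) \<longleftrightarrow> i = j"
      using gens gen j gen_supp_nonempty[OF j]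
      unfolding separable_generators_def disjoint_family_on_def by blast
    moreover have "even (int_inner (I (s i)) (s j)) \<longleftrightarrow> i \<noteq> j"
      using \<open>\<And>i j. i \<in> {1..k} \<Longrightarrow> j \<in> {1..k} \<Longrightarrow> int_inner (I (s i)) (s j) mod 2 = (if i = j then 1 else 0)\<close>[OF gen j]
      by (auto split: if_splits)
    ultimately show ?case by blast
  next
    case (add h h')
    have "supp (s j) \<subseteq> supp (parity_add h h') \<longleftrightarrow> (supp (s j) \<subseteq> supp h) \<noteq> (supp (s j) \<subseteq> supp h')"
      using supp_gen_cases[OF add.hyps(1) j] supp_gen_cases[OF add.hyps(2) j] gen_supp_nonempty[OF j]
        supp_parity_add[OF add.hyps(1,2)] by blast
    then show ?case using \<open>\<And>h h'. h \<in> G \<Longrightarrow> h' \<in> G \<Longrightarrow> _\<close>[OF add.hyps(1,2)] add.IH by simp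
  qed
qed

subsection \<open>Partial reflections of a separable function\<close>

text \<open>Each block of a generator lies within \<open>supp \<sigma>\<close> or is disjoint from
  it, and block 0 is always disjoint from it. Collecting the factors of \<open>g\<close> accordingly
  gives \<open>\<alpha>\<close> and \<open>\<beta>\<close>, which are arbitrary functions without
  any measurability.\<close>

lemma separable_fun_factor:
  assumes g: "separable_fun k s g" and \<sigma>: "\<sigma> \<in> G"
  obtains \<alpha> \<beta> :: "real^'n \<Rightarrow> complex" where "\<And>x. g x = \<alpha> x * \<beta> x"
    "\<And>x y. (\<And>i. i \<in> supp \<sigma> \<Longrightarrow> x $ i = y $ i) \<Longrightarrow> \<alpha> x = \<alpha> y"
    "\<And>x y. (\<And>i. i \<notin> supp \<sigma> \<Longrightarrow> x $ i = y $ i) \<Longrightarrow> \<beta> x = \<beta> y"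
proof -
  obtain \<phi> where \<phi>: "\<And>x. g x = (\<Prod>i=0..k. \<phi> i (coord_proj (coord_block k s i) x))"
    using g by (auto simp: separable_fun_def)
  define K where "K = {i \<in> {1..k}. supp (s i) \<subseteq> supp \<sigma>}"
  let ?f = "\<lambda>x i. \<phi> i (coord_proj (coord_block k s i) x)"
  have cp: "coord_proj S x = coord_proj S y" if "\<And>i. i \<in> S \<Longrightarrow> x $ i = y $ i" for S and x y :: "real^'n"
    using that by (auto simp: coord_proj_def restrict_def)
  show thesis
  proof (rule that[of "\<lambda>x. \<Prod>i\<in>K. ?f x i" "\<lambda>x. \<Prod>i\<in>{0..k}-K. ?f x i"])
    have "K \<subseteq> {0..k}" by (auto simp: K_def)
    then show "g x = (\<Prod>i\<in>K. ?f x i) * (\<Prod>i\<in>{0..k}-K. ?f x i)" for x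
      unfolding \<phi> by (subst mult.commute, intro prod.subset_diff) auto
    show "(\<Prod>i\<in>K. ?f x i) = (\<Prod>i\<in>K. ?f y i)" if "\<And>i. i \<in> supp \<sigma> \<Longrightarrow> x $ i = y $ i" for x y
    proof (intro prod.cong refl arg_cong[of _ _ "\<phi> _"] cp)
      fix i l assume "i \<in> K" "l \<in> coord_block k s i"
      then have "l \<in> supp \<sigma>" by (auto simp: K_def coord_block_def)
      then show "x $ l = y $ l" by (rule that)
    qed
    show "(\<Prod>i\<in>{0..k}-K. ?f x i) = (\<Prod>i\<in>{0..k}-K. ?f y i)" if "\<And>i. i \<notin> supp \<sigma> \<Longrightarrow> x $ i = y $ i" for x y
    proof (intro prod.cong refl arg_cong[of _ _ "\<phi> _"] cp)
      fix i l assume i: "i \<in> {0..k} - K" "l \<in> coord_block k s i"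
      have "l \<notin> supp \<sigma>"
      proof (cases "i = 0")
        case True
        then show ?thesis using i supp_subset_Union[OF \<sigma>] by (auto simp: coord_block_def)
      next
        case False
        then have "i \<in> {1..k}" "l \<in> supp (s i)" "\<not> supp (s i) \<subseteq> supp \<sigma>" using i by (auto simp: K_def coord_block_def)
        then show ?thesis using supp_gen_cases[OF \<sigma>, of i] by blast
      qed
      then show "x $ l = y $ l" by (rule that)
    qed
  qed
qed

end

text \<open>Fubini for a splitting of the coordinates, obtained inside one space. For each fixed
  \<open>v\<close>, translation by the projection \<open>\<pi> v\<close> preserves null sets;
  exchange the quantifiers over \<open>u\<close> and \<open>v\<close>, and substitute
  \<open>v = p - u\<close>. Then \<open>u + \<pi> v\<close> has the coordinates of \<open>p\<close>
  in \<open>T\<close> and those of \<open>u\<close> elsewhere.\<close>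

lemma AE_splice:
  fixes T :: "'n::finite set"
  assumes "AE x :: real^'n in lebesgue. Q x"
  shows "AE u in lebesgue. AE p in lebesgue. Q (\<chi> i. if i \<in> T then p $ i else u $ i)"
proof -
  define \<pi> :: "real^'n \<Rightarrow> real^'n" where "\<pi> = (\<lambda>v. \<chi> i. if i \<in> T then v $ i else 0)"
  have \<pi>m: "\<pi> \<in> borel_measurable borel"
  proof -
    have "continuous_on UNIV (\<lambda>v :: real^'n. if i \<in> T then v $ i else 0)" for i
      by (cases "i \<in> T") (auto intro!: continuous_intros)
    then show ?thesis
      unfolding \<pi>_def by (intro borel_measurable_continuous_onI continuous_on_vec_lambda)
  qed
  obtain N' where "{x \<in> space lebesgue. \<not> Q x} \<subseteq> N'" "emeasure lebesgue N' = 0" "N' \<in> sets lebesgue"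
    using AE_E[OF assms] .
  then have N': "{x. \<not> Q x} \<subseteq> N'" "N' \<in> null_sets lebesgue"
    by (simp_all only: space_completion space_lborel space_borel UNIV_I simp_thms null_setsI)
  from N'(2)[unfolded null_sets_completion_iff2]
  obtain N where N: "N' \<subseteq> N" "N \<in> null_sets lborel" ..
  have Nb: "N \<in> sets borel" using N by auto
  have notN: "AE x in lebesgue. x \<notin> N" by (rule AE_not_in) (use N in \<open>simp add: null_sets_completionI\<close>)
  have "AE v in lborel. AE u in lborel. u + \<pi> v \<notin> N"
    using AE_translate[OF notN] by (simp add: AE_completion_iff)
  moreover have "{z \<in> space (lborel \<Otimes>\<^sub>M lborel). snd z + \<pi> (fst z) \<notin> N} \<in> sets (lborel \<Otimes>\<^sub>M lborel)"
    using Nb \<pi>m by measurable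
  ultimately have "AE u in lborel. AE v in lborel. u + \<pi> v \<notin> N"
    by (subst (asm) lborel_pair.AE_commute) auto
  then have "AE u in lebesgue. AE v in lebesgue. u + \<pi> v \<notin> N" by (simp add: AE_completion_iff)
  then show ?thesis
  proof eventually_elim
    case (elim u)
    have "AE p in lebesgue. u + \<pi> (p + - u) \<notin> N" by (rule AE_translate[OF elim])
    then show ?case
    proof eventually_elim
      case (elim p)
      have "u + \<pi> (p + - u) = (\<chi> i. if i \<in> T then p $ i else u $ i)" by (simp add: \<pi>_def vec_eq_iff)
      then show ?case using elim N(1) N'(1) by auto
    qed
  qed
qed

definition swap_reflect :: "int^'n \<Rightarrow> real^'n \<Rightarrow> real^'n \<Rightarrow> real^'n" where
  "swap_reflect \<sigma> p q = (\<chi> i. if odd (\<sigma> $ i) then - q $ i else p $ i)"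

lemma eventually_not_eventually_ex:
  assumes "eventually P F" "\<not> eventually Q F"
  shows "\<exists>x. P x \<and> \<not> Q x"
  using assms eventually_mono by blast

text \<open>Choose \<open>u\<close> with \<open>g u \<noteq> 0\<close> such that the symmetry holds
  at \<open>u\<close> and at almost every point obtained by splicing \<open>p\<close> into
  \<open>u\<close>. Dividing by \<open>\<beta> (- u)\<close> expresses \<open>\<alpha> (- p)\<close>
  through the conjugate of \<open>\<alpha> p\<close>. The conclusion speaks of all pairs from
  \<open>X\<close>, since it will be used at points whose difference is fixed.\<close>

lemma factor_swap_reflect:
  fixes g \<alpha> \<beta> :: "real^'n \<Rightarrow> complex"
  assumes g: "\<And>x. g x = \<alpha> x * \<beta> x"
    and \<alpha>: "\<And>x y. (\<And>i. i \<in> supp \<sigma> \<Longrightarrow> x $ i = y $ i) \<Longrightarrow> \<alpha> x = \<alpha> y"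
    and \<beta>: "\<And>x y. (\<And>i. i \<notin> supp \<sigma> \<Longrightarrow> x $ i = y $ i) \<Longrightarrow> \<beta> x = \<beta> y"
    and sym: "AE x in lebesgue. g (- x) = cnj (g x)" and nz: "\<not> (AE x in lebesgue. g x = 0)"
  obtains X where "AE x in lebesgue. x \<in> X"
    "\<And>p q. p \<in> X \<Longrightarrow> q \<in> X \<Longrightarrow> g p * cnj (g q) = g (swap_reflect \<sigma> p q) * cnj (g (swap_reflect \<sigma> q p))"
proof -
  have m1: "rrefl (1 :: int^'n) x = - x" for x by (simp add: rrefl_def vec_eq_iff)
  let ?sp = "\<lambda>p u. (\<chi> i. if i \<in> supp \<sigma> then p $ i else u $ i)"
  have "AE u in lebesgue. AE p in lebesgue. g (- ?sp p u) = cnj (g (?sp p u))"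
    by (rule AE_splice[OF sym])
  with sym have "AE u in lebesgue. g (- u) = cnj (g u) \<and> (AE p in lebesgue. g (- ?sp p u) = cnj (g (?sp p u)))"
    by eventually_elim simp
  from eventually_not_eventually_ex[OF this nz]
  obtain u where u: "g (- u) = cnj (g u)" "AE p in lebesgue. g (- ?sp p u) = cnj (g (?sp p u))" "g u \<noteq> 0"
    by blast
  have \<beta>nz: "\<beta> (- u) \<noteq> 0" using u g by auto
  define c where "c = cnj (\<beta> u) / \<beta> (- u)"
  have ae: "AE p in lebesgue. \<alpha> (- p) = c * cnj (\<alpha> p)"
    using u(2)
  proof eventually_elim
    case (elim p)
    have "\<alpha> (- ?sp p u) = \<alpha> (- p)" "\<alpha> (?sp p u) = \<alpha> p" "\<beta> (- ?sp p u) = \<beta> (- u)" "\<beta> (?sp p u) = \<beta> u"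
      by (auto intro!: \<alpha> \<beta>)
    then have "\<alpha> (- p) * \<beta> (- u) = cnj (\<alpha> p) * cnj (\<beta> u)" using elim by (simp add: g)
    then show ?case using \<beta>nz by (simp add: c_def field_simps)
  qed
  have ae': "AE p in lebesgue. \<alpha> p = c * cnj (\<alpha> (- p))"
    using AE_rrefl[OF ae, of 0 1] by (simp add: m1)
  define X where "X = {p. \<alpha> (- p) = c * cnj (\<alpha> p) \<and> \<alpha> p = c * cnj (\<alpha> (- p))}"
  have X: "AE p in lebesgue. p \<in> X" using ae ae' by eventually_elim (simp add: X_def)
  have "\<not> (AE p in lebesgue. \<alpha> p = 0)"
  proof
    assume "AE p in lebesgue. \<alpha> p = 0"
    then have "AE p in lebesgue. g p = 0" by eventually_elim (simp add: g)
    then show False using nz by blast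
  qed
  \<comment> \<open>Going from \<open>p0\<close> to \<open>- p0\<close> and back multiplies the
    nonzero number \<open>\<alpha> p0\<close> by \<open>c * cnj c\<close>; this determines the
    modulus of \<open>c\<close>.\<close>
  from eventually_not_eventually_ex[OF X this] obtain p0 where p0: "p0 \<in> X" "\<alpha> p0 \<noteq> 0" by blast
  have e1: "\<alpha> (- p0) = c * cnj (\<alpha> p0)" and e2: "\<alpha> p0 = c * cnj (\<alpha> (- p0))"
    using p0(1) unfolding X_def by blast+
  have "1 * \<alpha> p0 = c * cnj (c * cnj (\<alpha> p0))" unfolding e1[symmetric] mult_1 by (rule e2)
  also have "\<dots> = (c * cnj c) * \<alpha> p0" unfolding complex_cnj_mult complex_cnj_cnj by (simp only: ac_simps)
  finally have "(c * cnj c) * \<alpha> p0 = 1 * \<alpha> p0" by (rule HOL.sym)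
  then have cc: "c * cnj c = 1" unfolding mult_right_cancel[OF p0(2)] .
  show thesis
  proof (rule that[OF X])
    fix p q assume p: "p \<in> X" and q: "q \<in> X"
    have e: "\<alpha> (swap_reflect \<sigma> p q) = \<alpha> (- q)" "\<beta> (swap_reflect \<sigma> p q) = \<beta> p" for p q
      by (auto intro!: \<alpha> \<beta> simp: swap_reflect_def supp_def)
    have ap: "\<alpha> p = c * cnj (\<alpha> (- p))" using p unfolding X_def by blast
    have aq: "cnj c * \<alpha> (- q) = cnj (\<alpha> q)"
    proof -
      have "\<alpha> (- q) = c * cnj (\<alpha> q)" using q unfolding X_def by blast
      then have "cnj c * \<alpha> (- q) = (c * cnj c) * cnj (\<alpha> q)" by (simp only: ac_simps)
      then show ?thesis unfolding cc by (simp only: mult_1)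
    qed
    have "\<alpha> p * cnj (\<alpha> q) = (c * cnj (\<alpha> (- p))) * (cnj c * \<alpha> (- q))"
      by (rule arg_cong2[where f = "(*)", OF ap aq[symmetric]])
    also have "\<dots> = (c * cnj c) * (cnj (\<alpha> (- p)) * \<alpha> (- q))" by (simp only: ac_simps)
    finally have "\<alpha> p * cnj (\<alpha> q) = (c * cnj c) * (cnj (\<alpha> (- p)) * \<alpha> (- q))" .
    then have "\<alpha> p * cnj (\<alpha> q) = cnj (\<alpha> (- p)) * \<alpha> (- q)" unfolding cc by (simp only: mult_1)
    then show "g p * cnj (g q) = g (swap_reflect \<sigma> p q) * cnj (g (swap_reflect \<sigma> q p))"
    proof -
      assume eq: "\<alpha> p * cnj (\<alpha> q) = cnj (\<alpha> (- p)) * \<alpha> (- q)"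
      have "g p * cnj (g q) = (\<alpha> p * cnj (\<alpha> q)) * (\<beta> p * cnj (\<beta> q))"
        unfolding g complex_cnj_mult by (simp only: ac_simps)
      also have "\<dots> = g (swap_reflect \<sigma> p q) * cnj (g (swap_reflect \<sigma> q p))"
        unfolding eq unfolding g e complex_cnj_mult by (simp only: ac_simps)
      finally show ?thesis .
    qed
  qed
qed

lemma (in separable_group) separable_swap_reflect:
  assumes g: "separable_fun k s g"
    and sym: "AE x in lebesgue. g (- x) = cnj (g x)" and nz: "\<not> (AE x in lebesgue. g x = 0)"
  obtains X where "AE x in lebesgue. x \<in> X"
    "\<And>\<sigma> p q. \<sigma> \<in> G \<Longrightarrow> p \<in> X \<Longrightarrow> q \<in> X \<Longrightarrow>
       g p * cnj (g q) = g (swap_reflect \<sigma> p q) * cnj (g (swap_reflect \<sigma> q p))"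
proof -
  have "\<exists>X. (AE x in lebesgue. x \<in> X) \<and> (\<forall>p\<in>X. \<forall>q\<in>X.
      g p * cnj (g q) = g (swap_reflect \<sigma> p q) * cnj (g (swap_reflect \<sigma> q p)))" if \<sigma>: "\<sigma> \<in> G" for \<sigma>
  proof -
    obtain \<alpha> \<beta> where "\<And>x. g x = \<alpha> x * \<beta> x"
      "\<And>x y. (\<And>i. i \<in> supp \<sigma> \<Longrightarrow> x $ i = y $ i) \<Longrightarrow> \<alpha> x = \<alpha> y"
      "\<And>x y. (\<And>i. i \<notin> supp \<sigma> \<Longrightarrow> x $ i = y $ i) \<Longrightarrow> \<beta> x = \<beta> y"
      using separable_fun_factor[OF g \<sigma>] by blast
    from factor_swap_reflect[OF this sym nz] show ?thesis by metis
  qed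
  then obtain X where X: "\<And>\<sigma>. \<sigma> \<in> G \<Longrightarrow> AE x in lebesgue. x \<in> X \<sigma>"
    "\<And>\<sigma> p q. \<sigma> \<in> G \<Longrightarrow> p \<in> X \<sigma> \<Longrightarrow> q \<in> X \<sigma> \<Longrightarrow>
      g p * cnj (g q) = g (swap_reflect \<sigma> p q) * cnj (g (swap_reflect \<sigma> q p))"
    by metis
  show thesis
  proof (rule that[of "\<Inter>\<sigma>\<in>G. X \<sigma>"])
    show "AE x in lebesgue. x \<in> (\<Inter>\<sigma>\<in>G. X \<sigma>)"
    proof -
      have "AE x in lebesgue. \<forall>\<sigma>\<in>G. x \<in> X \<sigma>" by (rule AE_finite_allI[OF finite_G X(1)])
      then show ?thesis by simp
    qed
  qed (use X(2) in auto)
qed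

subsection \<open>Autocorrelations along the integer lattice\<close>

text \<open>Turns extended nonnegative integrals into real parts of quadratic forms. Nonnegativity
  is part of the conclusion so that sums of such integrals can be compared as sums of complex
  numbers.\<close>

lemma nn_integral_norm_lincomb:
  fixes f :: "'i \<Rightarrow> 'a \<Rightarrow> complex" and c :: "'i \<Rightarrow> complex"
  assumes P: "finite P" and m: "\<And>i. i \<in> P \<Longrightarrow> f i \<in> borel_measurable M"
    and i: "\<And>i. i \<in> P \<Longrightarrow> integrable M (\<lambda>x. (norm (f i x))\<^sup>2)"
  defines "Z \<equiv> (\<Sum>i\<in>P. \<Sum>j\<in>P. c i * cnj (c j) * (LINT x|M. f i x * cnj (f j x)))"
  shows "(\<integral>\<^sup>+x. ennreal ((norm (\<Sum>i\<in>P. c i * f i x))\<^sup>2) \<partial>M) = ennreal (Re Z)" and "0 \<le> Re Z"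
proof -
  have ii: "integrable M (\<lambda>x. (norm (\<Sum>i\<in>P. c i * f i x))\<^sup>2)"
    using m i by (intro integrable_norm_sum_sq[OF P]) (auto simp: norm_mult power_mult_distrib)
  have pw: "complex_of_real ((norm (\<Sum>i\<in>P. c i * f i x))\<^sup>2) =
      (\<Sum>i\<in>P. \<Sum>j\<in>P. c i * cnj (c j) * (f i x * cnj (f j x)))" for x
    unfolding complex_norm_square cnj_sum sum_product complex_cnj_mult by (simp only: ac_simps)
  have "complex_of_real (LINT x|M. (norm (\<Sum>i\<in>P. c i * f i x))\<^sup>2) =
      (LINT x|M. (\<Sum>i\<in>P. \<Sum>j\<in>P. c i * cnj (c j) * (f i x * cnj (f j x))))"
    unfolding integral_complex_of_real[symmetric] pw ..
  also have "\<dots> = Z"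
  proof -
    have "integrable M (\<lambda>x. c i * cnj (c j) * (f i x * cnj (f j x)))" if "i \<in> P" "j \<in> P" for i j
      using that m i by (intro integrable_mult_right integrable_mult_cnj) auto
    then show ?thesis
      unfolding Z_def
      by (subst Bochner_Integration.integral_sum, force intro!: Bochner_Integration.integrable_sum, intro sum.cong refl)
        (subst Bochner_Integration.integral_sum, auto)
  qed
  finally have "Re Z = (LINT x|M. (norm (\<Sum>i\<in>P. c i * f i x))\<^sup>2)"
    by (metis Re_complex_of_real)
  moreover have "(\<integral>\<^sup>+x. ennreal ((norm (\<Sum>i\<in>P. c i * f i x))\<^sup>2) \<partial>M) =
      ennreal (LINT x|M. (norm (\<Sum>i\<in>P. c i * f i x))\<^sup>2)"
    by (rule nn_integral_eq_integral[OF ii]) simp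
  ultimately show "(\<integral>\<^sup>+x. ennreal ((norm (\<Sum>i\<in>P. c i * f i x))\<^sup>2) \<partial>M) = ennreal (Re Z)" "0 \<le> Re Z"
    by simp_all
qed

text \<open>The inner product of the samples of \<open>g\<close> along the integer cosets of
  \<open>p\<close> and \<open>q\<close>; these numbers are the entries of the quadratic forms
  below.\<close>

definition autocorr :: "(real^'n \<Rightarrow> complex) \<Rightarrow> real^'n \<Rightarrow> real^'n \<Rightarrow> complex" where
  "autocorr g p q = (LINT m|count_space UNIV. g (p + real_vec m) * cnj (g (q + real_vec m)))"

lemma autocorr_shift: "autocorr g (p + real_vec n) (q + real_vec n) = autocorr g p q"
  using integral_bij_count_space[OF bij_plus, of "\<lambda>m. g (p + real_vec m) * cnj (g (q + real_vec m))" n]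
  by (simp add: autocorr_def add.assoc)

text \<open>Shifting both points by \<open>m\<close> shifts the reflected and swapped points by the
  reflection of \<open>m\<close>, which merely permutes the terms.\<close>

lemma autocorr_swap_reflect:
  assumes "\<And>m. g (p + real_vec m) * cnj (g (q + real_vec m)) =
     g (swap_reflect \<sigma> (p + real_vec m) (q + real_vec m)) * cnj (g (swap_reflect \<sigma> (q + real_vec m) (p + real_vec m)))"
  shows "autocorr g p q = autocorr g (swap_reflect \<sigma> p q) (swap_reflect \<sigma> q p)"
proof -
  have "swap_reflect \<sigma> (p + real_vec m) (q + real_vec m) = swap_reflect \<sigma> p q + real_vec (reflect \<sigma> m)" for p q m
    by (auto simp: swap_reflect_def reflect_def vec_eq_iff)
  then have "autocorr g p q = (LINT m|count_space UNIV.
      g (swap_reflect \<sigma> p q + real_vec (reflect \<sigma> m)) * cnj (g (swap_reflect \<sigma> q p + real_vec (reflect \<sigma> m))))"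
    unfolding autocorr_def using assms by simp
  also have "\<dots> = autocorr g (swap_reflect \<sigma> p q) (swap_reflect \<sigma> q p)"
    unfolding autocorr_def by (rule integral_bij_count_space[OF bij_reflect])
  finally show ?thesis .
qed

lemma autocorr_uminus:
  "(LINT m|count_space UNIV. cnj (g (p - real_vec m)) * cnj (cnj (g (q - real_vec m)))) = autocorr g q p"
proof -
  have "(LINT m|count_space UNIV. cnj (g (p - real_vec m)) * cnj (cnj (g (q - real_vec m)))) =
     (LINT m|count_space UNIV. g (q + real_vec (- m)) * cnj (g (p + real_vec (- m))))"
    by (simp add: mult.commute)
  also have "\<dots> = autocorr g q p"
    unfolding autocorr_def by (rule integral_bij_count_space[OF bij_uminus])
  finally show ?thesis .
qed

section \<open>The quadratic form at a single point\<close>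

definition half_vec :: "int^'n \<Rightarrow> real^'n" where
  "half_vec a = (1/2) *\<^sub>R real_vec a"

lemma half_vec_nth [simp]: "half_vec a $ i = of_int (a $ i) / 2"
  by (simp add: half_vec_def)

locale symmetric_window = separable_group G k s
  for G :: "(int^'n) set" and k :: nat and s :: "nat \<Rightarrow> int^'n" +
  fixes I :: "int^'n \<Rightarrow> int^'n" and g :: "real^'n \<Rightarrow> complex" and X :: "(real^'n) set"
  assumes dual: "dual_iso_rep G k s I"
    and gL2: "g \<in> L2"
    and X_AE: "AE x in lebesgue. x \<in> X"
    and swap: "\<And>\<sigma> p q. \<sigma> \<in> G \<Longrightarrow> p \<in> X \<Longrightarrow> q \<in> X \<Longrightarrow>
       g p * cnj (g q) = g (swap_reflect \<sigma> p q) * cnj (g (swap_reflect \<sigma> q p))"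
begin

definition chi :: "int^'n \<Rightarrow> int^'n \<Rightarrow> complex" where
  "chi h \<sigma> = (if even (int_inner (I h) \<sigma>) then 1 else -1)"

lemma chi_parity_add: "chi h (parity_add \<sigma> \<tau>) = chi h \<sigma> * chi h \<tau>"
  by (auto simp: chi_def even_int_inner_parity_add)

lemma chi_self: "chi h \<sigma> * chi h \<sigma> = 1"
  by (simp add: chi_def)

lemma cnj_chi [simp]: "cnj (chi h \<sigma>) = chi h \<sigma>"
  by (simp add: chi_def)

lemma chi_gen: "h \<in> G \<Longrightarrow> j \<in> {1..k} \<Longrightarrow> chi h (s j) = (if supp (s j) \<subseteq> supp h then -1 else 1)"
  using even_int_inner_dual_iso_rep[OF dual] by (simp add: chi_def)

lemma bij_parity_add:
  assumes "\<tau> \<in> G"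
  shows "bij_betw (\<lambda>\<sigma>. parity_add \<sigma> \<tau>) G G"
proof (rule bij_betw_byWitness[where f' = "\<lambda>\<sigma>. parity_add \<sigma> \<tau>"])
  have "parity_add (parity_add \<sigma> \<tau>) \<tau> = \<sigma>" if "\<sigma> \<in> G" for \<sigma>
    unfolding vec_eq_iff
  proof
    fix i
    show "parity_add (parity_add \<sigma> \<tau>) \<tau> $ i = \<sigma> $ i"
      using G_carrier[OF that, of i] G_carrier[OF assms, of i] by auto
  qed
  then show "\<forall>\<sigma>\<in>G. parity_add (parity_add \<sigma> \<tau>) \<tau> = \<sigma>" "\<forall>\<sigma>\<in>G. parity_add (parity_add \<sigma> \<tau>) \<tau> = \<sigma>" by blast+
qed (use assms parity_add_mem_G in auto)

text \<open>All points at which \<open>g\<close> is sampled below are half-integer shifts of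
  reflections of \<open>x\<close>. There are countably many, so almost every \<open>x\<close> has
  all of them in \<open>X\<close> with square-summable samples.\<close>

definition good_point :: "real^'n \<Rightarrow> bool" where
  "good_point x \<longleftrightarrow> (\<forall>\<sigma>\<in>G. \<forall>u. half_vec u + rrefl \<sigma> x \<in> X \<and>
     integrable (count_space UNIV) (\<lambda>m. (norm (g ((half_vec u + rrefl \<sigma> x) + real_vec m)))\<^sup>2))"

lemma AE_good_point: "AE x in lebesgue. good_point x"
proof -
  have "AE x in lebesgue. x \<in> X \<and> integrable (count_space UNIV) (\<lambda>m. (norm (g (x + real_vec m)))\<^sup>2)"
    using X_AE AE_square_summable[OF gL2] by eventually_elim simp
  note AE_rrefl[OF this]
  then show ?thesis
    unfolding good_point_def AE_ball_countable[OF countable_finite[OF finite_G]] AE_all_countable by blast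
qed

text \<open>The isometry from the overview. Its half shift is what cancels the sign belonging to
  \<open>\<gamma>\<close> in the Wilson functions; see
  \<open>wilson_poly_refl_point\<close>.\<close>

definition refl_point :: "int^'n \<Rightarrow> real^'n \<Rightarrow> real^'n" where
  "refl_point \<sigma> x = rrefl \<sigma> (x + half_vec \<sigma>)"

lemma refl_point_nth: "refl_point \<sigma> x $ i = (if odd (\<sigma> $ i) then - (x $ i + of_int (\<sigma> $ i) / 2) else x $ i + of_int (\<sigma> $ i) / 2)"
  by (simp add: refl_point_def rrefl_def)

lemma refl_point_half:
  "refl_point \<sigma> x - (real_vec l + half_vec h) = half_vec (reflect \<sigma> \<sigma> - (l + l) - h) + rrefl \<sigma> x"
  by (simp add: vec_eq_iff refl_point_nth reflect_def rrefl_def field_simps)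

lemma half_add_real_vec: "(half_vec u + y) + real_vec m = half_vec (u + (m + m)) + y"
  by (simp add: vec_eq_iff field_simps)

lemma good_refl_point:
  assumes x: "good_point x" and \<sigma>: "\<sigma> \<in> G"
  shows "refl_point \<sigma> x - (real_vec l + half_vec h) + real_vec m \<in> X"
    and "integrable (count_space UNIV) (\<lambda>m. (norm (g (refl_point \<sigma> x - (real_vec l + half_vec h) + real_vec m)))\<^sup>2)"
  using x \<sigma> unfolding refl_point_half by (auto simp: good_point_def half_add_real_vec)

lemma good_point_square_summable:
  assumes x: "good_point x"
  shows "integrable (count_space UNIV) (\<lambda>m. (norm (g (x + real_vec l - half_vec \<sigma> - real_vec m)))\<^sup>2)"
proof -
  have e: "x + real_vec l - half_vec \<sigma> - real_vec m = (half_vec ((l + l) - \<sigma>) + rrefl 0 x) + real_vec (- m)" for m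
    by (simp add: vec_eq_iff field_simps)
  have "integrable (count_space UNIV) (\<lambda>m. (norm (g ((half_vec ((l + l) - \<sigma>) + rrefl 0 x) + real_vec m)))\<^sup>2)"
    using x zero_mem_G unfolding good_point_def by blast
  then show ?thesis
    unfolding e using integrable_bij_count_space[OF bij_uminus, of "\<lambda>m. (norm (g ((half_vec ((l + l) - \<sigma>) + rrefl 0 x) + real_vec m)))\<^sup>2"]
    by simp
qed

lemma autocorr_swap_refl_point:
  assumes x: "good_point x" and \<sigma>: "\<sigma> \<in> G" and \<tau>: "\<tau> \<in> G"
  defines "p \<equiv> \<lambda>l h. refl_point \<sigma> x - (real_vec l + half_vec h)"
  shows "autocorr g (p l h) (p l' h') = autocorr g (swap_reflect \<tau> (p l h) (p l' h')) (swap_reflect \<tau> (p l' h') (p l h))"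
  unfolding p_def by (intro autocorr_swap_reflect swap[OF \<tau>] good_refl_point[OF x \<sigma>])

text \<open>On \<open>supp \<tau>\<close>, changing \<open>\<sigma>\<close> to the sum with
  \<open>\<tau>\<close> sends a coordinate \<open>y\<close> of \<open>refl_point \<sigma> x\<close>
  to \<open>- y - 1/2\<close>. Swapping instead negates the other point, whose half shift is
  complementary there. The two results differ by one integer vector \<open>?n\<close>, the same for
  both points, and autocorrelations ignore common integer shifts.\<close>

lemma autocorr_refl_point_flip:
  assumes x: "good_point x" and \<sigma>: "\<sigma> \<in> G" and \<tau>: "\<tau> \<in> G" and h: "\<And>i. i \<in> supp \<tau> \<Longrightarrow> h $ i + h' $ i = 1"
  shows "autocorr g (refl_point (parity_add \<sigma> \<tau>) x - (real_vec l + half_vec h)) (refl_point (parity_add \<sigma> \<tau>) x - (real_vec l' + half_vec h'))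
    = autocorr g (refl_point \<sigma> x - (real_vec l + half_vec h)) (refl_point \<sigma> x - (real_vec l' + half_vec h'))"
proof -
  let ?p = "\<lambda>l h. refl_point \<sigma> x - (real_vec l + half_vec h)"
  let ?n = "\<chi> i. if odd (\<tau> $ i) then - 1 - l $ i - l' $ i else 0"
  have hr: "real_of_int (h $ i) = 1 - real_of_int (h' $ i)" if "\<tau> $ i = 1" for i
  proof -
    have "h $ i = 1 - h' $ i" using h[of i] that by (simp add: supp_def)
    then show ?thesis by simp
  qed
  have "refl_point (parity_add \<sigma> \<tau>) x - (real_vec l + half_vec h) = swap_reflect \<tau> (?p l h) (?p l' h') + real_vec ?n"
    "refl_point (parity_add \<sigma> \<tau>) x - (real_vec l' + half_vec h') = swap_reflect \<tau> (?p l' h') (?p l h) + real_vec ?n"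
    unfolding vec_eq_iff
  proof safe
    fix i
    have c: "\<sigma> $ i = 0 \<or> \<sigma> $ i = 1" "\<tau> $ i = 0 \<or> \<tau> $ i = 1" using G_carrier \<sigma> \<tau> by auto
    show "(refl_point (parity_add \<sigma> \<tau>) x - (real_vec l + half_vec h)) $ i = (swap_reflect \<tau> (?p l h) (?p l' h') + real_vec ?n) $ i"
      "(refl_point (parity_add \<sigma> \<tau>) x - (real_vec l' + half_vec h')) $ i = (swap_reflect \<tau> (?p l' h') (?p l h) + real_vec ?n) $ i"
      using c hr[of i] by (auto simp: refl_point_nth swap_reflect_def field_simps)
  qed
  then show ?thesis
    using autocorr_swap_refl_point[OF x \<sigma> \<tau>, of l h l' h'] by (simp only: autocorr_shift)
qed

text \<open>Adding a generator whose block lies in exactly one of \<open>supp h\<close> and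
  \<open>supp h'\<close> permutes \<open>G\<close>, reverses the product of the two signs and
  preserves the autocorrelation. The sum is therefore its own negative.\<close>

lemma sum_autocorr_offdiag:
  assumes x: "good_point x" and h: "h \<in> G" "h' \<in> G" "h \<noteq> h'"
  shows "(\<Sum>\<sigma>\<in>G. chi h \<sigma> * chi h' \<sigma> * autocorr g (refl_point \<sigma> x - (real_vec l + half_vec h)) (refl_point \<sigma> x - (real_vec l' + half_vec h'))) = 0"
    (is "(\<Sum>\<sigma>\<in>G. ?t \<sigma>) = 0")
proof -
  obtain j where j: "j \<in> {1..k}" "supp (s j) \<subseteq> supp h \<longleftrightarrow> \<not> supp (s j) \<subseteq> supp h'"
    using distinguishing_generator[OF h] by blast
  have \<tau>: "s j \<in> G" by (rule gen_mem_G[OF j(1)])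
  have hh: "h $ i + h' $ i = 1" if "i \<in> supp (s j)" for i
  proof -
    have "odd (h $ i) \<longleftrightarrow> even (h' $ i)"
      using that j supp_gen_cases[OF h(1) j(1)] supp_gen_cases[OF h(2) j(1)] unfolding supp_def by blast
    then show ?thesis using G_carrier[OF h(1), of i] G_carrier[OF h(2), of i] by auto
  qed
  have "?t (parity_add \<sigma> (s j)) = - ?t \<sigma>" if "\<sigma> \<in> G" for \<sigma>
  proof -
    have "chi h (s j) * chi h' (s j) = -1" using j chi_gen[OF h(1) j(1)] chi_gen[OF h(2) j(1)] by auto
    then have "chi h (parity_add \<sigma> (s j)) * chi h' (parity_add \<sigma> (s j)) = - (chi h \<sigma> * chi h' \<sigma>)"
      unfolding chi_parity_add by (metis (no_types, opaque_lifting) mult.assoc mult.commute mult_minus1_right)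
    then show ?thesis using autocorr_refl_point_flip[OF x that \<tau> hh] by simp
  qed
  then have "(\<Sum>\<sigma>\<in>G. ?t (parity_add \<sigma> (s j))) = - (\<Sum>\<sigma>\<in>G. ?t \<sigma>)" by (simp add: sum_negf)
  moreover have "(\<Sum>\<sigma>\<in>G. ?t (parity_add \<sigma> (s j))) = (\<Sum>\<sigma>\<in>G. ?t \<sigma>)"
    by (rule sum.reindex_bij_betw[OF bij_parity_add[OF \<tau>]])
  ultimately show ?thesis by simp
qed

text \<open>Swapping with \<open>\<sigma>\<close> itself undoes the reflection and leaves the half
  shift by the sum of \<open>\<sigma>\<close> and \<open>h\<close>, so that summing over
  \<open>G\<close> eliminates \<open>h\<close>. A common integer shift by \<open>- l - l'\<close>,
  off the support of \<open>\<sigma>\<close>, lets \<open>l\<close> and \<open>l'\<close> trade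
  places.\<close>

lemma sum_autocorr_diag:
  assumes x: "good_point x" and h: "h \<in> G"
  shows "(\<Sum>\<sigma>\<in>G. autocorr g (refl_point \<sigma> x - (real_vec l + half_vec h)) (refl_point \<sigma> x - (real_vec l' + half_vec h)))
    = (\<Sum>\<sigma>\<in>G. autocorr g (x + real_vec l' - half_vec \<sigma>) (x + real_vec l - half_vec \<sigma>))"
proof -
  have "autocorr g (refl_point \<sigma> x - (real_vec l + half_vec h)) (refl_point \<sigma> x - (real_vec l' + half_vec h))
    = autocorr g (x + real_vec l' - half_vec (parity_add \<sigma> h)) (x + real_vec l - half_vec (parity_add \<sigma> h))"
    if \<sigma>: "\<sigma> \<in> G" for \<sigma>
  proof -
    let ?p = "\<lambda>l. refl_point \<sigma> x - (real_vec l + half_vec h)"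
    let ?n = "\<chi> i. if odd (\<sigma> $ i) then 1 else - l $ i - l' $ i"
    have "swap_reflect \<sigma> (?p l) (?p l') = x + real_vec l' - half_vec (parity_add \<sigma> h) + real_vec ?n"
      "swap_reflect \<sigma> (?p l') (?p l) = x + real_vec l - half_vec (parity_add \<sigma> h) + real_vec ?n"
      unfolding vec_eq_iff
    proof safe
      fix i
      have c: "\<sigma> $ i = 0 \<or> \<sigma> $ i = 1" "h $ i = 0 \<or> h $ i = 1" using G_carrier \<sigma> h by auto
      show "swap_reflect \<sigma> (?p l) (?p l') $ i = (x + real_vec l' - half_vec (parity_add \<sigma> h) + real_vec ?n) $ i"
        "swap_reflect \<sigma> (?p l') (?p l) $ i = (x + real_vec l - half_vec (parity_add \<sigma> h) + real_vec ?n) $ i"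
        using c by (auto simp: refl_point_nth swap_reflect_def field_simps)
    qed
    then show ?thesis
      using autocorr_swap_refl_point[OF x \<sigma> \<sigma>, of l h l' h] by (simp only: autocorr_shift)
  qed
  then have "(\<Sum>\<sigma>\<in>G. autocorr g (refl_point \<sigma> x - (real_vec l + half_vec h)) (refl_point \<sigma> x - (real_vec l' + half_vec h))) =
      (\<Sum>\<sigma>\<in>G. autocorr g (x + real_vec l' - half_vec (parity_add \<sigma> h)) (x + real_vec l - half_vec (parity_add \<sigma> h)))"
    by (rule sum.cong[OF refl])
  also have "\<dots> = (\<Sum>\<sigma>\<in>G. autocorr g (x + real_vec l' - half_vec \<sigma>) (x + real_vec l - half_vec \<sigma>))"
    by (rule sum.reindex_bij_betw[OF bij_parity_add[OF h], of "\<lambda>\<sigma>. autocorr g (x + real_vec l' - half_vec \<sigma>) (x + real_vec l - half_vec \<sigma>)"])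
  finally show ?thesis .
qed

text \<open>Links synthesis to analysis. Expanded in autocorrelations, the left side keeps only the
  entries with \<open>h = h'\<close>. The conjugate on the right accounts for the exchanged
  arguments in \<open>sum_autocorr_diag\<close>; the resulting sums over \<open>l\<close> are the
  correlations with translates of \<open>g\<close> that bound the frame sum in
  \<open>frame_lower_cube\<close>.\<close>

theorem pointwise_identity:
  assumes x: "good_point x" and L: "finite L"
  shows "(\<Sum>\<sigma>\<in>G. \<integral>\<^sup>+m. ennreal ((norm (\<Sum>(l, h)\<in>L \<times> G. (chi h \<sigma> * E l h) * g (refl_point \<sigma> x - (real_vec l + half_vec h) + real_vec m)))\<^sup>2) \<partial>count_space UNIV)
    = (\<Sum>h\<in>G. \<Sum>\<sigma>\<in>G. \<integral>\<^sup>+m. ennreal ((norm (\<Sum>l\<in>L. E l h * cnj (g (x + real_vec l - half_vec \<sigma> - real_vec m))))\<^sup>2) \<partial>count_space UNIV)"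
    (is "(\<Sum>\<sigma>\<in>G. ?l \<sigma>) = (\<Sum>h\<in>G. \<Sum>\<sigma>\<in>G. ?r h \<sigma>)")
proof -
  define A where "A = (\<lambda>\<sigma> l h l' h'. autocorr g (refl_point \<sigma> x - (real_vec l + half_vec h)) (refl_point \<sigma> x - (real_vec l' + half_vec h')))"
  define B where "B = (\<lambda>\<sigma> l l'. autocorr g (x + real_vec l' - half_vec \<sigma>) (x + real_vec l - half_vec \<sigma>))"
  define Z where "Z = (\<lambda>\<sigma>. \<Sum>(l, h)\<in>L \<times> G. \<Sum>(l', h')\<in>L \<times> G. (chi h \<sigma> * E l h) * cnj (chi h' \<sigma> * E l' h') * A \<sigma> l h l' h')"
  define W where "W = (\<lambda>h \<sigma>. \<Sum>l\<in>L. \<Sum>l'\<in>L. E l h * cnj (E l' h) * B \<sigma> l l')"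
  have fin: "finite (L \<times> G)" using L finite_G by simp
  have l: "?l \<sigma> = ennreal (Re (Z \<sigma>))" "0 \<le> Re (Z \<sigma>)" if \<sigma>: "\<sigma> \<in> G" for \<sigma>
  proof -
    let ?f = "\<lambda>(l, h) m. g (refl_point \<sigma> x - (real_vec l + half_vec h) + real_vec m)"
    let ?c = "\<lambda>(l, h). chi h \<sigma> * E l h"
    have "integrable (count_space UNIV) (\<lambda>m. (norm (?f i m))\<^sup>2)" for i
      using good_refl_point(2)[OF x \<sigma>] by (cases i) simp
    from nn_integral_norm_lincomb[where f = ?f and c = ?c, OF fin _ this]
    show "?l \<sigma> = ennreal (Re (Z \<sigma>))" "0 \<le> Re (Z \<sigma>)"
      by (simp_all add: Z_def A_def autocorr_def case_prod_unfold)
  qed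
  have r: "?r h \<sigma> = ennreal (Re (W h \<sigma>))" "0 \<le> Re (W h \<sigma>)" for h \<sigma>
  proof -
    let ?f = "\<lambda>l m. cnj (g (x + real_vec l - half_vec \<sigma> - real_vec m))"
    have "integrable (count_space UNIV) (\<lambda>m. (norm (?f l m))\<^sup>2)" for l
      using good_point_square_summable[OF x] by simp
    from nn_integral_norm_lincomb[where f = ?f and c = "\<lambda>l. E l h", OF L _ this]
    show "?r h \<sigma> = ennreal (Re (W h \<sigma>))" "0 \<le> Re (W h \<sigma>)"
      unfolding W_def B_def autocorr_uminus by simp_all
  qed
  have "(\<Sum>\<sigma>\<in>G. Z \<sigma>) = (\<Sum>(l, h)\<in>L \<times> G. \<Sum>(l', h')\<in>L \<times> G. E l h * cnj (E l' h') * (\<Sum>\<sigma>\<in>G. chi h \<sigma> * chi h' \<sigma> * A \<sigma> l h l' h'))"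
  proof -
    have "(\<Sum>\<sigma>\<in>G. Z \<sigma>) = (\<Sum>i\<in>L \<times> G. \<Sum>\<sigma>\<in>G. \<Sum>j\<in>L \<times> G.
        (chi (snd i) \<sigma> * E (fst i) (snd i)) * cnj (chi (snd j) \<sigma> * E (fst j) (snd j)) * A \<sigma> (fst i) (snd i) (fst j) (snd j))"
      unfolding Z_def case_prod_unfold by (rule sum.swap)
    also have "\<dots> = (\<Sum>i\<in>L \<times> G. \<Sum>j\<in>L \<times> G. \<Sum>\<sigma>\<in>G.
        (chi (snd i) \<sigma> * E (fst i) (snd i)) * cnj (chi (snd j) \<sigma> * E (fst j) (snd j)) * A \<sigma> (fst i) (snd i) (fst j) (snd j))"
      by (rule sum.cong[OF refl], rule sum.swap)
    finally show ?thesis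
      by (simp add: case_prod_unfold sum_distrib_left ac_simps)
  qed
  also have "\<dots> = (\<Sum>(l, h)\<in>L \<times> G. \<Sum>(l', h')\<in>L \<times> G. if h' = h then E l h * cnj (E l' h) * (\<Sum>\<sigma>\<in>G. B \<sigma> l l') else 0)"
  proof -
    have "E l h * cnj (E l' h') * (\<Sum>\<sigma>\<in>G. chi h \<sigma> * chi h' \<sigma> * A \<sigma> l h l' h') =
        (if h' = h then E l h * cnj (E l' h) * (\<Sum>\<sigma>\<in>G. B \<sigma> l l') else 0)"
      if h: "h \<in> G" "h' \<in> G" for l h l' h'
      using sum_autocorr_diag[OF x h(1), of l l'] sum_autocorr_offdiag[OF x h, of l l']
      by (auto simp: A_def B_def chi_self)
    then show ?thesis by (auto intro!: sum.cong)
  qed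
  also have "\<dots> = (\<Sum>l\<in>L. \<Sum>h\<in>G. \<Sum>l'\<in>L. E l h * cnj (E l' h) * (\<Sum>\<sigma>\<in>G. B \<sigma> l l'))"
    unfolding sum.cartesian_product[symmetric] using finite_G by (simp add: sum.delta)
  also have "\<dots> = (\<Sum>h\<in>G. \<Sum>\<sigma>\<in>G. W h \<sigma>)"
  proof -
    have "(\<Sum>\<sigma>\<in>G. W h \<sigma>) = (\<Sum>l\<in>L. \<Sum>l'\<in>L. E l h * cnj (E l' h) * (\<Sum>\<sigma>\<in>G. B \<sigma> l l'))" for h
      unfolding W_def sum_distrib_left
      by (subst sum.swap, rule sum.cong[OF refl], rule sum.swap)
    then show ?thesis by (simp add: sum.swap[of _ L G])
  qed
  finally have "(\<Sum>\<sigma>\<in>G. Z \<sigma>) = (\<Sum>h\<in>G. \<Sum>\<sigma>\<in>G. W h \<sigma>)" .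
  then have "Re (\<Sum>\<sigma>\<in>G. Z \<sigma>) = Re (\<Sum>h\<in>G. \<Sum>\<sigma>\<in>G. W h \<sigma>)" by simp
  moreover have "(\<Sum>\<sigma>\<in>G. ?l \<sigma>) = ennreal (Re (\<Sum>\<sigma>\<in>G. Z \<sigma>))"
    using l by (simp add: sum_ennreal)
  moreover have "(\<Sum>h\<in>G. \<Sum>\<sigma>\<in>G. ?r h \<sigma>) = ennreal (Re (\<Sum>h\<in>G. \<Sum>\<sigma>\<in>G. W h \<sigma>))"
    unfolding r(1) using r(2) by (simp add: sum_ennreal sum_nonneg)
  ultimately show ?thesis by simp
qed

end

subsection \<open>Wilson systems\<close>

definition psign :: "int \<Rightarrow> complex" where
  "psign n = (if even n then 1 else -1)"

lemma psign_add: "psign (a + b) = psign a * psign b"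
  by (simp add: psign_def)

lemma psign_self: "psign a * psign a = 1"
  by (simp add: psign_def)

lemma cis_pi_int: "cis (pi * of_int n) = psign n"
proof (cases "even n")
  case True
  then obtain z where "n = 2 * z" by (rule evenE)
  then show ?thesis using cis_multiple_2pi[of "of_int z"] by (simp add: psign_def ac_simps)
next
  case False
  then obtain z where "n = 2 * z + 1" by (rule oddE)
  then show ?thesis using cis_multiple_2pi[of "of_int z"]
    by (simp add: psign_def distrib_left cis_mult[symmetric] ac_simps)
qed

lemma inner_rrefl: "rrefl \<sigma> x \<bullet> y = x \<bullet> rrefl \<sigma> y"
  unfolding inner_vec_def by (intro sum.cong refl) (simp add: rrefl_def)

lemma even_int_inner_reflect: "psign (int_inner a (reflect \<sigma> b)) = psign (int_inner a b)"
proof -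
  have "int_inner a (reflect \<sigma> b) = int_inner a b - 2 * (\<Sum>i\<in>UNIV. if odd (\<sigma> $ i) then a $ i * b $ i else 0)"
    unfolding int_inner_def sum_distrib_left sum_subtractf[symmetric]
    by (intro sum.cong refl) (simp add: reflect_def)
  then show ?thesis by (simp add: psign_def)
qed

lemma half_vec_inner: "2 * pi * (half_vec a \<bullet> real_vec b) = pi * of_int (int_inner a b)"
  by (simp add: half_vec_def inner_real_vec_Ints)

lemma cis_inner_int_shift:
  "cis (2 * pi * ((w + real_vec n) \<bullet> real_vec \<xi>)) = cis (2 * pi * (w \<bullet> real_vec \<xi>))"
proof -
  have "2 * pi * ((w + real_vec n) \<bullet> real_vec \<xi>) = 2 * pi * (w \<bullet> real_vec \<xi>) + 2 * pi * of_int (int_inner n \<xi>)"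
    by (simp add: inner_add_left inner_real_vec_Ints distrib_left)
  then show ?thesis using cis_multiple_2pi[of "of_int (int_inner n \<xi>)"] by (simp add: cis_mult[symmetric])
qed

lemma reflect_reflect: "reflect \<tau> (reflect \<sigma> \<gamma>) = reflect (parity_add \<sigma> \<tau>) \<gamma>"
  by (simp add: reflect_def vec_eq_iff)

context symmetric_window
begin

lemma chi_psign: "chi h \<sigma> = psign (int_inner (I h) \<sigma>)"
  by (simp add: chi_def psign_def)

definition wilson_sign :: "int^'n \<Rightarrow> int^'n \<Rightarrow> int^'n \<Rightarrow> complex" where
  "wilson_sign h \<gamma> \<sigma> = psign (int_inner (I h + \<gamma>) \<sigma>)"

text \<open>A Wilson function is a constant times the product of this polynomial and
  \<open>g\<close>, translated together. The lemmas below record how the polynomial behaves under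
  the three constituents of the isometries: integer shifts, reflections and half shifts.\<close>

definition wilson_poly :: "int^'n \<Rightarrow> int^'n \<Rightarrow> real^'n \<Rightarrow> complex" where
  "wilson_poly h \<gamma> w = (\<Sum>\<sigma>\<in>G. wilson_sign h \<gamma> \<sigma> * cis (2 * pi * (w \<bullet> real_vec (reflect \<sigma> \<gamma>))))"

lemma wilson_eq:
  "wilson k G I g (l, h, \<gamma>) x = of_real (wilson_const k G \<gamma>) *
     (wilson_poly h \<gamma> (x - (real_vec l + half_vec h)) * g (x - (real_vec l + half_vec h)))"
proof -
  have e: "x - real_vec l - half_vec h = x - (real_vec l + half_vec h)" by simp
  show ?thesis
    unfolding wilson_def translate_def modulate_def prod.case half_vec_def[symmetric] e minus_one_powi
      wilson_poly_def wilson_sign_def psign_def sum_distrib_right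
    by (simp add: ac_simps)
qed

lemma wilson_sign_parity_add: "wilson_sign h \<gamma> (parity_add \<sigma> \<tau>) = wilson_sign h \<gamma> \<sigma> * wilson_sign h \<gamma> \<tau>"
  by (simp add: wilson_sign_def psign_def even_int_inner_parity_add)

lemma wilson_sign_eq: "wilson_sign h \<gamma> \<tau> = chi h \<tau> * psign (int_inner \<gamma> \<tau>)"
  by (simp add: wilson_sign_def chi_psign int_inner_add_left psign_add)

lemma norm_wilson_sign [simp]: "norm (wilson_sign h \<gamma> \<sigma>) = 1"
  by (simp add: wilson_sign_def psign_def)

lemma wilson_poly_int_shift: "wilson_poly h \<gamma> (w + real_vec n) = wilson_poly h \<gamma> w"
  by (simp only: wilson_poly_def cis_inner_int_shift)

text \<open>Reflecting the argument reflects the frequencies, which reindexes the sum over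
  \<open>G\<close>; the sign is multiplicative in the group element and comes out as a
  factor.\<close>

lemma wilson_poly_rrefl:
  assumes \<tau>: "\<tau> \<in> G"
  shows "wilson_poly h \<gamma> (rrefl \<tau> w) = chi h \<tau> * psign (int_inner \<gamma> \<tau>) * wilson_poly h \<gamma> w"
proof -
  let ?f = "\<lambda>\<sigma>. wilson_sign h \<gamma> \<sigma> * cis (2 * pi * (w \<bullet> real_vec (reflect \<sigma> \<gamma>)))"
  have "wilson_poly h \<gamma> (rrefl \<tau> w) = (\<Sum>\<sigma>\<in>G. wilson_sign h \<gamma> \<tau> * ?f (parity_add \<sigma> \<tau>))"
    unfolding wilson_poly_def
  proof (intro sum.cong refl)
    fix \<sigma>
    have "wilson_sign h \<gamma> \<tau> * wilson_sign h \<gamma> (parity_add \<sigma> \<tau>) = wilson_sign h \<gamma> \<sigma>"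
      unfolding wilson_sign_parity_add using psign_self[of "int_inner (I h + \<gamma>) \<tau>"]
      by (simp add: wilson_sign_def mult.left_commute)
    then show "wilson_sign h \<gamma> \<sigma> * cis (2 * pi * (rrefl \<tau> w \<bullet> real_vec (reflect \<sigma> \<gamma>))) = wilson_sign h \<gamma> \<tau> * ?f (parity_add \<sigma> \<tau>)"
      unfolding inner_rrefl rrefl_real_vec reflect_reflect by (simp only: mult.assoc[symmetric])
  qed
  also have "\<dots> = wilson_sign h \<gamma> \<tau> * (\<Sum>\<sigma>\<in>G. ?f (parity_add \<sigma> \<tau>))" by (simp only: sum_distrib_left)
  also have "(\<Sum>\<sigma>\<in>G. ?f (parity_add \<sigma> \<tau>)) = wilson_poly h \<gamma> w"
    unfolding wilson_poly_def by (rule sum.reindex_bij_betw[OF bij_parity_add[OF \<tau>]])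
  finally show ?thesis by (simp only: wilson_sign_eq)
qed

text \<open>All frequencies in one orbit pair with \<open>\<tau>\<close> with the same parity, so
  the half shift multiplies every term by the same sign.\<close>

lemma wilson_poly_half_shift:
  "wilson_poly h \<gamma> (w + half_vec \<tau>) = psign (int_inner \<gamma> \<tau>) * wilson_poly h \<gamma> w"
proof -
  have "cis (2 * pi * ((w + half_vec \<tau>) \<bullet> real_vec (reflect \<sigma> \<gamma>))) =
      psign (int_inner \<gamma> \<tau>) * cis (2 * pi * (w \<bullet> real_vec (reflect \<sigma> \<gamma>)))" for \<sigma>
  proof -
    have "cis (2 * pi * ((w + half_vec \<tau>) \<bullet> real_vec (reflect \<sigma> \<gamma>))) =
       cis (2 * pi * (w \<bullet> real_vec (reflect \<sigma> \<gamma>))) * cis (2 * pi * (half_vec \<tau> \<bullet> real_vec (reflect \<sigma> \<gamma>)))"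
      by (simp add: cis_mult inner_add_left distrib_left)
    then show ?thesis
      unfolding half_vec_inner cis_pi_int even_int_inner_reflect by (simp add: int_inner_commute[of \<gamma>] mult.commute)
  qed
  then show ?thesis by (simp add: wilson_poly_def sum_distrib_left mult.left_commute)
qed

text \<open>The sign of \<open>\<gamma>\<close> appears twice, from the reflection and from the half
  shift by \<open>\<sigma>\<close>, and cancels. What is left depends on \<open>h\<close> alone and
  can be taken out of the sum over \<open>\<gamma>\<close>.\<close>

lemma wilson_poly_refl_point:
  assumes \<sigma>: "\<sigma> \<in> G"
  shows "wilson_poly h \<gamma> (refl_point \<sigma> x - (real_vec l + half_vec h) + real_vec m) = chi h \<sigma> * wilson_poly h \<gamma> (x - half_vec h)"
proof -
  \<comment> \<open>Subtracting \<open>half_vec h\<close> before instead of after the reflection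
    changes the coordinates in \<open>supp \<sigma>\<close> by \<open>h\<close>, hence by
    integers.\<close>
  have "refl_point \<sigma> x - (real_vec l + half_vec h) + real_vec m =
      rrefl \<sigma> ((x - half_vec h) + half_vec \<sigma>) + real_vec (m - l - (\<chi> i. if odd (\<sigma> $ i) then h $ i else 0))"
    by (simp add: vec_eq_iff refl_point_nth rrefl_def field_simps)
  then have "wilson_poly h \<gamma> (refl_point \<sigma> x - (real_vec l + half_vec h) + real_vec m) =
      chi h \<sigma> * psign (int_inner \<gamma> \<sigma>) * (psign (int_inner \<gamma> \<sigma>) * wilson_poly h \<gamma> (x - half_vec h))"
    by (simp only: wilson_poly_int_shift wilson_poly_rrefl[OF \<sigma>] wilson_poly_half_shift)
  then show ?thesis using psign_self[of "int_inner \<gamma> \<sigma>"] by (simp add: mult.assoc[symmetric])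
qed

lemma norm_wilson_poly_le: "norm (wilson_poly h \<gamma> w) \<le> real (card G)"
  unfolding wilson_poly_def by (rule order_trans[OF norm_sum]) (simp add: norm_mult)

lemma wilson_poly_measurable: "(\<lambda>x. wilson_poly h \<gamma> (x - v)) \<in> borel_measurable lebesgue"
  unfolding wilson_poly_def inner_diff_left by measurable

abbreviation corr_sq :: "(int^'n) set \<Rightarrow> (int^'n \<Rightarrow> real^'n \<Rightarrow> complex) \<Rightarrow> int^'n \<Rightarrow> real^'n \<Rightarrow> int^'n \<Rightarrow> ennreal" where
  "corr_sq L \<epsilon> h x m \<equiv> ennreal ((norm (\<Sum>l\<in>L. \<epsilon> l x * cnj (g (x + real_vec l - half_vec h - real_vec m))))\<^sup>2)"

text \<open>The integral of the squared modulus of \<open>F\<close> is tiled once along each of the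
  \<open>card G\<close> isometries, and \<open>pointwise_identity\<close> is applied at almost every
  point of the cube. By periodicity \<open>l\<close> enters \<open>E\<close> only through the
  coefficients.\<close>

lemma wilson_lincomb_norm:
  fixes L :: "(int^'n) set" and \<Gamma> :: "(int^'n) set" and c
  defines "F \<equiv> \<lambda>x. \<Sum>(l, h)\<in>L \<times> G. \<Sum>\<gamma>\<in>\<Gamma>. c (l, h, \<gamma>) * wilson k G I g (l, h, \<gamma>) x"
    and "E \<equiv> \<lambda>l h x. \<Sum>\<gamma>\<in>\<Gamma>. c (l, h, \<gamma>) * of_real (wilson_const k G \<gamma>) * wilson_poly h \<gamma> (x - half_vec h)"
  assumes L: "finite L" and F: "F \<in> L2"
  shows "of_nat (card G) * ennreal ((l2_norm F)\<^sup>2) =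
    (\<Sum>h\<in>G. \<integral>\<^sup>+x. indicator unit_cube x * (\<Sum>\<sigma>\<in>G. \<integral>\<^sup>+m.
       corr_sq L (\<lambda>l. E l h) \<sigma> x m \<partial>count_space UNIV) \<partial>lebesgue)"
proof -
  have FR: "F (refl_point \<sigma> x + real_vec m) =
      (\<Sum>(l, h)\<in>L \<times> G. (chi h \<sigma> * E l h x) * g (refl_point \<sigma> x - (real_vec l + half_vec h) + real_vec m))"
    if \<sigma>: "\<sigma> \<in> G" for \<sigma> x m
  proof -
    have e: "refl_point \<sigma> x + real_vec m - (real_vec l + half_vec h) = refl_point \<sigma> x - (real_vec l + half_vec h) + real_vec m" for l h
      by simp
    show ?thesis
      unfolding F_def wilson_eq e wilson_poly_refl_point[OF \<sigma>] E_def sum_distrib_left sum_distrib_right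
      by (simp only: ac_simps)
  qed
  have Fm: "F \<in> borel_measurable lebesgue" and Fi: "integrable lebesgue (\<lambda>x. (norm (F x))\<^sup>2)"
    using F by (simp_all add: L2_def)
  have Fm2: "(\<lambda>x. ennreal ((norm (F x))\<^sup>2)) \<in> borel_measurable lebesgue" using Fm by measurable
  have gm: "g \<in> borel_measurable lebesgue" using gL2 by (simp add: L2_def)
  have Em: "(\<lambda>x. E l h x) \<in> borel_measurable lebesgue" for l h
    unfolding E_def by (intro borel_measurable_sum borel_measurable_times wilson_poly_measurable) auto
  have "(\<Sum>\<sigma>\<in>G. \<integral>\<^sup>+x. ennreal ((norm (F x))\<^sup>2) \<partial>lebesgue) =
    (\<Sum>\<sigma>\<in>G. \<integral>\<^sup>+x. indicator unit_cube x * (\<integral>\<^sup>+m. ennreal ((norm (F (refl_point \<sigma> x + real_vec m)))\<^sup>2) \<partial>count_space UNIV) \<partial>lebesgue)"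
    unfolding refl_point_def by (intro sum.cong refl nn_integral_tile_rrefl[OF Fm2])
  also have "\<dots> = (\<integral>\<^sup>+x. (\<Sum>\<sigma>\<in>G. indicator unit_cube x * (\<integral>\<^sup>+m. ennreal ((norm (F (refl_point \<sigma> x + real_vec m)))\<^sup>2) \<partial>count_space UNIV)) \<partial>lebesgue)"
  proof (rule nn_integral_sum[symmetric])
    fix \<sigma>
    have "refl_point \<sigma> x + real_vec m = (rrefl \<sigma> (half_vec \<sigma>) + real_vec m) + rrefl \<sigma> x" for x m
      by (simp add: refl_point_def rrefl_add)
    then show "(\<lambda>x. indicator unit_cube x * (\<integral>\<^sup>+m. ennreal ((norm (F (refl_point \<sigma> x + real_vec m)))\<^sup>2) \<partial>count_space UNIV)) \<in> borel_measurable lebesgue"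
      by (simp only:) (intro borel_measurable_times_ennreal borel_measurable_count_sum borel_measurable_rrefl[OF Fm2]
        borel_measurable_indicator unit_cube_lebesgue)
  qed
  also have "\<dots> = (\<integral>\<^sup>+x. (\<Sum>h\<in>G. indicator unit_cube x * (\<Sum>\<sigma>\<in>G. \<integral>\<^sup>+m.
       corr_sq L (\<lambda>l. E l h) \<sigma> x m \<partial>count_space UNIV)) \<partial>lebesgue)"
  proof (rule nn_integral_cong_AE)
    show "AE x in lebesgue. (\<Sum>\<sigma>\<in>G. indicator unit_cube x * (\<integral>\<^sup>+m. ennreal ((norm (F (refl_point \<sigma> x + real_vec m)))\<^sup>2) \<partial>count_space UNIV)) =
       (\<Sum>h\<in>G. indicator unit_cube x * (\<Sum>\<sigma>\<in>G. \<integral>\<^sup>+m.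
       corr_sq L (\<lambda>l. E l h) \<sigma> x m \<partial>count_space UNIV))"
      using AE_good_point
    proof eventually_elim
      case (elim x)
      show ?case
        unfolding sum_distrib_left[symmetric] pointwise_identity[OF elim L, symmetric]
        by (rule arg_cong[where f = "\<lambda>t. indicator unit_cube x * t"], rule sum.cong[OF refl]) (simp only: FR)
    qed
  qed
  also have "\<dots> = (\<Sum>h\<in>G. \<integral>\<^sup>+x. indicator unit_cube x * (\<Sum>\<sigma>\<in>G. \<integral>\<^sup>+m.
       corr_sq L (\<lambda>l. E l h) \<sigma> x m \<partial>count_space UNIV) \<partial>lebesgue)"
  proof (rule nn_integral_sum)
    fix h
    have "(\<lambda>x. corr_sq L (\<lambda>l. E l h) \<sigma> x m) \<in> borel_measurable lebesgue" for \<sigma> m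
    proof -
      have "(\<lambda>x. g (x + real_vec l - half_vec \<sigma> - real_vec m)) \<in> borel_measurable lebesgue" for l
        using borel_measurable_translate[OF gm, of "real_vec l - half_vec \<sigma> - real_vec m"] by (simp add: algebra_simps)
      then show ?thesis using Em by measurable
    qed
    then show "(\<lambda>x. indicator unit_cube x * (\<Sum>\<sigma>\<in>G. \<integral>\<^sup>+m.
       corr_sq L (\<lambda>l. E l h) \<sigma> x m \<partial>count_space UNIV)) \<in> borel_measurable lebesgue"
      by (intro borel_measurable_times_ennreal borel_measurable_sum borel_measurable_count_sum
        borel_measurable_indicator unit_cube_lebesgue)
  qed
  finally show ?thesis
    using Fi by (simp add: l2_norm_sq nn_integral_eq_integral)
qed

subsection \<open>The lower frame bound on the unit cube\<close>

lemma wilson_const_sq_le: "(wilson_const k G \<gamma>)\<^sup>2 \<le> real (card G)"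
proof -
  have "refl_orbit G \<gamma> = (\<lambda>\<sigma>. reflect \<sigma> \<gamma>) ` G" by (auto simp: refl_orbit_def)
  then have c: "card (refl_orbit G \<gamma>) \<le> card G" using card_image_le[OF finite_G] by simp
  have "(wilson_const k G \<gamma>)\<^sup>2 = (1 / 2 ^ k)\<^sup>2 * real (card (refl_orbit G \<gamma>))"
    by (simp add: wilson_const_def power_mult_distrib power_divide)
  also have "\<dots> \<le> 1 * real (card (refl_orbit G \<gamma>))"
    by (intro mult_right_mono power_le_one) auto
  finally show ?thesis using c by simp
qed

lemma wilson_const_sq_ge: "(1 / 2 ^ k)\<^sup>2 \<le> (wilson_const k G \<gamma>)\<^sup>2"
proof -
  have e: "refl_orbit G \<gamma> = (\<lambda>\<sigma>. reflect \<sigma> \<gamma>) ` G" by (auto simp: refl_orbit_def)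
  have "card (refl_orbit G \<gamma>) \<noteq> 0" unfolding e using finite_G zero_mem_G by auto
  then have "1 \<le> real (card (refl_orbit G \<gamma>))" by simp
  then have "(1 / 2 ^ k)\<^sup>2 * 1 \<le> (1 / 2 ^ k)\<^sup>2 * real (card (refl_orbit G \<gamma>))"
    by (intro mult_left_mono) auto
  then show ?thesis by (simp add: wilson_const_def power_mult_distrib power_divide)
qed

lemma L2_bounded_mult:
  fixes e f :: "real^'n \<Rightarrow> complex"
  assumes "e \<in> borel_measurable lebesgue" "\<And>x. norm (e x) \<le> B" "f \<in> L2"
  shows "(\<lambda>x. e x * f x) \<in> L2"
proof -
  have "integrable lebesgue (\<lambda>x. (norm (e x * f x))\<^sup>2)"
  proof (rule Bochner_Integration.integrable_bound)
    show "integrable lebesgue (\<lambda>x. B\<^sup>2 * (norm (f x))\<^sup>2)" using assms by (auto simp: L2_def)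
    show "(\<lambda>x. (norm (e x * f x))\<^sup>2) \<in> borel_measurable lebesgue" using assms by (auto simp: L2_def)
    have "(norm (e x * f x))\<^sup>2 \<le> B\<^sup>2 * (norm (f x))\<^sup>2" for x
      unfolding norm_mult power_mult_distrib using assms(2)[of x] by (intro mult_right_mono power_mono) auto
    then show "AE x in lebesgue. norm ((norm (e x * f x))\<^sup>2) \<le> norm (B\<^sup>2 * (norm (f x))\<^sup>2)" by simp
  qed
  then show ?thesis using assms by (auto simp: L2_def)
qed

text \<open>The functions \<open>\<epsilon> l\<close> are laid out on the integer translates of the
  cube as one test function \<open>f\<close>. Its inner product with a Wilson function is a signed
  sum over \<open>\<sigma>\<close> of Fourier coefficients on the cube. The three factors
  \<open>card G\<close> stem from Cauchy-Schwarz over \<open>\<sigma>\<close>, from the bound for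
  the square of \<open>wilson_const\<close>, and from summing over \<open>\<sigma>\<close> after
  Bessel's inequality in \<open>\<gamma>\<close>.\<close>

lemma frame_lower_cube:
  fixes \<epsilon> :: "int^'n \<Rightarrow> real^'n \<Rightarrow> complex" and L :: "(int^'n) set"
  assumes fr: "is_frame (wilson_index k G I N g) (wilson k G I g) a b"
    and L: "finite L" and \<epsilon>m: "\<And>l. \<epsilon> l \<in> borel_measurable lebesgue" and \<epsilon>B: "\<And>l x. norm (\<epsilon> l x) \<le> B l"
  shows "ennreal a * (\<integral>\<^sup>+x. indicator unit_cube x * (\<Sum>l\<in>L. ennreal ((norm (\<epsilon> l x))\<^sup>2)) \<partial>lebesgue)
    \<le> ennreal (real (card G) ^ 3) * (\<integral>\<^sup>+x. indicator unit_cube x * (\<Sum>h\<in>G. \<integral>\<^sup>+m.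
       corr_sq L \<epsilon> h x m \<partial>count_space UNIV) \<partial>lebesgue)"
    (is "_ * ?lhs \<le> _ * ?R")
proof -
  have a: "0 < a" using fr by (simp add: is_frame_def)
  define \<rho> where "\<rho> = (\<lambda>l x. indicator unit_cube x * \<epsilon> l x)"
  have \<rho>L: "\<rho> l \<in> L2" for l unfolding \<rho>_def using \<epsilon>m \<epsilon>B by (rule L2_bounded_unit_cube)
  define f where "f = (\<lambda>y. \<Sum>l\<in>L. \<rho> l (y - real_vec l))"
  have fL: "f \<in> L2" unfolding f_def using L2_translate[OF \<rho>L, of _ "- real_vec _"] by (intro L2_sum L) auto
  have "(\<integral>\<^sup>+x. ennreal ((norm (f x))\<^sup>2) \<partial>lebesgue) = ?lhs"
  proof -
    have m: "(\<lambda>x. ennreal ((norm (f x))\<^sup>2)) \<in> borel_measurable lebesgue" using fL by (auto simp: L2_def)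
    have "indicator unit_cube x * (\<integral>\<^sup>+m. ennreal ((norm (f (x + real_vec m)))\<^sup>2) \<partial>count_space UNIV) =
       indicator unit_cube x * (\<Sum>l\<in>L. ennreal ((norm (\<epsilon> l x))\<^sup>2))" for x
    proof (cases "x \<in> unit_cube")
      case True
      have fl: "floor_vec x = 0" using True add_real_vec_mem_unit_cube[of x 0] by simp
      have "f (x + real_vec m) = (if m \<in> L then \<epsilon> m x else 0)" for m
      proof -
        have "\<rho> l (x + real_vec m - real_vec l) = (if l = m then \<epsilon> m x else 0)" for l
        proof -
          have e: "x + real_vec m - real_vec l = x + real_vec (m - l)" by simp
          have "x + real_vec m - real_vec l \<in> unit_cube \<longleftrightarrow> l = m"
            unfolding e add_real_vec_mem_unit_cube fl by auto
          then show ?thesis by (auto simp: \<rho>_def indicator_def)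
        qed
        then show ?thesis using L by (simp add: f_def sum.delta')
      qed
      then have "(\<integral>\<^sup>+m. ennreal ((norm (f (x + real_vec m)))\<^sup>2) \<partial>count_space UNIV) =
          (\<integral>\<^sup>+m. ennreal ((norm (\<epsilon> m x))\<^sup>2) * indicator L m \<partial>count_space UNIV)"
        by (intro nn_integral_cong) (simp add: indicator_def)
      also have "\<dots> = (\<integral>\<^sup>+m. ennreal ((norm (\<epsilon> m x))\<^sup>2) \<partial>count_space L)"
        by (simp add: nn_integral_restrict_space[symmetric] restrict_count_space)
      also have "\<dots> = (\<Sum>l\<in>L. ennreal ((norm (\<epsilon> l x))\<^sup>2))" by (rule nn_integral_count_space_finite[OF L])
      finally show ?thesis by simp
    qed simp
    then show ?thesis unfolding nn_integral_tile[OF m] by simp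
  qed
  then have fnorm: "ennreal ((l2_norm f)\<^sup>2) = ?lhs"
    using fL by (simp add: l2_norm_sq nn_integral_eq_integral L2_def)
  \<comment> \<open>On the cube this is the sum of
    \<open>f (x + l) * cnj (g (x + l - \<mu>))\<close> over \<open>l\<close>, that is,
    \<open>f\<close> times a conjugated translate of \<open>g\<close>, periodized. Its Fourier
    coefficients have the modulus of the inner products of \<open>f\<close> with modulated
    translates of \<open>g\<close>.\<close>
  define H where "H = (\<lambda>\<mu> x. \<Sum>l\<in>L. \<rho> l x * cnj (g (x + (real_vec l - \<mu>))))"
  let ?b = "\<lambda>\<mu> \<sigma> \<gamma>. (norm (l2_inner (H \<mu>) (cube_exp (reflect \<sigma> \<gamma>))))\<^sup>2"
  let ?n = "\<lambda>h m. (l2_norm (H (real_vec m + half_vec h)))\<^sup>2"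
  let ?w = "\<lambda>j. (norm (l2_inner f (wilson k G I g j)))\<^sup>2"
  have modulated_L2: "(\<lambda>y. cnj (cis (2 * pi * ((y - \<mu>) \<bullet> real_vec \<xi>)) * g (y - \<mu>))) \<in> L2" for \<mu> :: "real^'n" and \<xi>
  proof -
    have "(\<lambda>y. cis (2 * pi * ((y - \<mu>) \<bullet> real_vec \<xi>))) \<in> borel_measurable lebesgue"
      unfolding inner_diff_left by measurable
    from L2_bounded_mult[OF this, of 1, OF _ L2_translate[OF gL2, of "- \<mu>"]]
    have "(\<lambda>y. cis (2 * pi * ((y - \<mu>) \<bullet> real_vec \<xi>)) * g (y + - \<mu>)) \<in> L2" by simp
    from L2_cnj[OF this] show ?thesis by (simp only: add_uminus_conv_diff)
  qed
  have gtL: "(\<lambda>x. cnj (g (x + v))) \<in> L2" for v by (intro L2_cnj L2_translate gL2)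
  have \<rho>m: "\<rho> l \<in> borel_measurable lebesgue" for l using \<rho>L by (simp add: L2_def)
  have \<rho>B: "norm (\<rho> l x) \<le> B l" for l x
    using \<epsilon>B[of l x] order_trans[OF norm_ge_zero \<epsilon>B[of l x]] by (auto simp: \<rho>_def indicator_def)
  have HL: "H \<mu> \<in> L2" for \<mu> unfolding H_def
    by (intro L2_sum L L2_bounded_mult[OF \<rho>m \<rho>B gtL])
  have inner_modulated: "norm (LINT y|lebesgue. f y * cnj (cis (2 * pi * ((y - \<mu>) \<bullet> real_vec \<xi>)) * g (y - \<mu>))) =
      norm (l2_inner (H \<mu>) (cube_exp \<xi>))" for \<mu> \<xi>
  proof -
    let ?q = "\<lambda>y. cnj (cis (2 * pi * ((y - \<mu>) \<bullet> real_vec \<xi>)) * g (y - \<mu>))"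
    note qL = modulated_L2[of \<mu> \<xi>]
    have \<rho>t: "(\<lambda>y. \<rho> l (y - real_vec l)) \<in> L2" for l using L2_translate[OF \<rho>L, of l "- real_vec l"] by simp
    have "(LINT y|lebesgue. f y * ?q y) = (\<Sum>l\<in>L. LINT y|lebesgue. \<rho> l (y - real_vec l) * ?q y)"
      unfolding f_def sum_distrib_right
      by (rule Bochner_Integration.integral_sum) (rule integrable_mult_L2[OF \<rho>t qL])
    also have "\<dots> = (\<Sum>l\<in>L. LINT x|lebesgue. \<rho> l x * ?q (x + real_vec l))"
    proof (intro sum.cong refl)
      fix l
      have m: "(\<lambda>y. \<rho> l (y - real_vec l) * ?q y) \<in> borel_measurable lebesgue"
        by (rule borel_measurable_integrable[OF integrable_mult_L2[OF \<rho>t qL]])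
      show "(LINT y|lebesgue. \<rho> l (y - real_vec l) * ?q y) = (LINT x|lebesgue. \<rho> l x * ?q (x + real_vec l))"
        using integral_translate[OF m, of "real_vec l"] by simp
    qed
    also have "\<dots> = (LINT x|lebesgue. (\<Sum>l\<in>L. \<rho> l x * ?q (x + real_vec l)))"
      by (rule Bochner_Integration.integral_sum[symmetric]) (rule integrable_mult_L2[OF \<rho>L L2_translate[OF qL]])
    also have "\<dots> = (LINT x|lebesgue. cis (2 * pi * (\<mu> \<bullet> real_vec \<xi>)) * (H \<mu> x * cnj (cube_exp \<xi> x)))"
    proof (intro Bochner_Integration.integral_cong refl)
      fix x
      have q: "?q (x + real_vec l) = cis (2 * pi * (\<mu> \<bullet> real_vec \<xi>)) * cnj (cis (2 * pi * (x \<bullet> real_vec \<xi>))) * cnj (g (x + (real_vec l - \<mu>)))" for l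
      proof -
        have "x + real_vec l - \<mu> = (x - \<mu>) + real_vec l" by simp
        then have "cis (2 * pi * ((x + real_vec l - \<mu>) \<bullet> real_vec \<xi>)) = cis (2 * pi * ((x - \<mu>) \<bullet> real_vec \<xi>))"
          by (simp only: cis_inner_int_shift)
        then show ?thesis
          by (simp add: cis_cnj cis_mult inner_diff_left right_diff_distrib add_diff_eq)
      qed
      have c: "\<rho> l x * cnj (cube_exp \<xi> x) = \<rho> l x * cnj (cis (2 * pi * (x \<bullet> real_vec \<xi>)))" for l
        by (simp add: \<rho>_def cube_exp_def indicator_def)
      have "(\<Sum>l\<in>L. \<rho> l x * ?q (x + real_vec l)) =
         cis (2 * pi * (\<mu> \<bullet> real_vec \<xi>)) * (\<Sum>l\<in>L. \<rho> l x * cnj (cis (2 * pi * (x \<bullet> real_vec \<xi>))) * cnj (g (x + (real_vec l - \<mu>))))"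
        unfolding q sum_distrib_left by (simp only: ac_simps)
      also have "\<dots> = cis (2 * pi * (\<mu> \<bullet> real_vec \<xi>)) * (H \<mu> x * cnj (cube_exp \<xi> x))"
        unfolding c[symmetric] H_def sum_distrib_right by (simp only: ac_simps)
      finally show "(\<Sum>l\<in>L. \<rho> l x * ?q (x + real_vec l)) = cis (2 * pi * (\<mu> \<bullet> real_vec \<xi>)) * (H \<mu> x * cnj (cube_exp \<xi> x))" .
    qed
    also have "\<dots> = cis (2 * pi * (\<mu> \<bullet> real_vec \<xi>)) * l2_inner (H \<mu>) (cube_exp \<xi>)"
      unfolding l2_inner_def by (rule integral_mult_right_zero)
    finally show ?thesis by (simp only: norm_mult norm_cis mult_1)
  qed
  have inner_le: "?w (l, h, \<gamma>) \<le>
     (real (card G))\<^sup>2 * (\<Sum>\<sigma>\<in>G. ?b (real_vec l + half_vec h) \<sigma> \<gamma>)" for l h \<gamma>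
  proof -
    let ?\<mu> = "real_vec l + half_vec h"
    let ?q = "\<lambda>\<sigma> y. cnj (cis (2 * pi * ((y - ?\<mu>) \<bullet> real_vec (reflect \<sigma> \<gamma>))) * g (y - ?\<mu>))"
    let ?c = "\<lambda>\<sigma>. of_real (wilson_const k G \<gamma>) * cnj (wilson_sign h \<gamma> \<sigma>)"
    note qL = modulated_L2[of ?\<mu>]
    have "l2_inner f (wilson k G I g (l, h, \<gamma>)) = (LINT y|lebesgue. (\<Sum>\<sigma>\<in>G. ?c \<sigma> * (f y * ?q \<sigma> y)))"
      unfolding l2_inner_def wilson_eq wilson_poly_def
      by (intro Bochner_Integration.integral_cong refl)
        (simp add: sum_distrib_left sum_distrib_right ac_simps)
    also have "\<dots> = (\<Sum>\<sigma>\<in>G. ?c \<sigma> * (LINT y|lebesgue. f y * ?q \<sigma> y))"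
      by (subst Bochner_Integration.integral_sum)
        (auto simp only: integral_mult_right_zero intro!: integrable_mult_right integrable_mult_L2[OF fL qL])
    finally have "norm (l2_inner f (wilson k G I g (l, h, \<gamma>))) \<le>
       (\<Sum>\<sigma>\<in>G. norm (?c \<sigma> * (LINT y|lebesgue. f y * ?q \<sigma> y)))"
      by (simp only: norm_sum)
    also have "\<dots> = \<bar>wilson_const k G \<gamma>\<bar> * (\<Sum>\<sigma>\<in>G. norm (l2_inner (H ?\<mu>) (cube_exp (reflect \<sigma> \<gamma>))))"
      unfolding norm_mult inner_modulated sum_distrib_left by simp
    finally have "?w (l, h, \<gamma>) \<le>
       (\<bar>wilson_const k G \<gamma>\<bar> * (\<Sum>\<sigma>\<in>G. norm (l2_inner (H ?\<mu>) (cube_exp (reflect \<sigma> \<gamma>)))))\<^sup>2"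
      by (rule power_mono) simp
    also have "\<dots> = (wilson_const k G \<gamma>)\<^sup>2 * (\<Sum>\<sigma>\<in>G. norm (l2_inner (H ?\<mu>) (cube_exp (reflect \<sigma> \<gamma>))))\<^sup>2"
      by (simp add: power_mult_distrib)
    also have "\<dots> \<le> real (card G) * ((\<Sum>\<sigma>\<in>G. ?b ?\<mu> \<sigma> \<gamma>) * real (card G))"
      by (intro mult_mono wilson_const_sq_le sum_squared_le_sum_of_squares) auto
    finally show ?thesis by (simp add: power2_eq_square ac_simps)
  qed
  have Hn: "ennreal (?n h m) =
     (\<integral>\<^sup>+x. indicator unit_cube x * corr_sq L \<epsilon> h x m \<partial>lebesgue)" for m h
  proof -
    have "ennreal (?n h m) = (\<integral>\<^sup>+x. ennreal ((norm (H (real_vec m + half_vec h) x))\<^sup>2) \<partial>lebesgue)"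
      using HL by (simp add: l2_norm_sq nn_integral_eq_integral L2_def)
    also have "\<dots> = (\<integral>\<^sup>+x. indicator unit_cube x * corr_sq L \<epsilon> h x m \<partial>lebesgue)"
      by (intro nn_integral_cong) (simp add: H_def \<rho>_def indicator_def algebra_simps)
    finally show ?thesis .
  qed
  have gm: "g \<in> borel_measurable lebesgue" using gL2 by (simp add: L2_def)
  have Rm: "(\<lambda>x. indicator unit_cube x * corr_sq L \<epsilon> h x m) \<in> borel_measurable lebesgue" for h m
  proof -
    have "(\<lambda>x. g (x + real_vec l - half_vec h - real_vec m)) \<in> borel_measurable lebesgue" for l
      using borel_measurable_translate[OF gm, of "real_vec l - half_vec h - real_vec m"] by (simp add: algebra_simps)
    then have "(\<lambda>x. corr_sq L \<epsilon> h x m) \<in> borel_measurable lebesgue"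
      using \<epsilon>m by measurable
    then show ?thesis by (intro borel_measurable_times_ennreal borel_measurable_indicator unit_cube_lebesgue)
  qed
  have R: "?R = (\<Sum>h\<in>G. \<integral>\<^sup>+m. ennreal (?n h m) \<partial>count_space UNIV)"
  proof -
    have "?R = (\<integral>\<^sup>+x. (\<Sum>h\<in>G. \<integral>\<^sup>+m. indicator unit_cube x * corr_sq L \<epsilon> h x m \<partial>count_space UNIV) \<partial>lebesgue)"
      by (simp add: sum_distrib_left nn_integral_cmult)
    also have "\<dots> = (\<Sum>h\<in>G. \<integral>\<^sup>+x. (\<integral>\<^sup>+m. indicator unit_cube x * corr_sq L \<epsilon> h x m \<partial>count_space UNIV) \<partial>lebesgue)"
      by (intro nn_integral_sum borel_measurable_count_sum Rm)
    also have "\<dots> = (\<Sum>h\<in>G. \<integral>\<^sup>+m. ennreal (?n h m) \<partial>count_space UNIV)"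
      unfolding Hn by (intro sum.cong refl nn_integral_count_sum_swap Rm)
    finally show ?thesis .
  qed
  have fin: "ennreal (\<Sum>j\<in>F. ?w j) \<le> ennreal (real (card G) ^ 3) * ?R"
    if F: "finite F" "F \<subseteq> wilson_index k G I N g" for F
  proof -
    \<comment> \<open>Enlarging the index set to a box only adds nonnegative terms, and leaves, for
      fixed \<open>l\<close>, \<open>h\<close> and \<open>\<sigma>\<close>, a full sum over
      \<open>\<Gamma>\<close> of coefficients at distinct frequencies, as Bessel's inequality
      requires.\<close>
    define L' where "L' = fst ` F"
    define \<Gamma> where "\<Gamma> = (snd \<circ> snd) ` F"
    have fin: "finite L'" "finite \<Gamma>" using F by (auto simp: L'_def \<Gamma>_def)
    have sub: "F \<subseteq> L' \<times> G \<times> \<Gamma>" using F unfolding wilson_index_def L'_def \<Gamma>_def by force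
    have bes: "(\<Sum>\<gamma>\<in>\<Gamma>. ?b \<mu> \<sigma> \<gamma>) \<le> (l2_norm (H \<mu>))\<^sup>2" for \<mu> \<sigma>
    proof -
      have "inj_on (reflect \<sigma>) \<Gamma>" by (rule inj_on_subset[OF bij_is_inj[OF bij_reflect]]) simp
      then have "(\<Sum>\<gamma>\<in>\<Gamma>. ?b \<mu> \<sigma> \<gamma>) = (\<Sum>\<xi>\<in>reflect \<sigma> ` \<Gamma>. (norm (l2_inner (H \<mu>) (cube_exp \<xi>)))\<^sup>2)"
        by (simp add: sum.reindex)
      also have "\<dots> \<le> (l2_norm (H \<mu>))\<^sup>2"
        by (rule bessel_inequality) (use fin HL in \<open>auto simp: cube_exp_L2 cube_exp_orthonormal\<close>)
      finally show ?thesis .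
    qed
    have "(\<Sum>j\<in>F. ?w j) \<le> (\<Sum>j\<in>L' \<times> G \<times> \<Gamma>. ?w j)"
      using sub fin finite_G by (intro sum_mono2) auto
    also have "\<dots> = (\<Sum>l\<in>L'. \<Sum>h\<in>G. \<Sum>\<gamma>\<in>\<Gamma>. ?w (l, h, \<gamma>))"
      by (simp add: sum.cartesian_product)
    also have "\<dots> \<le> (\<Sum>l\<in>L'. \<Sum>h\<in>G. \<Sum>\<gamma>\<in>\<Gamma>. (real (card G))\<^sup>2 * (\<Sum>\<sigma>\<in>G. ?b (real_vec l + half_vec h) \<sigma> \<gamma>))"
      by (intro sum_mono inner_le)
    also have "\<dots> = (\<Sum>l\<in>L'. \<Sum>h\<in>G. (real (card G))\<^sup>2 * (\<Sum>\<sigma>\<in>G. \<Sum>\<gamma>\<in>\<Gamma>. ?b (real_vec l + half_vec h) \<sigma> \<gamma>))"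
      unfolding sum_distrib_left[symmetric] by (intro sum.cong refl arg_cong[where f = "\<lambda>t. _ * t"] sum.swap)
    also have "\<dots> \<le> (\<Sum>l\<in>L'. \<Sum>h\<in>G. (real (card G))\<^sup>2 * (\<Sum>\<sigma>\<in>G. ?n h l))"
      by (intro sum_mono mult_left_mono bes) auto
    also have "\<dots> = real (card G) ^ 3 * (\<Sum>h\<in>G. \<Sum>l\<in>L'. ?n h l)"
      unfolding sum.swap[of _ L' G] sum_distrib_left
      by (intro sum.cong refl) (simp add: power3_eq_cube power2_eq_square)
    finally have "ennreal (\<Sum>j\<in>F. ?w j) \<le>
       ennreal (real (card G) ^ 3 * (\<Sum>h\<in>G. \<Sum>l\<in>L'. ?n h l))"
      by (rule ennreal_leI)
    also have "\<dots> = ennreal (real (card G) ^ 3) * (\<Sum>h\<in>G. \<Sum>l\<in>L'. ennreal (?n h l))"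
      by (simp add: ennreal_mult sum_nonneg sum_ennreal)
    also have "\<dots> \<le> ennreal (real (card G) ^ 3) * ?R"
      unfolding R
    proof (intro mult_left_mono sum_mono)
      fix h
      have "(\<Sum>l\<in>L'. ennreal (?n h l)) = (\<integral>\<^sup>+m. ennreal (?n h m) \<partial>count_space L')"
        by (rule nn_integral_count_space_finite[OF fin(1), symmetric])
      also have "\<dots> = (\<integral>\<^sup>+m. ennreal (?n h m) * indicator L' m \<partial>count_space UNIV)"
        by (simp add: nn_integral_restrict_space[symmetric] restrict_count_space)
      also have "\<dots> \<le> (\<integral>\<^sup>+m. ennreal (?n h m) \<partial>count_space UNIV)"
        by (intro nn_integral_mono) (simp add: indicator_def)
      finally show "(\<Sum>l\<in>L'. ennreal (?n h l)) \<le> (\<integral>\<^sup>+m. ennreal (?n h m) \<partial>count_space UNIV)" .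
    qed simp
    finally show ?thesis .
  qed
  show ?thesis
  proof (cases "ennreal (real (card G) ^ 3) * ?R = \<infinity>")
    case False
    then obtain r where r: "0 \<le> r" "ennreal (real (card G) ^ 3) * ?R = ennreal r"
      by (cases "ennreal (real (card G) ^ 3) * ?R") auto
    have "a * (l2_norm f)\<^sup>2 \<le> (\<Sum>\<^sub>\<infinity>j\<in>wilson_index k G I N g. ?w j)"
      using fr fL by (simp add: is_frame_def)
    also have "\<dots> \<le> r"
    proof (rule infsum_le_finite_sums)
      show "(\<lambda>j. ?w j) summable_on wilson_index k G I N g"
        using fr fL by (simp add: is_frame_def)
      show "(\<Sum>j\<in>F. ?w j) \<le> r" if "finite F" "F \<subseteq> wilson_index k G I N g" for F
        using fin[OF that] r by simp
    qed
    finally have "ennreal (a * (l2_norm f)\<^sup>2) \<le> ennreal r" by (rule ennreal_leI)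
    then have "ennreal a * ennreal ((l2_norm f)\<^sup>2) \<le> ennreal r" using a by (simp add: ennreal_mult)
    then show ?thesis unfolding fnorm r(2) .
  qed simp
qed

subsection \<open>Lower Riesz bound\<close>

text \<open>The coefficient of the exponential of frequency \<open>\<xi>\<close> in
  \<open>wilson_poly h \<gamma>\<close>. Several \<open>\<sigma>\<close> reach the same frequency
  when \<open>\<gamma>\<close> vanishes on coordinates that they reflect differently, and their
  signs may then cancel.\<close>

definition orbit_coeff :: "int^'n \<Rightarrow> int^'n \<Rightarrow> int^'n \<Rightarrow> complex" where
  "orbit_coeff h \<gamma> \<xi> = (\<Sum>\<sigma> | \<sigma> \<in> G \<and> reflect \<sigma> \<gamma> = \<xi>. wilson_sign h \<gamma> \<sigma>)"

lemma orbit_coeff_outside: "\<xi> \<notin> refl_orbit G \<gamma> \<Longrightarrow> orbit_coeff h \<gamma> \<xi> = 0"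
  by (auto simp: orbit_coeff_def refl_orbit_def intro!: sum.neutral)

text \<open>A sum of signs is an integer. This gives a lower bound uniform in
  \<open>\<gamma>\<close> for all coefficients that do not cancel.\<close>

lemma norm_orbit_coeff_ge:
  assumes "orbit_coeff h \<gamma> \<xi> \<noteq> 0"
  shows "1 \<le> (norm (orbit_coeff h \<gamma> \<xi>))\<^sup>2"
proof -
  define z where "z = (\<Sum>\<sigma> | \<sigma> \<in> G \<and> reflect \<sigma> \<gamma> = \<xi>. if even (int_inner (I h + \<gamma>) \<sigma>) then 1 else - 1 :: int)"
  have z: "orbit_coeff h \<gamma> \<xi> = of_int z"
    unfolding orbit_coeff_def z_def of_int_sum
    by (intro sum.cong refl) (simp add: wilson_sign_def psign_def)
  then have "1 \<le> \<bar>real_of_int z\<bar>" using assms by simp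
  then have "1 \<le> \<bar>real_of_int z\<bar>\<^sup>2" by (rule one_le_power)
  then show ?thesis by (simp add: z)
qed

lemma wilson_poly_orbit:
  assumes "finite \<Xi>" "refl_orbit G \<gamma> \<subseteq> \<Xi>"
  shows "wilson_poly h \<gamma> w = (\<Sum>\<xi>\<in>\<Xi>. orbit_coeff h \<gamma> \<xi> * cis (2 * pi * (w \<bullet> real_vec \<xi>)))"
proof -
  have "wilson_poly h \<gamma> w = (\<Sum>\<xi>\<in>\<Xi>. \<Sum>\<sigma> | \<sigma> \<in> G \<and> reflect \<sigma> \<gamma> = \<xi>. wilson_sign h \<gamma> \<sigma> * cis (2 * pi * (w \<bullet> real_vec (reflect \<sigma> \<gamma>))))"
    unfolding wilson_poly_def
    by (rule sum.group[symmetric]) (use assms finite_G in \<open>auto simp: refl_orbit_def\<close>)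
  also have "\<dots> = (\<Sum>\<xi>\<in>\<Xi>. orbit_coeff h \<gamma> \<xi> * cis (2 * pi * (w \<bullet> real_vec \<xi>)))"
    unfolding orbit_coeff_def sum_distrib_right by (intro sum.cong refl) auto
  finally show ?thesis .
qed

lemma finite_refl_orbit: "finite (refl_orbit G \<gamma>)"
  using finite_G unfolding refl_orbit_def by simp

lemma reflect_mem_orbit_sym:
  assumes "\<xi> \<in> refl_orbit G \<gamma>"
  shows "\<gamma> \<in> refl_orbit G \<xi>"
proof -
  obtain \<sigma> where \<sigma>: "\<sigma> \<in> G" "\<xi> = reflect \<sigma> \<gamma>" using assms by (auto simp: refl_orbit_def)
  have "\<gamma> = reflect \<sigma> \<xi>" unfolding \<sigma>(2) by (simp add: reflect_def vec_eq_iff)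
  then show ?thesis using \<sigma>(1) by (auto simp: refl_orbit_def)
qed

text \<open>Reflections are involutions, so a common point of two orbits puts both elements into the
  intersection of \<open>N\<close> with the orbit of that point, which is a singleton.\<close>

lemma representative_unique:
  assumes N: "\<forall>x. card (N \<inter> refl_orbit G x) = 1" and "\<gamma> \<in> N" "\<gamma>' \<in> N" "\<xi> \<in> refl_orbit G \<gamma>" "\<xi> \<in> refl_orbit G \<gamma>'"
  shows "\<gamma> = \<gamma>'"
proof -
  have "\<gamma> \<in> N \<inter> refl_orbit G \<xi>" "\<gamma>' \<in> N \<inter> refl_orbit G \<xi>" using assms reflect_mem_orbit_sym by blast+
  moreover obtain z where "N \<inter> refl_orbit G \<xi> = {z}" using N card_1_singletonE by metis
  ultimately show ?thesis by simp
qed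

lemma wilson_index_orbit_coeff:
  assumes "(l, h, \<gamma>) \<in> wilson_index k G I N g"
  obtains \<xi> where "\<xi> \<in> refl_orbit G \<gamma>" "orbit_coeff h \<gamma> \<xi> \<noteq> 0"
proof -
  have "\<exists>\<xi>\<in>refl_orbit G \<gamma>. orbit_coeff h \<gamma> \<xi> \<noteq> 0"
  proof (rule ccontr)
    assume "\<not> ?thesis"
    then have "wilson_poly h \<gamma> w = 0" for w
      unfolding wilson_poly_orbit[OF finite_refl_orbit subset_refl] by (intro sum.neutral) auto
    then have "wilson k G I g (l, h, \<gamma>) x = 0" for x by (simp add: wilson_eq)
    then show False using assms by (simp add: wilson_index_def)
  qed
  then show thesis using that by blast
qed

text \<open>Orbits of distinct elements of \<open>N\<close> are disjoint, so every
  \<open>\<gamma>\<close> with \<open>d \<gamma> \<noteq> 0\<close> owns a frequency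
  \<open>p \<gamma>\<close> at which no other polynomial contributes. By orthonormality the integral
  is the sum of the squared coefficients over all frequencies, and those at the points
  \<open>p \<gamma>\<close> already suffice.\<close>

lemma trig_norm_lower:
  assumes N: "\<forall>x. card (N \<inter> refl_orbit G x) = 1" and \<Gamma>: "finite \<Gamma>" "\<Gamma> \<subseteq> N"
    and d: "\<And>\<gamma>. \<gamma> \<in> \<Gamma> \<Longrightarrow> d \<gamma> \<noteq> 0 \<Longrightarrow> \<exists>\<xi>\<in>refl_orbit G \<gamma>. orbit_coeff h \<gamma> \<xi> \<noteq> 0"
  shows "ennreal (\<Sum>\<gamma>\<in>\<Gamma>. (norm (d \<gamma>))\<^sup>2) \<le>
    (\<integral>\<^sup>+x. indicator unit_cube x * ennreal ((norm (\<Sum>\<gamma>\<in>\<Gamma>. d \<gamma> * wilson_poly h \<gamma> (x - half_vec h)))\<^sup>2) \<partial>lebesgue)"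
proof -
  define \<Xi> where "\<Xi> = (\<Union>\<gamma>\<in>\<Gamma>. refl_orbit G \<gamma>)"
  have \<Xi>: "finite \<Xi>" unfolding \<Xi>_def using \<Gamma> finite_refl_orbit by blast
  \<comment> \<open>The shift of the argument by \<open>half_vec h\<close> amounts to this sign,
    which does not affect the modulus.\<close>
  define e where "e = (\<lambda>\<gamma>. d \<gamma> * psign (int_inner \<gamma> h))"
  define c where "c = (\<lambda>\<xi>. \<Sum>\<gamma>\<in>\<Gamma>. e \<gamma> * orbit_coeff h \<gamma> \<xi>)"
  have sh: "wilson_poly h \<gamma> (x - half_vec h) = psign (int_inner \<gamma> h) * wilson_poly h \<gamma> x" for \<gamma> x
    using wilson_poly_half_shift[of h \<gamma> "x - half_vec h" h] psign_self[of "int_inner \<gamma> h"]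
    by (simp add: mult.assoc[symmetric])
  have eq: "indicator unit_cube x * (\<Sum>\<gamma>\<in>\<Gamma>. d \<gamma> * wilson_poly h \<gamma> (x - half_vec h)) = (\<Sum>\<xi>\<in>\<Xi>. c \<xi> * cube_exp \<xi> x)" for x
  proof -
    have "(\<Sum>\<gamma>\<in>\<Gamma>. d \<gamma> * wilson_poly h \<gamma> (x - half_vec h)) = (\<Sum>\<gamma>\<in>\<Gamma>. e \<gamma> * wilson_poly h \<gamma> x)"
      unfolding sh e_def by (simp only: mult.assoc)
    also have "\<dots> = (\<Sum>\<gamma>\<in>\<Gamma>. \<Sum>\<xi>\<in>\<Xi>. e \<gamma> * (orbit_coeff h \<gamma> \<xi> * cis (2 * pi * (x \<bullet> real_vec \<xi>))))"
    proof (intro sum.cong refl)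
      fix \<gamma> assume "\<gamma> \<in> \<Gamma>"
      then have "refl_orbit G \<gamma> \<subseteq> \<Xi>" by (auto simp: \<Xi>_def)
      from wilson_poly_orbit[OF \<Xi> this]
      show "e \<gamma> * wilson_poly h \<gamma> x = (\<Sum>\<xi>\<in>\<Xi>. e \<gamma> * (orbit_coeff h \<gamma> \<xi> * cis (2 * pi * (x \<bullet> real_vec \<xi>))))"
        by (simp only: sum_distrib_left)
    qed
    also have "\<dots> = (\<Sum>\<xi>\<in>\<Xi>. c \<xi> * cis (2 * pi * (x \<bullet> real_vec \<xi>)))"
      unfolding c_def sum_distrib_right by (subst sum.swap) (simp only: mult.assoc)
    finally show ?thesis by (simp add: cube_exp_def sum_distrib_left ac_simps)
  qed
  have "(\<integral>\<^sup>+x. indicator unit_cube x * ennreal ((norm (\<Sum>\<gamma>\<in>\<Gamma>. d \<gamma> * wilson_poly h \<gamma> (x - half_vec h)))\<^sup>2) \<partial>lebesgue) =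
      (\<integral>\<^sup>+x. ennreal ((norm (\<Sum>\<xi>\<in>\<Xi>. c \<xi> * cube_exp \<xi> x))\<^sup>2) \<partial>lebesgue)"
    unfolding eq[symmetric] by (intro nn_integral_cong) (simp add: indicator_def)
  also have "\<dots> = ennreal ((l2_norm (\<lambda>x. \<Sum>\<xi>\<in>\<Xi>. c \<xi> * cube_exp \<xi> x))\<^sup>2)"
  proof -
    have "(\<lambda>x. \<Sum>\<xi>\<in>\<Xi>. c \<xi> * cube_exp \<xi> x) \<in> L2" by (intro L2_lincomb \<Xi> cube_exp_L2)
    then show ?thesis by (simp add: l2_norm_sq nn_integral_eq_integral L2_def)
  qed
  also have "(l2_norm (\<lambda>x. \<Sum>\<xi>\<in>\<Xi>. c \<xi> * cube_exp \<xi> x))\<^sup>2 = (\<Sum>\<xi>\<in>\<Xi>. (norm (c \<xi>))\<^sup>2)"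
    by (rule l2_norm_orthonormal_lincomb) (auto simp: \<Xi> cube_exp_L2 cube_exp_orthonormal)
  finally have norm_eq: "(\<integral>\<^sup>+x. indicator unit_cube x * ennreal ((norm (\<Sum>\<gamma>\<in>\<Gamma>. d \<gamma> * wilson_poly h \<gamma> (x - half_vec h)))\<^sup>2) \<partial>lebesgue) =
      ennreal (\<Sum>\<xi>\<in>\<Xi>. (norm (c \<xi>))\<^sup>2)" .
  define \<Gamma>' where "\<Gamma>' = {\<gamma> \<in> \<Gamma>. d \<gamma> \<noteq> 0}"
  obtain p where p: "\<And>\<gamma>. \<gamma> \<in> \<Gamma>' \<Longrightarrow> p \<gamma> \<in> refl_orbit G \<gamma> \<and> orbit_coeff h \<gamma> (p \<gamma>) \<noteq> 0"
    using d unfolding \<Gamma>'_def by (metis (mono_tags, lifting) mem_Collect_eq)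
  have inj: "inj_on p \<Gamma>'"
  proof (rule inj_onI)
    fix \<gamma> \<gamma>' assume g: "\<gamma> \<in> \<Gamma>'" "\<gamma>' \<in> \<Gamma>'" and e: "p \<gamma> = p \<gamma>'"
    then have "\<gamma> \<in> N" "\<gamma>' \<in> N" using \<Gamma> by (auto simp: \<Gamma>'_def)
    then show "\<gamma> = \<gamma>'" using representative_unique[OF N, of \<gamma> \<gamma>' "p \<gamma>"] p[OF g(1)] p[OF g(2)] e by simp
  qed
  have cp: "c (p \<gamma>) = e \<gamma> * orbit_coeff h \<gamma> (p \<gamma>)" if "\<gamma> \<in> \<Gamma>'" for \<gamma>
  proof -
    have "e \<gamma>' * orbit_coeff h \<gamma>' (p \<gamma>) = 0" if "\<gamma>' \<in> \<Gamma> - {\<gamma>}" for \<gamma>'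
    proof -
      have "p \<gamma> \<notin> refl_orbit G \<gamma>'"
        using representative_unique[OF N, of \<gamma> \<gamma>' "p \<gamma>"] p[OF \<open>\<gamma> \<in> \<Gamma>'\<close>] that \<open>\<gamma> \<in> \<Gamma>'\<close> \<Gamma>(2) by (auto simp: \<Gamma>'_def)
      then show ?thesis by (simp add: orbit_coeff_outside)
    qed
    then have "(\<Sum>\<gamma>'\<in>\<Gamma> - {\<gamma>}. e \<gamma>' * orbit_coeff h \<gamma>' (p \<gamma>)) = 0" by (intro sum.neutral) blast
    then show ?thesis unfolding c_def using \<Gamma>(1) that
      by (subst sum.remove[of _ \<gamma>]) (simp_all add: \<Gamma>'_def)
  qed
  have "(\<Sum>\<gamma>\<in>\<Gamma>. (norm (d \<gamma>))\<^sup>2) = (\<Sum>\<gamma>\<in>\<Gamma>'. (norm (d \<gamma>))\<^sup>2)"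
    unfolding \<Gamma>'_def using \<Gamma>(1) by (intro sum.mono_neutral_right) auto
  also have "\<dots> \<le> (\<Sum>\<gamma>\<in>\<Gamma>'. (norm (c (p \<gamma>)))\<^sup>2)"
  proof (rule sum_mono)
    fix \<gamma> assume g: "\<gamma> \<in> \<Gamma>'"
    have "(norm (d \<gamma>))\<^sup>2 * 1 \<le> (norm (d \<gamma>))\<^sup>2 * (norm (orbit_coeff h \<gamma> (p \<gamma>)))\<^sup>2"
      using norm_orbit_coeff_ge p[OF g] by (intro mult_left_mono) auto
    then show "(norm (d \<gamma>))\<^sup>2 \<le> (norm (c (p \<gamma>)))\<^sup>2"
      by (simp add: cp[OF g] norm_mult power_mult_distrib e_def psign_def)
  qed
  also have "\<dots> = (\<Sum>\<xi>\<in>p ` \<Gamma>'. (norm (c \<xi>))\<^sup>2)" by (simp add: sum.reindex[OF inj])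
  also have "\<dots> \<le> (\<Sum>\<xi>\<in>\<Xi>. (norm (c \<xi>))\<^sup>2)"
    using p by (intro sum_mono2 \<Xi>) (auto simp: \<Xi>_def \<Gamma>'_def)
  finally show ?thesis unfolding norm_eq by (rule ennreal_leI)
qed

text \<open>Origin of the constant: \<open>4 ^ k\<close> because the square of
  \<open>wilson_const\<close> is at least \<open>1 / 4 ^ k\<close>, three factors
  \<open>card G\<close> from \<open>frame_lower_cube\<close>, and a fourth from averaging over
  \<open>G\<close> in \<open>wilson_lincomb_norm\<close>.\<close>

theorem wilson_lower_riesz:
  assumes N: "\<forall>x. card (N \<inter> refl_orbit G x) = 1"
    and fr: "is_frame (wilson_index k G I N g) (wilson k G I g) a b"
    and F: "finite F" "F \<subseteq> wilson_index k G I N g"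
  shows "a / (4 ^ k * real (card G) ^ 4) * (\<Sum>j\<in>F. (norm (c j))\<^sup>2) \<le> (l2_norm (\<lambda>x. \<Sum>j\<in>F. c j * wilson k G I g j x))\<^sup>2"
proof -
  have a: "0 < a" and wL: "\<And>j. j \<in> F \<Longrightarrow> wilson k G I g j \<in> L2"
    using fr F by (auto simp: is_frame_def)
  define L where "L = fst ` F"
  define \<Gamma> where "\<Gamma> = (snd \<circ> snd) ` F"
  have L: "finite L" and \<Gamma>: "finite \<Gamma>" "\<Gamma> \<subseteq> N" using F by (auto simp: L_def \<Gamma>_def wilson_index_def)
  have sub: "F \<subseteq> L \<times> G \<times> \<Gamma>" using F unfolding wilson_index_def L_def \<Gamma>_def by force
  \<comment> \<open>Extending by zero to a box adds triples that may have been removed from the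
    system. This is harmless because \<open>trig_norm_lower\<close> demands a nonvanishing orbit
    coefficient only where the coefficient itself is nonzero.\<close>
  define c' where "c' = (\<lambda>j. if j \<in> F then c j else 0)"
  let ?F = "\<lambda>x. \<Sum>(l, h)\<in>L \<times> G. \<Sum>\<gamma>\<in>\<Gamma>. c' (l, h, \<gamma>) * wilson k G I g (l, h, \<gamma>) x"
  have triple: "(\<Sum>(l, h)\<in>L \<times> G. \<Sum>\<gamma>\<in>\<Gamma>. t (l, h, \<gamma>)) = (\<Sum>j\<in>L \<times> G \<times> \<Gamma>. t j)" for t :: "_ \<Rightarrow> 'z::comm_monoid_add"
    by (simp add: sum.cartesian_product')
  have Feq: "(\<Sum>j\<in>F. c j * wilson k G I g j x) = ?F x" for x
    unfolding triple[of "\<lambda>j. c' j * wilson k G I g j x"] unfolding c'_def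
    by (rule sum.mono_neutral_cong_left) (use L finite_G \<Gamma> sub in auto)
  have FL: "?F \<in> L2" unfolding Feq[symmetric] using F(1) wL by (rule L2_lincomb)
  define E where "E = (\<lambda>l h x. \<Sum>\<gamma>\<in>\<Gamma>. c' (l, h, \<gamma>) * of_real (wilson_const k G \<gamma>) * wilson_poly h \<gamma> (x - half_vec h))"
  define R where "R = (\<lambda>h. \<integral>\<^sup>+x. indicator unit_cube x * (\<Sum>\<sigma>\<in>G. \<integral>\<^sup>+m.
       corr_sq L (\<lambda>l. E l h) \<sigma> x m \<partial>count_space UNIV) \<partial>lebesgue)"
  have up: "of_nat (card G) * ennreal ((l2_norm ?F)\<^sup>2) = (\<Sum>h\<in>G. R h)"
    unfolding R_def E_def by (rule wilson_lincomb_norm[OF L FL])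
  have Em: "(\<lambda>x. E l h x) \<in> borel_measurable lebesgue" for l h
    unfolding E_def by (intro borel_measurable_sum borel_measurable_times wilson_poly_measurable) auto
  have EB: "norm (E l h x) \<le> (\<Sum>\<gamma>\<in>\<Gamma>. norm (c' (l, h, \<gamma>) * of_real (wilson_const k G \<gamma>)) * real (card G))" for l h x
    unfolding E_def
    by (rule order_trans[OF norm_sum]) (intro sum_mono, subst norm_mult, intro mult_left_mono norm_wilson_poly_le norm_ge_zero)
  have low: "ennreal a * (\<integral>\<^sup>+x. indicator unit_cube x * (\<Sum>l\<in>L. ennreal ((norm (E l h x))\<^sup>2)) \<partial>lebesgue) \<le> ennreal (real (card G) ^ 3) * R h" for h
    unfolding R_def by (rule frame_lower_cube[OF fr L Em EB])
  have trig: "ennreal ((1 / 2 ^ k)\<^sup>2 * (\<Sum>\<gamma>\<in>\<Gamma>. (norm (c' (l, h, \<gamma>)))\<^sup>2)) \<le> (\<integral>\<^sup>+x. indicator unit_cube x * ennreal ((norm (E l h x))\<^sup>2) \<partial>lebesgue)" for l h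
  proof -
    let ?d = "\<lambda>\<gamma>. c' (l, h, \<gamma>) * of_real (wilson_const k G \<gamma>)"
    have "(1 / 2 ^ k)\<^sup>2 * (\<Sum>\<gamma>\<in>\<Gamma>. (norm (c' (l, h, \<gamma>)))\<^sup>2) \<le> (\<Sum>\<gamma>\<in>\<Gamma>. (norm (?d \<gamma>))\<^sup>2)"
      unfolding sum_distrib_left norm_mult power_mult_distrib norm_of_real power2_abs
      by (intro sum_mono) (subst mult.commute, intro mult_left_mono wilson_const_sq_ge zero_le_power2)
    then have "ennreal ((1 / 2 ^ k)\<^sup>2 * (\<Sum>\<gamma>\<in>\<Gamma>. (norm (c' (l, h, \<gamma>)))\<^sup>2)) \<le> ennreal (\<Sum>\<gamma>\<in>\<Gamma>. (norm (?d \<gamma>))\<^sup>2)"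
      by (rule ennreal_leI)
    also have "\<dots> \<le> (\<integral>\<^sup>+x. indicator unit_cube x * ennreal ((norm (E l h x))\<^sup>2) \<partial>lebesgue)"
      unfolding E_def
    proof (rule trig_norm_lower[OF N \<Gamma>])
      fix \<gamma> assume "\<gamma> \<in> \<Gamma>" "?d \<gamma> \<noteq> 0"
      then have "(l, h, \<gamma>) \<in> wilson_index k G I N g" using F(2) by (auto simp: c'_def split: if_splits)
      then show "\<exists>\<xi>\<in>refl_orbit G \<gamma>. orbit_coeff h \<gamma> \<xi> \<noteq> 0" using wilson_index_orbit_coeff by metis
    qed
    finally show ?thesis .
  qed
  let ?q = "(1 / 2 ^ k)\<^sup>2 :: real"
  have sumE: "ennreal (?q * (\<Sum>l\<in>L. \<Sum>\<gamma>\<in>\<Gamma>. (norm (c' (l, h, \<gamma>)))\<^sup>2)) \<le> (\<integral>\<^sup>+x. indicator unit_cube x * (\<Sum>l\<in>L. ennreal ((norm (E l h x))\<^sup>2)) \<partial>lebesgue)" for h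
  proof -
    have "ennreal (?q * (\<Sum>l\<in>L. \<Sum>\<gamma>\<in>\<Gamma>. (norm (c' (l, h, \<gamma>)))\<^sup>2)) = (\<Sum>l\<in>L. ennreal (?q * (\<Sum>\<gamma>\<in>\<Gamma>. (norm (c' (l, h, \<gamma>)))\<^sup>2)))"
      unfolding sum_distrib_left[of ?q _ L] by (rule sum_ennreal[symmetric]) (auto intro!: mult_nonneg_nonneg sum_nonneg)
    also have "\<dots> \<le> (\<Sum>l\<in>L. \<integral>\<^sup>+x. indicator unit_cube x * ennreal ((norm (E l h x))\<^sup>2) \<partial>lebesgue)"
      by (intro sum_mono trig)
    also have "\<dots> = (\<integral>\<^sup>+x. indicator unit_cube x * (\<Sum>l\<in>L. ennreal ((norm (E l h x))\<^sup>2)) \<partial>lebesgue)"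
      unfolding sum_distrib_left
      by (intro nn_integral_sum[symmetric] borel_measurable_times_ennreal borel_measurable_indicator unit_cube_lebesgue)
        (use Em in measurable)
    finally show ?thesis .
  qed
  have total: "(\<Sum>j\<in>F. (norm (c j))\<^sup>2) = (\<Sum>h\<in>G. \<Sum>l\<in>L. \<Sum>\<gamma>\<in>\<Gamma>. (norm (c' (l, h, \<gamma>)))\<^sup>2)"
  proof -
    have "(\<Sum>j\<in>F. (norm (c j))\<^sup>2) = (\<Sum>j\<in>L \<times> G \<times> \<Gamma>. (norm (c' j))\<^sup>2)"
      unfolding c'_def by (rule sum.mono_neutral_cong_left) (use L finite_G \<Gamma> sub in auto)
    also have "\<dots> = (\<Sum>l\<in>L. \<Sum>h\<in>G. \<Sum>\<gamma>\<in>\<Gamma>. (norm (c' (l, h, \<gamma>)))\<^sup>2)"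
      using triple[of "\<lambda>j. (norm (c' j))\<^sup>2"] sum.cartesian_product[of "\<lambda>l h. \<Sum>\<gamma>\<in>\<Gamma>. (norm (c' (l, h, \<gamma>)))\<^sup>2" G L]
      by simp
    finally show ?thesis by (simp only: sum.swap[of _ L G])
  qed
  have "ennreal (a * (?q * (\<Sum>j\<in>F. (norm (c j))\<^sup>2))) =
     (\<Sum>h\<in>G. ennreal a * ennreal (?q * (\<Sum>l\<in>L. \<Sum>\<gamma>\<in>\<Gamma>. (norm (c' (l, h, \<gamma>)))\<^sup>2)))"
  proof -
    have nn: "0 \<le> ?q * (\<Sum>l\<in>L. \<Sum>\<gamma>\<in>\<Gamma>. (norm (c' (l, h, \<gamma>)))\<^sup>2)" for h
      by (intro mult_nonneg_nonneg sum_nonneg) auto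
    have "(\<Sum>h\<in>G. ennreal a * ennreal (?q * (\<Sum>l\<in>L. \<Sum>\<gamma>\<in>\<Gamma>. (norm (c' (l, h, \<gamma>)))\<^sup>2))) =
        (\<Sum>h\<in>G. ennreal (a * (?q * (\<Sum>l\<in>L. \<Sum>\<gamma>\<in>\<Gamma>. (norm (c' (l, h, \<gamma>)))\<^sup>2))))"
      using a nn by (simp only: ennreal_mult less_imp_le)
    also have "\<dots> = ennreal (\<Sum>h\<in>G. a * (?q * (\<Sum>l\<in>L. \<Sum>\<gamma>\<in>\<Gamma>. (norm (c' (l, h, \<gamma>)))\<^sup>2)))"
      by (rule sum_ennreal) (intro mult_nonneg_nonneg nn less_imp_le[OF a])
    finally show ?thesis unfolding total sum_distrib_left[symmetric] by simp
  qed
  also have "\<dots> \<le> (\<Sum>h\<in>G. ennreal (real (card G) ^ 3) * R h)"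
    by (intro sum_mono order_trans[OF mult_left_mono[OF sumE] low]) simp
  also have "\<dots> = ennreal (real (card G) ^ 3) * (of_nat (card G) * ennreal ((l2_norm ?F)\<^sup>2))"
    unfolding up sum_distrib_left ..
  also have "\<dots> = ennreal (real (card G) ^ 3 * (real (card G) * (l2_norm ?F)\<^sup>2))"
    by (simp only: ennreal_of_nat_eq_real_of_nat ennreal_mult of_nat_0_le_iff zero_le_power zero_le_power2 mult_nonneg_nonneg)
  also have "real (card G) ^ 3 * (real (card G) * (l2_norm ?F)\<^sup>2) = real (card G) ^ 4 * (l2_norm ?F)\<^sup>2"
    by (simp only: power4_eq_xxxx power3_eq_cube mult.assoc)
  finally have "a * (?q * (\<Sum>j\<in>F. (norm (c j))\<^sup>2)) \<le> real (card G) ^ 4 * (l2_norm ?F)\<^sup>2"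
    by (subst (asm) ennreal_le_iff) auto
  moreover have "0 < real (card G)" using finite_G zero_mem_G by (auto simp: card_gt_0_iff)
  moreover have "?q = 1 / 4 ^ k" by (simp add: power_divide power_mult_distrib[symmetric] power2_eq_square)
  ultimately show ?thesis unfolding Feq by (simp add: field_simps)
qed

end

theorem corollary4p6:
  fixes G N :: "(int^'n) set" and k :: nat and s :: "nat \<Rightarrow> int^'n"
    and I :: "int^'n \<Rightarrow> int^'n" and g g_hat :: "real^'n \<Rightarrow> complex" and a b :: real
  assumes "separable_generators G k s"
    and "dual_iso_rep G k s I"
    and "\<forall>x. card (N \<inter> refl_orbit G x) = 1"
    and "g \<in> L2"
    and "separable_fun k s g"
    and "has_fourier_L2 g g_hat"
    and "AE \<omega> in lebesgue. g_hat \<omega> = cnj (g_hat \<omega>)"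
    and "is_frame (wilson_index k G I N g) (wilson k G I g) a b"
  shows "is_riesz_basis (wilson_index k G I N g) (wilson k G I g) a b"
proof (cases "AE x in lebesgue. g x = 0")
  case True
  \<comment> \<open>A window that vanishes almost everywhere leaves an empty system. This case
    stands apart because the swap identity is derived from points where \<open>g\<close> is
    nonzero.\<close>
  have "AE x in lebesgue. wilson k G I g j x = 0" for j
  proof -
    obtain l h \<gamma> where j: "j = (l, h, \<gamma>)" by (cases j)
    have "AE x in lebesgue. g (x + (- real_vec l - (1/2) *\<^sub>R real_vec h)) = 0"
      by (rule AE_translate[OF True])
    then show ?thesis
      unfolding j wilson_def translate_def modulate_def by eventually_elim (simp add: algebra_simps)
  qed
  then have "wilson_index k G I N g = {}" by (simp add: wilson_index_def)
  then show ?thesis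
    using assms(8) by (intro frame_riesz_basis[where ?a0.0 = 1]) (auto simp: l2_norm_sq)
next
  case False
  interpret separable_group G k s by unfold_locales (rule assms(1))
  have "AE x in lebesgue. g (- x) = cnj (g x)"
    by (rule has_fourier_L2_real_imp_symmetric[OF assms(6,7)])
  from separable_swap_reflect[OF assms(5) this False] obtain X where X: "AE x in lebesgue. x \<in> X"
    "\<And>\<sigma> p q. \<sigma> \<in> G \<Longrightarrow> p \<in> X \<Longrightarrow> q \<in> X \<Longrightarrow>
       g p * cnj (g q) = g (swap_reflect \<sigma> p q) * cnj (g (swap_reflect \<sigma> q p))" by blast
  interpret symmetric_window G k s I g X
    by unfold_locales (use assms X in auto)
  have "0 < real (card G)" using finite_G zero_mem_G by (auto simp: card_gt_0_iff)
  then have "0 < a / (4 ^ k * real (card G) ^ 4)" using assms(8) by (simp add: is_frame_def)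
  then show ?thesis
    by (rule frame_riesz_basis[OF assms(8)]) (rule wilson_lower_riesz[OF assms(3,8)])
qed

end
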